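(* Let $(M,\mu)$, $(N,\nu)$ be measure spaces (real scalars), $B_0=B(L^\infty(d\nu),L^\infty(d\mu))$, $B_1=B(L^1(d\nu),L^1(d\mu))$, viewed as a compatible couple of operators from $L^\infty(d\nu)\cap L^1(d\nu)$ to $L^\infty(d\mu)+L^1(d\mu)$. Let $0<\theta<1$ and $p=1/\theta$. Then $$(B_0,B_1)_{\theta,\infty}=B_r\big(L^{p,1}(d\nu),L^{p,\infty}(d\mu)\big)$$ with equivalent norms (an operator on $L^{p,1}(d\nu)$ being identified with its restriction to $L^\infty(d\nu)\cap L^1(d\nu)$).
   Context: $B(X,Y)$ denotes bounded linear operators. For a compatible couple $(A_0,A_1)$, $K_t(x;A_0,A_1)=\inf\{\|x_0\|_{A_0}+t\|x_1\|_{A_1}:x=x_0+x_1\}$ and $(A_0,A_1)_{\theta,\infty}$ is the space of $x\in A_0+A_1$ with $\|x\|_{\theta,\infty}=\sup_{t>0}t^{-\theta}K_t(x;A_0,A_1)<\infty$. For a nonnegative measurable $g$, $g^*$ is its nonincreasing rearrangement, $\|g\|_{L^{p,\infty}}=\sup_{s>0}s^{1/p}g^*(s)$ and $\|g\|_{L^{p,1}}=\int_0^\infty s^{1/p}g^*(s)\,ds/s$. For Banach lattices $L,\Lambda$, a bounded operator $u:L\to\Lambda$ is regular if there is a positive operator $v:L\to\Lambda$ with $|u(x)|\le v(|x|)$ for all $x\in L$; $\|u\|_r=\inf\|v\|$ over such $v$, and $B_r(L,\Lambda)$ is the space of regular operators with this norm.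
   Formalization: If ν is infinite, B(L^∞(dν),L^∞(dμ)) need not embed in operators on L^∞∩L^1 (Banach limits restrict to 0), so B_0 is taken as the linear operators on L^∞(dν)∩L^1(dν) bounded from the L^∞(dν)-norm to L^∞(dμ), normed by that bound; an extension to all of L^∞(dν) is not asserted. *)

theory Defs
  imports "HOL-Analysis.Analysis"
begin

text \<open>Function spaces are represented by real-valued measurable functions, with all
  identities understood almost everywhere. Norms take values in ennreal
  (infinite norm = not in the space).\<close>

definition Linf_norm :: "'a measure \<Rightarrow> ('a \<Rightarrow> real) \<Rightarrow> ennreal" where
  "Linf_norm M f = Inf {C. AE x in M. ennreal \<bar>f x\<bar> \<le> C}"

definition L1_norm :: "'a measure \<Rightarrow> ('a \<Rightarrow> real) \<Rightarrow> ennreal" where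
  "L1_norm M f = (\<integral>\<^sup>+ x. ennreal \<bar>f x\<bar> \<partial>M)"

definition rearr :: "'a measure \<Rightarrow> ('a \<Rightarrow> real) \<Rightarrow> real \<Rightarrow> ennreal" where
  "rearr M g s = Inf {ennreal l | l. 0 \<le> l \<and>
       emeasure M {x \<in> space M. \<bar>g x\<bar> > l} \<le> ennreal s}"

definition lorentz_inf_norm :: "'a measure \<Rightarrow> real \<Rightarrow> ('a \<Rightarrow> real) \<Rightarrow> ennreal" where
  "lorentz_inf_norm M p g = (SUP s\<in>{0<..}. ennreal (s powr (1/p)) * rearr M g s)"

definition lorentz_1_norm :: "'a measure \<Rightarrow> real \<Rightarrow> ('a \<Rightarrow> real) \<Rightarrow> ennreal" where
  "lorentz_1_norm M p g =
     (\<integral>\<^sup>+ s. indicator {0<..} s * ennreal (s powr (1/p) / s) * rearr M g s \<partial>lborel)"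

definition Lpinf :: "'a measure \<Rightarrow> real \<Rightarrow> ('a \<Rightarrow> real) set" where
  "Lpinf M p = {g \<in> borel_measurable M. lorentz_inf_norm M p g < top}"

definition Lp1 :: "'a measure \<Rightarrow> real \<Rightarrow> ('a \<Rightarrow> real) set" where
  "Lp1 M p = {g \<in> borel_measurable M. lorentz_1_norm M p g < top}"

definition Dint :: "'a measure \<Rightarrow> ('a \<Rightarrow> real) set" where
  "Dint M = {f \<in> borel_measurable M. Linf_norm M f < top \<and> L1_norm M f < top}"

definition Ssum :: "'a measure \<Rightarrow> ('a \<Rightarrow> real) set" where
  "Ssum M = {g \<in> borel_measurable M. \<exists>g0 g1. g0 \<in> borel_measurable M \<and> g1 \<in> borel_measurable M
      \<and> Linf_norm M g0 < top \<and> L1_norm M g1 < top \<and> (AE x in M. g x = g0 x + g1 x)}"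

definition lin_op_on ::
  "'b measure \<Rightarrow> 'a measure \<Rightarrow> ('b \<Rightarrow> real) set \<Rightarrow> (('b \<Rightarrow> real) \<Rightarrow> ('a \<Rightarrow> real)) \<Rightarrow> bool" where
  "lin_op_on N M S T \<longleftrightarrow>
     (\<forall>f\<in>S. T f \<in> borel_measurable M) \<and>
     (\<forall>f\<in>S. \<forall>g\<in>S. (AE y in N. f y = g y) \<longrightarrow> (AE x in M. T f x = T g x)) \<and>
     (\<forall>f\<in>S. \<forall>g\<in>S. \<forall>a b::real.
        AE x in M. T (\<lambda>y. a * f y + b * g y) x = a * T f x + b * T g x)"

definition amb_op :: "'b measure \<Rightarrow> 'a measure \<Rightarrow> (('b \<Rightarrow> real) \<Rightarrow> ('a \<Rightarrow> real)) \<Rightarrow> bool" where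
  "amb_op N M T \<longleftrightarrow> lin_op_on N M (Dint N) T \<and> (\<forall>f\<in>Dint N. T f \<in> Ssum M)"

definition B0_norm :: "'b measure \<Rightarrow> 'a measure \<Rightarrow> (('b \<Rightarrow> real) \<Rightarrow> ('a \<Rightarrow> real)) \<Rightarrow> ennreal" where
  "B0_norm N M T = Inf {C. \<forall>f\<in>Dint N. Linf_norm M (T f) \<le> C * Linf_norm N f}"

definition B1_norm :: "'b measure \<Rightarrow> 'a measure \<Rightarrow> (('b \<Rightarrow> real) \<Rightarrow> ('a \<Rightarrow> real)) \<Rightarrow> ennreal" where
  "B1_norm N M T = Inf {C. \<forall>f\<in>Dint N. L1_norm M (T f) \<le> C * L1_norm N f}"

definition Kfun :: "'b measure \<Rightarrow> 'a measure \<Rightarrow> real \<Rightarrow> (('b \<Rightarrow> real) \<Rightarrow> ('a \<Rightarrow> real)) \<Rightarrow> ennreal" where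
  "Kfun N M t T = Inf {B0_norm N M T0 + ennreal t * B1_norm N M T1 | T0 T1.
      amb_op N M T0 \<and> amb_op N M T1 \<and>
      (\<forall>f\<in>Dint N. AE x in M. T f x = T0 f x + T1 f x)}"

text \<open>Norm of (B_0,B_1)_{theta,infty}; infinite iff T is not in the space.\<close>
definition interp_norm :: "'b measure \<Rightarrow> 'a measure \<Rightarrow> real \<Rightarrow> (('b \<Rightarrow> real) \<Rightarrow> ('a \<Rightarrow> real)) \<Rightarrow> ennreal" where
  "interp_norm N M \<theta> T = (SUP t\<in>{0<..}. ennreal (t powr (-\<theta>)) * Kfun N M t T)"

definition lor_opnorm :: "'b measure \<Rightarrow> 'a measure \<Rightarrow> real \<Rightarrow> (('b \<Rightarrow> real) \<Rightarrow> ('a \<Rightarrow> real)) \<Rightarrow> ennreal" where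
  "lor_opnorm N M p u = Inf {C. \<forall>f\<in>Lp1 N p. lorentz_inf_norm M p (u f) \<le> C * lorentz_1_norm N p f}"

definition lor_bdd_op :: "'b measure \<Rightarrow> 'a measure \<Rightarrow> real \<Rightarrow> (('b \<Rightarrow> real) \<Rightarrow> ('a \<Rightarrow> real)) \<Rightarrow> bool" where
  "lor_bdd_op N M p u \<longleftrightarrow> lin_op_on N M (Lp1 N p) u \<and> lor_opnorm N M p u < top"

definition positive_op :: "'b measure \<Rightarrow> 'a measure \<Rightarrow> ('b \<Rightarrow> real) set \<Rightarrow> (('b \<Rightarrow> real) \<Rightarrow> ('a \<Rightarrow> real)) \<Rightarrow> bool" where
  "positive_op N M S v \<longleftrightarrow> (\<forall>f\<in>S. (AE y in N. 0 \<le> f y) \<longrightarrow> (AE x in M. 0 \<le> v f x))"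

definition regular_norm :: "'b measure \<Rightarrow> 'a measure \<Rightarrow> real \<Rightarrow> (('b \<Rightarrow> real) \<Rightarrow> ('a \<Rightarrow> real)) \<Rightarrow> ennreal" where
  "regular_norm N M p u = Inf {lor_opnorm N M p v | v.
      lor_bdd_op N M p v \<and> positive_op N M (Lp1 N p) v \<and>
      (\<forall>f\<in>Lp1 N p. AE x in M. \<bar>u f x\<bar> \<le> v (\<lambda>y. \<bar>f y\<bar>) x)}"

text \<open>Norm in B_r(L^{p,1},L^{p,infty}) of an operator T on L^infty cap L^1, identified with
  the regular operators on L^{p,1} whose restriction to L^infty cap L^1 is T
  (infinite iff there is none).\<close>
definition Br_norm :: "'b measure \<Rightarrow> 'a measure \<Rightarrow> real \<Rightarrow> (('b \<Rightarrow> real) \<Rightarrow> ('a \<Rightarrow> real)) \<Rightarrow> ennreal" where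
  "Br_norm N M p T = Inf {regular_norm N M p u | u.
      lor_bdd_op N M p u \<and> (\<forall>f\<in>Dint N. AE x in M. u f x = T f x)}"

end

theory Submission
  imports Defs
begin

text \<open>
  Write \<open>a = t\<^bsup>\<theta>\<^esup>\<close> and \<open>b = t\<^bsup>\<theta>-1\<^esup>\<close>.

  If \<open>T = T0 + T1\<close> with \<open>B0\<close>-norm of \<open>T0\<close> at most \<open>K a\<close> and \<open>B1\<close>-norm of \<open>T1\<close> at most \<open>K b\<close>, then for
  nonnegative \<open>f\<^sub>1, \<dots>, f\<^sub>k\<close> with sum \<open>f\<close> the function \<open>\<Sum>\<^sub>i (T f\<^sub>i)\<^sup>+\<close> is a sum of a function bounded by
  \<open>K a\<close> times the sup norm of \<open>f\<close> and one with integral at most \<open>K b\<close> times that of \<open>f\<close>.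
  Optimizing over \<open>t\<close> gives a weak type bound, uniformly in the decomposition of \<open>f\<close>, and cutting \<open>f\<close>
  into dyadic level slices makes it a bound by the \<open>L\<^sup>p\<^sup>,\<^sup>1\<close>-norm. Hence the Riesz-Kantorovich
  suprema \<open>T\<^sup>+\<close> and \<open>T\<^sup>-\<close> exist on \<open>L\<^sup>p\<^sup>,\<^sup>1\<close>, and \<open>T\<^sup>+ + T\<^sup>-\<close> dominates \<open>T\<^sup>+ - T\<^sup>-\<close>, which extends \<open>T\<close>.

  Conversely, let \<open>v \<ge> 0\<close> dominate \<open>T\<close>. The weak type bound and the arithmetic-geometric mean
  inequality give \<open>\<integral>\<^sub>E v 1\<^sub>F \<le> \<kappa> (a \<mu>(E) + b \<nu>(F))\<close>. For finite partitions this is the condition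
  under which the mass of each pair of cells can be assigned to one of the two cells such that no cell
  receives more than twice its capacity; the two halves of \<open>T\<close> are then bounded on
  \<open>L\<^sup>\<infinity>\<close> and on \<open>L\<^sup>1\<close>. The bilinear forms obtained in this way have a limit along a
  subnet of the partitions by Tychonoff's theorem, and Radon-Nikodym turns the limit into an operator;
  domination by \<open>v\<close> keeps everything supported on sigma-finite sets, so arbitrary measures are allowed.
\<close>

section \<open>Weak and strong Lorentz norms\<close>


text \<open>The weak quasi-norm is not subadditive with a constant independent of the number of
  summands. Long sums are therefore estimated through the equivalent quantity sup over E of
  mu(E)^(\<theta>-1) times the integral of |g| over E, which is subadditive. In the converse
  direction the cells are assigned by means of \<open>v\<close>, not \<open>T\<close>: only a
  positive operator gives each product of cells a nonnegative mass, and |J T| \<le> J v then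
  transfers the estimates to \<open>T\<close>. No separability is assumed, so the finite families of
  sets form a directed set without a cofinal sequence, and compactness has to replace the extraction
  of subsequences. What converges are numbers, the values of bilinear forms at a pair (f, A). Only
  the L^infinity half of the limit is represented by densities. The other half is defined as the
  difference \<open>T - T0\<close>, and its L^1 bound is recovered by testing on two disjoint sets,
  which stand for the sets where the image is positive and negative. All norms are infima, so every
  estimate is proved for an arbitrary real constant strictly above the norm in question, and the
  infimum is reached only at the very end.\<close>

text \<open>The infimum is the limit of a sequence of admissible bounds, and countably many null
  sets may be discarded.\<close>

lemma AE_Linf_norm: "AE x in M. ennreal \<bar>f x\<bar> \<le> Linf_norm M f"
proof -
  let ?S = "{C. AE x in M. ennreal \<bar>f x\<bar> \<le> C}"
  have "top \<in> ?S" by simp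
  then have "?S \<noteq> {}" by blast
  then obtain u where u: "\<And>n. u n \<in> ?S" "u \<longlonglongrightarrow> Inf ?S"
    using Inf_as_limit[of ?S] by blast
  have "AE x in M. \<forall>n. ennreal \<bar>f x\<bar> \<le> u n"
    using u(1) by (subst AE_all_countable) auto
  then show ?thesis
    unfolding Linf_norm_def
    by eventually_elim (use u(2) in \<open>auto intro: LIMSEQ_le_const\<close>)
qed

lemma Linf_norm_le: "AE x in M. ennreal \<bar>f x\<bar> \<le> C \<Longrightarrow> Linf_norm M f \<le> C"
  unfolding Linf_norm_def by (auto intro: Inf_lower)

lemma Linf_norm_le_iff: "0 \<le> h \<Longrightarrow> Linf_norm M f \<le> ennreal h \<longleftrightarrow> (AE x in M. \<bar>f x\<bar> \<le> h)"
proof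
  assume "0 \<le> h" "Linf_norm M f \<le> ennreal h"
  with AE_Linf_norm[of f M] show "AE x in M. \<bar>f x\<bar> \<le> h"
    by (auto elim!: eventually_mono dest: order_trans simp: ennreal_le_iff)
qed (auto intro!: Linf_norm_le elim!: eventually_mono simp: ennreal_leI)

text \<open>The bound \<open>h\<close> is kept strictly positive, also for f = 0, because it is
  later used as a divisor.\<close>

lemma Dint_iff:
  "f \<in> Dint N \<longleftrightarrow> integrable N f \<and> (\<exists>h>0. AE y in N. \<bar>f y\<bar> \<le> h)"
proof -
  have "Linf_norm N f < top \<longleftrightarrow> (\<exists>h>0. AE y in N. \<bar>f y\<bar> \<le> h)"
  proof
    assume "Linf_norm N f < top"
    then obtain r where r: "0 \<le> r" "Linf_norm N f = ennreal r"
      by (cases "Linf_norm N f") auto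
    then have "AE y in N. \<bar>f y\<bar> \<le> r" using Linf_norm_le_iff[of r N f] by simp
    then have "AE y in N. \<bar>f y\<bar> \<le> r + 1" by eventually_elim simp
    then show "\<exists>h>0. AE y in N. \<bar>f y\<bar> \<le> h" using r(1) by (intro exI[of _ "r + 1"]) simp
  next
    assume "\<exists>h>0. AE y in N. \<bar>f y\<bar> \<le> h"
    then obtain h where "h > 0" "AE y in N. \<bar>f y\<bar> \<le> h" by blast
    then have "Linf_norm N f \<le> ennreal h" using Linf_norm_le_iff[of h N f] by simp
    then show "Linf_norm N f < top" by (metis ennreal_less_top order_le_less_trans)
  qed
  then show ?thesis
    unfolding Dint_def L1_norm_def integrable_iff_bounded by auto
qed

lemma Dint_measurable [measurable_dest]: "f \<in> Dint N \<Longrightarrow> f \<in> borel_measurable N"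
  by (simp add: Dint_def)

lemma Dint_integrable: "f \<in> Dint N \<Longrightarrow> integrable N f"
  by (simp add: Dint_iff)

lemma Dint_dominated:
  assumes "g \<in> borel_measurable N" "f \<in> Dint N" "AE y in N. \<bar>g y\<bar> \<le> \<bar>f y\<bar>"
  shows "g \<in> Dint N"
proof -
  have "integrable N g"
    by (rule Bochner_Integration.integrable_bound[OF Dint_integrable[OF assms(2)] assms(1)])
       (use assms(3) in simp)
  moreover obtain h where "h > 0" "AE y in N. \<bar>f y\<bar> \<le> h" using assms(2) by (auto simp: Dint_iff)
  then have "\<exists>h>0. AE y in N. \<bar>g y\<bar> \<le> h"
    using assms(3) by (intro exI[of _ h]) auto
  ultimately show ?thesis by (simp add: Dint_iff)
qed

lemma Dint_lincomb:
  assumes "f \<in> Dint N" "g \<in> Dint N"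
  shows "(\<lambda>y. a * f y + b * g y) \<in> Dint N"
proof -
  obtain h where h: "h > 0" "AE y in N. \<bar>f y\<bar> \<le> h" using assms by (auto simp: Dint_iff)
  obtain k where k: "k > 0" "AE y in N. \<bar>g y\<bar> \<le> k" using assms by (auto simp: Dint_iff)
  have "AE y in N. \<bar>a * f y + b * g y\<bar> \<le> \<bar>a\<bar> * h + \<bar>b\<bar> * k + 1"
    using h(2) k(2)
  proof eventually_elim
    case (elim y)
    have "\<bar>a * f y\<bar> \<le> \<bar>a\<bar> * h" "\<bar>b * g y\<bar> \<le> \<bar>b\<bar> * k"
      using elim by (auto simp: abs_mult intro: mult_left_mono)
    then show ?case by linarith
  qed
  moreover have "\<bar>a\<bar> * h + \<bar>b\<bar> * k + 1 > 0" using h k by (intro add_nonneg_pos) auto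
  ultimately show ?thesis using assms by (auto simp: Dint_iff)
qed

lemma Dint_add: "f \<in> Dint N \<Longrightarrow> g \<in> Dint N \<Longrightarrow> (\<lambda>y. f y + g y) \<in> Dint N"
  using Dint_lincomb[of f N g 1 1] by simp

lemma Dint_diff: "f \<in> Dint N \<Longrightarrow> g \<in> Dint N \<Longrightarrow> (\<lambda>y. f y - g y) \<in> Dint N"
  using Dint_lincomb[of f N g 1 "-1"] by simp

lemma Dint_cmult: "f \<in> Dint N \<Longrightarrow> (\<lambda>y. a * f y) \<in> Dint N"
  using Dint_lincomb[of f N f a 0] by simp

lemma Dint_abs: "f \<in> Dint N \<Longrightarrow> (\<lambda>y. \<bar>f y\<bar>) \<in> Dint N"
  by (rule Dint_dominated[of _ N f]) auto

lemma Dint_zero: "(\<lambda>y. 0) \<in> Dint N"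
  by (auto simp: Dint_iff intro: exI[of _ 1])

lemma Dint_max: "f \<in> Dint N \<Longrightarrow> g \<in> Dint N \<Longrightarrow> (\<lambda>y. max (f y) (g y)) \<in> Dint N"
  by (rule Dint_dominated[OF _ Dint_add[OF Dint_abs Dint_abs], of _ _ f g]) auto

lemma Dint_sum: "(\<And>i. i \<in> I \<Longrightarrow> f i \<in> Dint N) \<Longrightarrow> (\<lambda>y. \<Sum>i\<in>I. f i y) \<in> Dint N"
  by (induction I rule: infinite_finite_induct) (auto intro: Dint_add Dint_zero)

lemma Dint_indicator: "F \<in> fmeasurable N \<Longrightarrow> indicat_real F \<in> Dint N"
  by (auto simp: Dint_iff fmeasurable_def integrable_indicator_iff intro!: exI[of _ 1] AE_I2 split: split_indicator)

lemma lin_op_on_measurable: "lin_op_on N M S T \<Longrightarrow> f \<in> S \<Longrightarrow> T f \<in> borel_measurable M"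
  by (simp add: lin_op_on_def)

lemma lin_op_on_cong: "lin_op_on N M S T \<Longrightarrow> f \<in> S \<Longrightarrow> g \<in> S \<Longrightarrow> AE y in N. f y = g y
    \<Longrightarrow> AE x in M. T f x = T g x"
  by (simp add: lin_op_on_def)

lemma lin_op_on_lincomb: "lin_op_on N M S T \<Longrightarrow> f \<in> S \<Longrightarrow> g \<in> S
    \<Longrightarrow> AE x in M. T (\<lambda>y. a * f y + b * g y) x = a * T f x + b * T g x"
  by (simp add: lin_op_on_def)

lemma lin_op_on_add: "lin_op_on N M S T \<Longrightarrow> f \<in> S \<Longrightarrow> g \<in> S
    \<Longrightarrow> AE x in M. T (\<lambda>y. f y + g y) x = T f x + T g x"
  using lin_op_on_lincomb[of N M S T f g 1 1] by simp

lemma lin_op_on_diff: "lin_op_on N M S T \<Longrightarrow> f \<in> S \<Longrightarrow> g \<in> S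
    \<Longrightarrow> AE x in M. T (\<lambda>y. f y - g y) x = T f x - T g x"
  using lin_op_on_lincomb[of N M S T f g 1 "-1"] by simp

lemma lin_op_on_cmult: "lin_op_on N M S T \<Longrightarrow> f \<in> S
    \<Longrightarrow> AE x in M. T (\<lambda>y. a * f y) x = a * T f x"
  using lin_op_on_lincomb[of N M S T f f a 0] by simp

lemma lin_op_on_zero: "lin_op_on N M S T \<Longrightarrow> f \<in> S \<Longrightarrow> AE x in M. T (\<lambda>y. 0) x = 0"
  using lin_op_on_lincomb[of N M S T f f 0 0] by simp

lemma lin_op_on_sum:
  assumes "lin_op_on N M (Dint N) T" "finite I" "\<And>i. i \<in> I \<Longrightarrow> f i \<in> Dint N"
  shows "AE x in M. T (\<lambda>y. \<Sum>i\<in>I. f i y) x = (\<Sum>i\<in>I. T (f i) x)"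
  using assms(2,3)
proof (induction I rule: finite_induct)
  case empty
  then show ?case using lin_op_on_zero[OF assms(1) Dint_zero] by simp
next
  case (insert i I)
  have "AE x in M. T (\<lambda>y. f i y + (\<Sum>i\<in>I. f i y)) x = T (f i) x + T (\<lambda>y. \<Sum>i\<in>I. f i y) x"
    using insert.prems by (intro lin_op_on_add[OF assms(1)] Dint_sum) auto
  moreover have "AE x in M. T (\<lambda>y. \<Sum>i\<in>I. f i y) x = (\<Sum>i\<in>I. T (f i) x)"
    using insert by auto
  ultimately show ?case using insert.hyps by auto
qed

text \<open>The quasi-norm of weak $L^{1/\theta}$ is at most \<open>c\<close>, in terms of the distribution function.\<close>
definition weak_bound :: "'a measure \<Rightarrow> real \<Rightarrow> real \<Rightarrow> ('a \<Rightarrow> real) \<Rightarrow> bool" where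
  "weak_bound M \<theta> c g \<longleftrightarrow>
     (\<forall>l>0. emeasure M {x \<in> space M. \<bar>g x\<bar> > l} \<le> ennreal ((c / l) powr (1 / \<theta>)))"

lemma rearr_le: "0 \<le> l \<Longrightarrow> emeasure M {x \<in> space M. \<bar>g x\<bar> > l} \<le> ennreal s \<Longrightarrow> rearr M g s \<le> ennreal l"
  unfolding rearr_def by (auto intro: Inf_lower)

text \<open>Distribution functions decrease, so a level \<open>k\<close> admissible at
  \<open>s\<close> cannot lie below \<open>l\<close>.\<close>

lemma rearr_ge:
  assumes "g \<in> borel_measurable M" "emeasure M {x \<in> space M. \<bar>g x\<bar> > l} > ennreal s"
  shows "ennreal l \<le> rearr M g s"
  unfolding rearr_def
proof (rule Inf_greatest, safe)
  fix k :: real assume k: "0 \<le> k" "emeasure M {x \<in> space M. k < \<bar>g x\<bar>} \<le> ennreal s"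
  show "ennreal l \<le> ennreal k"
  proof (rule ccontr)
    assume "\<not> ?thesis"
    then have "k < l" by (metis ennreal_leI linorder_not_le)
    then have "emeasure M {x \<in> space M. l < \<bar>g x\<bar>} \<le> emeasure M {x \<in> space M. k < \<bar>g x\<bar>}"
      using assms(1) by (intro emeasure_mono) auto
    then show False using assms(2) k by (meson leD order_trans)
  qed
qed

lemma weak_bound_imp_lorentz_inf:
  assumes th: "0 < \<theta>" "\<theta> < 1" and c: "0 \<le> c" and w: "weak_bound M \<theta> c g"
  shows "lorentz_inf_norm M (1/\<theta>) g \<le> ennreal c"
  unfolding lorentz_inf_norm_def
proof (rule SUP_least)
  fix s :: real assume "s \<in> {0<..}"
  then have s: "0 < s" by simp
  have "rearr M g s \<le> ennreal (c / s powr \<theta>)"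
  proof (rule ennreal_le_epsilon)
    fix e :: real assume e: "0 < e"
    \<comment> \<open>The slack \<open>e\<close> keeps the level positive even when c = 0;
      \<open>weak_bound\<close> says nothing about level 0.\<close>
    define l where "l = c / s powr \<theta> + e"
    have l: "l > 0" unfolding l_def using e c s by (simp add: add_nonneg_pos)
    have "c \<le> s powr \<theta> * l" unfolding l_def using s e by (simp add: field_simps)
    then have "c / l \<le> s powr \<theta>" using l by (simp add: field_simps)
    then have "(c / l) powr (1/\<theta>) \<le> (s powr \<theta>) powr (1/\<theta>)"
      using c l th by (intro powr_mono2) auto
    also have "\<dots> = s" using th s by (simp add: powr_powr)
    finally have "ennreal ((c / l) powr (1/\<theta>)) \<le> ennreal s" by (simp add: ennreal_leI)
    then have "rearr M g s \<le> ennreal l"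
      using w l unfolding weak_bound_def by (intro rearr_le) (auto intro: order_trans)
    then show "rearr M g s \<le> ennreal (c / s powr \<theta>) + ennreal e"
      unfolding l_def using e c by (simp add: ennreal_plus[symmetric] del: ennreal_plus)
  qed
  then have "ennreal (s powr \<theta>) * rearr M g s \<le> ennreal (s powr \<theta>) * ennreal (c / s powr \<theta>)"
    by (rule mult_left_mono) simp
  also have "\<dots> = ennreal c" using s c by (simp add: ennreal_mult[symmetric])
  finally show "ennreal (s powr (1 / (1/\<theta>))) * rearr M g s \<le> ennreal c" by simp
qed

text \<open>If a level set were too large, some real \<open>s\<close> would fit strictly between the
  claimed bound and its measure, which may be infinite; the rearrangement at this \<open>s\<close>
  is then at least \<open>l\<close>, too much for the norm.\<close>

lemma lorentz_inf_imp_weak_bound: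
  assumes th: "0 < \<theta>" "\<theta> < 1" and c: "0 \<le> c" and g: "g \<in> borel_measurable M"
    and n: "lorentz_inf_norm M (1/\<theta>) g \<le> ennreal c"
  shows "weak_bound M \<theta> c g"
  unfolding weak_bound_def
proof safe
  fix l :: real assume l: "0 < l"
  show "emeasure M {x \<in> space M. l < \<bar>g x\<bar>} \<le> ennreal ((c / l) powr (1 / \<theta>))"
  proof (rule ccontr)
    assume "\<not> ?thesis"
    then have "ennreal ((c / l) powr (1 / \<theta>)) < emeasure M {x \<in> space M. l < \<bar>g x\<bar>}" by simp
    then obtain s' where s': "ennreal ((c / l) powr (1 / \<theta>)) < s'" "s' < emeasure M {x \<in> space M. l < \<bar>g x\<bar>}"
      using dense by blast
    then have "s' \<noteq> top" by auto
    then obtain s where s: "0 \<le> s" "s' = ennreal s" by (cases s') auto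
    have s1: "(c / l) powr (1 / \<theta>) < s" using s' s by (simp add: ennreal_less_iff)
    then have s0: "0 < s" by (meson le_less_trans powr_ge_zero)
    have "ennreal (s powr \<theta>) * ennreal l \<le> ennreal (s powr \<theta>) * rearr M g s"
      using s' s g by (intro mult_left_mono rearr_ge) auto
    also have "\<dots> \<le> ennreal c"
      using n s0 unfolding lorentz_inf_norm_def SUP_le_iff by auto
    finally have "s powr \<theta> * l \<le> c"
      using c l by (simp add: ennreal_mult[symmetric])
    then have "s powr \<theta> \<le> c / l" using l by (simp add: field_simps)
    then have "(s powr \<theta>) powr (1/\<theta>) \<le> (c / l) powr (1/\<theta>)"
      using th by (intro powr_mono2) auto
    then show False using s1 s0 th by (simp add: powr_powr)
  qed
qed

lemma weak_bound_mono:
  assumes "weak_bound M \<theta> c g" "f \<in> borel_measurable M" "g \<in> borel_measurable M"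
    "AE x in M. \<bar>f x\<bar> \<le> \<bar>g x\<bar>"
  shows "weak_bound M \<theta> c f"
  unfolding weak_bound_def
proof safe
  fix l :: real assume l: "0 < l"
  have "emeasure M {x \<in> space M. l < \<bar>f x\<bar>} \<le> emeasure M {x \<in> space M. l < \<bar>g x\<bar>}"
    using assms by (intro emeasure_mono_AE) auto
  then show "emeasure M {x \<in> space M. l < \<bar>f x\<bar>} \<le> ennreal ((c / l) powr (1 / \<theta>))"
    using assms(1) l unfolding weak_bound_def by (meson order_trans)
qed

text \<open>The summand 1 belongs to the base level; the other one is the geometric series over the
  dyadic levels above it, whose ratio is below 1 since \<theta> < 1.\<close>

definition C_weak :: "real \<Rightarrow> real" where
  "C_weak \<theta> = 1 + 1 / (1 - 2 powr (1 - 1/\<theta>))"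

lemma C_weak_pos: "0 < \<theta> \<Longrightarrow> \<theta> < 1 \<Longrightarrow> 1 \<le> C_weak \<theta>"
proof -
  assume "0 < \<theta>" "\<theta> < 1"
  then have "2 powr (1 - 1/\<theta>) < 2 powr 0" by (intro powr_less_mono) (auto simp: field_simps)
  then show ?thesis by (simp add: C_weak_def)
qed

text \<open>Summing the levels \<open>2\<^sup>n l\<close> avoids Fubini: \<open>x \<le> l + \<Sum>\<^sub>n 2\<^sup>n l [x > 2\<^sup>n l]\<close>.\<close>
lemma dyadic_upper:
  fixes x l :: real
  assumes l: "0 < l"
  shows "ennreal x \<le> ennreal l + (\<Sum>n. ennreal (2^n * l) * indicator {2^n * l<..} x)"
proof (cases "x \<le> l")
  case True
  then have "ennreal x \<le> ennreal l" by (rule ennreal_leI)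
  then show ?thesis by (simp add: add_increasing2)
next
  case False
  obtain m where m: "x < 2^m * l"
    using real_arch_pow[of 2 "x / l"] l by (auto simp: field_simps)
  define n where "n = (LEAST n. x \<le> 2^n * l)"
  have n1: "x \<le> 2^n * l" unfolding n_def using m by (intro LeastI[of "\<lambda>n. x \<le> 2^n * l" m]) simp
  have n2: "2^k * l < x" if "k < n" for k
    using not_less_Least[of k "\<lambda>n. x \<le> 2^n * l"] that unfolding n_def by auto
  have "(\<Sum>k<n. 2^k * l) = (2^n - 1) * l"
    by (simp add: sum_distrib_right[symmetric] sum_gp_strict)
  then have "ennreal x \<le> ennreal l + ennreal (\<Sum>k<n. 2^k * l)"
    using n1 l by (subst ennreal_plus[symmetric]) (auto intro!: ennreal_leI sum_nonneg simp: algebra_simps)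
  also have "ennreal (\<Sum>k<n. 2^k * l) = (\<Sum>k<n. ennreal (2^k * l) * indicator {2^k * l<..} x)"
    using l n2 by (subst sum_ennreal[symmetric]) (auto intro!: sum.cong)
  also have "\<dots> \<le> (\<Sum>n. ennreal (2^n * l) * indicator {2^n * l<..} x)"
    by (rule sum_le_suminf) auto
  finally show ?thesis by (simp add: add_left_mono)
qed

text \<open>Together with \<open>weak_bound_if_integral\<close> this compares the weak quasi-norm
  with averages over sets of finite measure, which behave additively in the function.\<close>

lemma weak_bound_integral:
  assumes th: "0 < \<theta>" "\<theta> < 1" and c: "0 < c" and w: "weak_bound M \<theta> c g"
    and [measurable]: "g \<in> borel_measurable M" and E: "E \<in> fmeasurable M"
  shows "(\<integral>\<^sup>+x\<in>E. ennreal \<bar>g x\<bar> \<partial>M) \<le> ennreal (C_weak \<theta> * c * measure M E powr (1 - \<theta>))"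
proof (cases "measure M E = 0")
  case True
  then have "emeasure M E = 0" using E by (metis emeasure_eq_measure2 ennreal_0)
  moreover have E'[measurable]: "E \<in> sets M" using E by simp
  ultimately have "AE x in M. x \<notin> E" by (simp add: AE_iff_null_sets[symmetric] null_setsI AE_not_in)
  then have "(\<integral>\<^sup>+x\<in>E. ennreal \<bar>g x\<bar> \<partial>M) = (\<integral>\<^sup>+x. 0 \<partial>M)"
    by (intro nn_integral_cong_AE) (auto elim!: eventually_mono)
  then show ?thesis by simp
next
  case False
  define m where "m = measure M E"
  have m: "0 < m" using False by (simp add: m_def zero_less_measure_iff)
  have E'[measurable]: "E \<in> sets M" using E by simp
  have Em: "emeasure M E = ennreal m" unfolding m_def using E by (simp add: emeasure_eq_measure2)
  \<comment> \<open>At this level the weak bound (c/l)^(1/\<theta>) equals the measure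
    \<open>m\<close> of E: below it the trivial bound by \<open>m\<close> is better, above it the
    weak bound.\<close>
  define l where "l = c / m powr \<theta>"
  have l: "0 < l" using c m by (simp add: l_def)
  have lm: "l * m = c * m powr (1 - \<theta>)"
    using m by (simp add: l_def powr_diff)
  let ?q = "2 powr (1 - 1/\<theta>) :: real"
  have q: "0 < ?q" "?q < 1"
  proof -
    have "?q < 2 powr 0" using th by (intro powr_less_mono) (auto simp: field_simps)
    then show "?q < 1" by simp
  qed simp
  have lev: "emeasure M (E \<inter> {x \<in> space M. 2^n * l < \<bar>g x\<bar>}) \<le> ennreal (m * 2 powr (- real n / \<theta>))" for n
  proof -
    have "emeasure M (E \<inter> {x \<in> space M. 2^n * l < \<bar>g x\<bar>}) \<le> emeasure M {x \<in> space M. 2^n * l < \<bar>g x\<bar>}"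
      by (intro emeasure_mono) auto
    also have "\<dots> \<le> ennreal ((c / (2^n * l)) powr (1/\<theta>))"
      using w l unfolding weak_bound_def by simp
    also have "c / (2^n * l) = m powr \<theta> * 2 powr (- real n)"
      using c m by (simp add: l_def powr_minus powr_realpow divide_simps)
    also have "(m powr \<theta> * 2 powr (- real n)) powr (1/\<theta>) = m * 2 powr (- real n / \<theta>)"
      using m th by (simp add: powr_mult powr_powr)
    finally show ?thesis .
  qed
  have "(\<integral>\<^sup>+x\<in>E. ennreal \<bar>g x\<bar> \<partial>M)
      \<le> (\<integral>\<^sup>+x. (ennreal l + (\<Sum>n. ennreal (2^n * l) * indicator {2^n * l<..} \<bar>g x\<bar>)) * indicator E x \<partial>M)"
    by (intro nn_integral_mono mult_right_mono dyadic_upper l) auto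
  also have "\<dots> = (\<integral>\<^sup>+x. ennreal l * indicator E x +
        (\<Sum>n. ennreal (2^n * l) * indicator (E \<inter> {x \<in> space M. 2^n * l < \<bar>g x\<bar>}) x) \<partial>M)"
    by (intro nn_integral_cong)
       (auto simp: distrib_right split: split_indicator intro!: suminf_cong)
  also have "\<dots> = ennreal l * emeasure M E +
        (\<Sum>n. ennreal (2^n * l) * emeasure M (E \<inter> {x \<in> space M. 2^n * l < \<bar>g x\<bar>}))"
    by (subst nn_integral_add) (auto simp: nn_integral_suminf nn_integral_cmult_indicator)
  also have "\<dots> \<le> ennreal (l * m) + (\<Sum>n. ennreal (l * m * ?q ^ n))"
  proof (intro add_mono suminf_le)
    show "ennreal l * emeasure M E \<le> ennreal (l * m)"
      using l m by (simp add: Em ennreal_mult)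
    fix n
    have "ennreal (2^n * l) * emeasure M (E \<inter> {x \<in> space M. 2^n * l < \<bar>g x\<bar>})
        \<le> ennreal (2^n * l) * ennreal (m * 2 powr (- real n / \<theta>))"
      by (intro mult_left_mono lev) auto
    also have "\<dots> = ennreal (l * m * (2^n * 2 powr (- real n / \<theta>)))"
      using l m by (simp add: ennreal_mult[symmetric] mult_ac)
    also have "2^n * 2 powr (- real n / \<theta>) = ?q ^ n"
      by (simp add: powr_realpow[symmetric] powr_add[symmetric] powr_powr algebra_simps)
    finally show "ennreal (2^n * l) * emeasure M (E \<inter> {x \<in> space M. 2^n * l < \<bar>g x\<bar>}) \<le> ennreal (l * m * ?q ^ n)" .
  qed auto
  also have "(\<Sum>n. ennreal (l * m * ?q ^ n)) = ennreal (l * m * (1 / (1 - ?q)))"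
  proof (rule suminf_ennreal_eq)
    show "(\<lambda>n. l * m * ?q ^ n) sums (l * m * (1 / (1 - ?q)))"
      using q by (intro sums_mult geometric_sums) auto
  qed (use l m q in simp)
  also have "ennreal (l * m) + \<dots> = ennreal (C_weak \<theta> * c * m powr (1 - \<theta>))"
    using l m q by (subst ennreal_plus[symmetric])
      (auto intro!: arg_cong[of _ _ ennreal] mult_nonneg_nonneg divide_nonneg_nonneg less_imp_le[OF c] simp: C_weak_def lm algebra_simps)
  finally show ?thesis by (simp add: m_def)
qed

text \<open>Chebyshev's inequality on the level set itself. The hypothesis with \<open>c0\<close> is
  qualitative: it makes level sets finite in measure, so that they may be inserted for E; its
  constant does not enter the conclusion.\<close>

lemma weak_bound_if_integral:
  assumes th: "0 < \<theta>" "\<theta> < 1" and c: "0 \<le> c" and w: "weak_bound M \<theta> c0 g"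
    and [measurable]: "g \<in> borel_measurable M"
    and int: "\<And>E. E \<in> fmeasurable M \<Longrightarrow>
      (\<integral>\<^sup>+x\<in>E. ennreal \<bar>g x\<bar> \<partial>M) \<le> ennreal (c * measure M E powr (1 - \<theta>))"
  shows "weak_bound M \<theta> c g"
  unfolding weak_bound_def
proof safe
  fix l :: real assume l: "0 < l"
  define E where "E = {x \<in> space M. l < \<bar>g x\<bar>}"
  have "emeasure M E \<le> ennreal ((c0 / l) powr (1 / \<theta>))"
    using w l unfolding weak_bound_def E_def by blast
  then have "emeasure M E < \<infinity>" by (metis ennreal_less_top infinity_ennreal_def order_le_less_trans)
  then have E: "E \<in> fmeasurable M" by (auto simp: fmeasurable_def E_def)
  define m where "m = measure M E"
  have Em: "emeasure M E = ennreal m" unfolding m_def using E by (simp add: emeasure_eq_measure2)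
  have m0: "0 \<le> m" by (simp add: m_def)
  show "emeasure M {x \<in> space M. l < \<bar>g x\<bar>} \<le> ennreal ((c / l) powr (1 / \<theta>))"
  proof (cases "m = 0")
    case True
    then show ?thesis using Em E_def by simp
  next
    case False
    then have m: "0 < m" using m0 by simp
    have "ennreal (l * m) = (\<integral>\<^sup>+x. ennreal l * indicator E x \<partial>M)"
      using E l m by (subst nn_integral_cmult_indicator) (auto simp: Em ennreal_mult)
    also have "\<dots> \<le> (\<integral>\<^sup>+x\<in>E. ennreal \<bar>g x\<bar> \<partial>M)"
      by (intro nn_integral_mono) (auto simp: E_def ennreal_leI split: split_indicator)
    also have "\<dots> \<le> ennreal (c * m powr (1 - \<theta>))" using int[OF E] by (simp add: m_def)
    finally have "l * m \<le> c * m powr (1 - \<theta>)"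
      using c by (subst (asm) ennreal_le_iff) auto
    then have "l * m powr \<theta> \<le> c"
      using m by (simp add: powr_diff field_simps)
    then have "m powr \<theta> \<le> c / l" using l by (simp add: field_simps)
    then have "(m powr \<theta>) powr (1/\<theta>) \<le> (c / l) powr (1/\<theta>)"
      using th by (intro powr_mono2) auto
    then have "m \<le> (c / l) powr (1/\<theta>)" using m th by (simp add: powr_powr)
    then show ?thesis using Em E_def by (simp add: ennreal_leI)
  qed
qed


section \<open>The Lorentz space with second index one\<close>

lemma nn_integral_powr_0:
  assumes th: "0 < \<theta>" and d: "0 \<le> d"
  shows "(\<integral>\<^sup>+s. indicator {0<..} s * ennreal (s powr \<theta> / s) * indicator {..<d} s \<partial>lborel)
    = ennreal (d powr \<theta> / \<theta>)"
proof -
  have "((\<lambda>x. x powr (\<theta> - 1)) has_integral (d powr (\<theta> - 1 + 1) / (\<theta> - 1 + 1))) {0..d}"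
    using th d by (intro has_integral_powr_from_0) auto
  then have I: "(\<integral>\<^sup>+s. ennreal (s powr (\<theta> - 1)) * indicator {0..d} s \<partial>lborel) = ennreal (d powr \<theta> / \<theta>)"
    by (subst nn_integral_has_integral_lebesgue') auto
  have "AE s in lborel. s \<notin> {0, d}" by (intro AE_not_in countable_imp_null_set_lborel) auto
  then have "(\<integral>\<^sup>+s. indicator {0<..} s * ennreal (s powr \<theta> / s) * indicator {..<d} s \<partial>lborel)
     = (\<integral>\<^sup>+s. ennreal (s powr (\<theta> - 1)) * indicator {0..d} s \<partial>lborel)"
    by (intro nn_integral_cong_AE, eventually_elim) (auto split: split_indicator simp: powr_diff)
  with I show ?thesis by simp
qed

lemma nn_integral_powr_inf:
  assumes th: "\<theta> < 1" and c: "0 < c"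
  shows "(\<integral>\<^sup>+s. ennreal (s powr (\<theta> - 2)) * indicator {c..} s \<partial>lborel)
    = ennreal (c powr (\<theta> - 1) / (1 - \<theta>))"
proof -
  have "((\<lambda>x. x powr (\<theta> - 2)) has_integral (-(c powr (\<theta> - 2 + 1)) / (\<theta> - 2 + 1))) {c..}"
    using th c by (intro has_integral_powr_to_inf) auto
  moreover have "-(c powr (\<theta> - 2 + 1)) / (\<theta> - 2 + 1) = c powr (\<theta> - 1) / (1 - \<theta>)"
    using th by (simp add: divide_simps) (simp add: algebra_simps)
  ultimately show ?thesis
    by (subst nn_integral_has_integral_lebesgue') auto
qed

text \<open>The two terms are the constants in the integrals of s^(\<theta>-1) near 0 and of
  s^(\<theta>-2) near infinity.\<close>

definition C_hoelder :: "real \<Rightarrow> real" where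
  "C_hoelder \<theta> = 1 / \<theta> + 1 / (1 - \<theta>)"

lemma C_hoelder_pos: "0 < \<theta> \<Longrightarrow> \<theta> < 1 \<Longrightarrow> 0 < C_hoelder \<theta>"
  by (simp add: C_hoelder_def add_pos_pos)

text \<open>The rearrangement at s is at most min(h, k/s). The integral is cut at s = k/h, where the
  two bounds agree, and both halves become multiples of h^(1-\<theta>) k^\<theta>.\<close>

lemma lorentz_1_norm_le_interpolated:
  assumes th: "0 < \<theta>" "\<theta> < 1" and h: "0 < h" "0 < k"
    and [measurable]: "f \<in> borel_measurable N"
    and fh: "AE y in N. \<bar>f y\<bar> \<le> h" and fk: "(\<integral>\<^sup>+y. ennreal \<bar>f y\<bar> \<partial>N) \<le> ennreal k"
  shows "lorentz_1_norm N (1/\<theta>) f \<le> ennreal (C_hoelder \<theta> * (h powr (1 - \<theta>) * k powr \<theta>))"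
proof -
  define c where "c = k / h"
  have c: "0 < c" using h by (simp add: c_def)
  have r1: "rearr N f s \<le> ennreal h" for s
  proof (rule rearr_le)
    have "emeasure N {x \<in> space N. h < \<bar>f x\<bar>} = emeasure N {}"
      using fh by (intro emeasure_eq_AE) auto
    then show "emeasure N {x \<in> space N. h < \<bar>f x\<bar>} \<le> ennreal s" by simp
  qed (use h in simp)
  have r2: "rearr N f s \<le> ennreal (k / s)" if s: "0 < s" for s
  proof (rule rearr_le)
    have "ennreal (k / s) * emeasure N {x \<in> space N. k / s < \<bar>f x\<bar>}
        = (\<integral>\<^sup>+y. ennreal (k / s) * indicator {x \<in> space N. k / s < \<bar>f x\<bar>} y \<partial>N)"
      by (subst nn_integral_cmult_indicator) auto
    also have "\<dots> \<le> (\<integral>\<^sup>+y. ennreal \<bar>f y\<bar> \<partial>N)"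
      by (intro nn_integral_mono) (auto split: split_indicator intro!: ennreal_leI)
    also have "\<dots> \<le> ennreal k" by fact
    also have "\<dots> = ennreal (k / s) * ennreal s"
      using s h by (simp add: ennreal_mult[symmetric])
    finally show "emeasure N {x \<in> space N. k / s < \<bar>f x\<bar>} \<le> ennreal s"
      using s h by (subst (asm) ennreal_mult_le_mult_iff) (auto simp: ennreal_eq_0_iff divide_le_0_iff)
  qed (use h s in simp)
  have "lorentz_1_norm N (1/\<theta>) f \<le>
      (\<integral>\<^sup>+s. ennreal h * (indicator {0<..} s * ennreal (s powr \<theta> / s) * indicator {..<c} s)
         + ennreal k * (ennreal (s powr (\<theta> - 2)) * indicator {c..} s) \<partial>lborel)"
    unfolding lorentz_1_norm_def
  proof (intro nn_integral_mono)
    fix s :: real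
    consider "s \<le> 0" | "0 < s" "s < c" | "c \<le> s" by linarith
    then show "indicator {0<..} s * ennreal (s powr (1 / (1 / \<theta>)) / s) * rearr N f s \<le>
        ennreal h * (indicator {0<..} s * ennreal (s powr \<theta> / s) * indicator {..<c} s)
         + ennreal k * (ennreal (s powr (\<theta> - 2)) * indicator {c..} s)"
    proof cases
      case 2
      then show ?thesis using mult_left_mono[OF r1[of s], of "ennreal (s powr \<theta> / s)"]
        by (simp add: mult_ac)
    next
      case 3
      then have s: "0 < s" using c by simp
      have "s powr (\<theta> - 2) = s powr \<theta> / s / s"
        using s by (simp add: powr_diff powr_numeral power2_eq_square)
      then have "ennreal (s powr \<theta> / s) * ennreal (k / s) = ennreal k * ennreal (s powr (\<theta> - 2))"
        using s h by (simp add: ennreal_mult[symmetric])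
      then show ?thesis using mult_left_mono[OF r2[OF s], of "ennreal (s powr \<theta> / s)"] 3 s
        by simp
    qed simp
  qed
  also have "\<dots> = ennreal h * ennreal (c powr \<theta> / \<theta>) + ennreal k * ennreal (c powr (\<theta> - 1) / (1 - \<theta>))"
    using th c by (subst nn_integral_add)
      (auto simp: nn_integral_cmult nn_integral_powr_0 nn_integral_powr_inf)
  also have "\<dots> = ennreal (h * c powr \<theta> / \<theta> + k * c powr (\<theta> - 1) / (1 - \<theta>))"
    using th h c by (simp add: ennreal_mult[symmetric] ennreal_plus[symmetric] del: ennreal_plus)
  also have "h * c powr \<theta> = h powr (1 - \<theta>) * k powr \<theta>"
    using h by (simp add: c_def powr_divide powr_diff)
  also have "k * c powr (\<theta> - 1) = h powr (1 - \<theta>) * k powr \<theta>"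
    using h by (simp add: c_def powr_divide powr_diff)
  finally show ?thesis by (simp add: C_hoelder_def algebra_simps)
qed

lemma Dint_subset_Lp1:
  assumes th: "0 < \<theta>" "\<theta> < 1" shows "Dint N \<subseteq> Lp1 N (1/\<theta>)"
proof
  fix f assume f: "f \<in> Dint N"
  then obtain h where h: "h > 0" "AE y in N. \<bar>f y\<bar> \<le> h" by (auto simp: Dint_iff)
  have "(\<integral>\<^sup>+y. ennreal \<bar>f y\<bar> \<partial>N) \<le> ennreal ((\<integral>y. \<bar>f y\<bar> \<partial>N) + 1)"
    using Dint_integrable[OF f] by (subst nn_integral_eq_integral) (auto intro!: ennreal_leI)
  then have "lorentz_1_norm N (1/\<theta>) f
      \<le> ennreal (C_hoelder \<theta> * (h powr (1 - \<theta>) * ((\<integral>y. \<bar>f y\<bar> \<partial>N) + 1) powr \<theta>))"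
    using h f by (intro lorentz_1_norm_le_interpolated th) (auto intro: add_nonneg_pos)
  then have "lorentz_1_norm N (1/\<theta>) f < top" by (metis ennreal_less_top order_le_less_trans)
  then show "f \<in> Lp1 N (1/\<theta>)" using f by (simp add: Lp1_def Dint_def)
qed

lemma rearr_antimono: "s \<le> t \<Longrightarrow> rearr M g t \<le> rearr M g s"
  unfolding rearr_def
proof (rule Inf_superset_mono, safe)
  fix l assume "s \<le> t" "0 \<le> l" "emeasure M {x \<in> space M. l < \<bar>g x\<bar>} \<le> ennreal s"
  then show "\<exists>k. ennreal l = ennreal k \<and> 0 \<le> k \<and> emeasure M {x \<in> space M. k < \<bar>g x\<bar>} \<le> ennreal t"
    by (intro exI[of _ l] conjI refl) (auto intro: order_trans[OF _ ennreal_leI])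
qed

lemma rearr_measurable [measurable]: "rearr M g \<in> borel_measurable borel"
proof (rule borel_measurableI_ge)
  fix y
  have "is_interval {s. y \<le> rearr M g s}"
    unfolding is_interval_1 by (auto intro: order_trans rearr_antimono)
  then show "{x \<in> space borel. y \<le> rearr M g x} \<in> sets borel"
    using real_interval_borel_measurable by simp
qed

lemma rearr_mono:
  assumes "f \<in> borel_measurable M" "g \<in> borel_measurable M" "AE x in M. \<bar>f x\<bar> \<le> \<bar>g x\<bar>"
  shows "rearr M f s \<le> rearr M g s"
  unfolding rearr_def
proof (rule Inf_superset_mono, safe)
  fix l :: real assume l: "0 \<le> l" "emeasure M {x \<in> space M. l < \<bar>g x\<bar>} \<le> ennreal s"
  have "emeasure M {x \<in> space M. l < \<bar>f x\<bar>} \<le> emeasure M {x \<in> space M. l < \<bar>g x\<bar>}"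
    using assms by (intro emeasure_mono_AE) auto
  with l show "\<exists>k. ennreal l = ennreal k \<and> 0 \<le> k \<and> emeasure M {x \<in> space M. k < \<bar>f x\<bar>} \<le> ennreal s"
    by (auto intro: order_trans)
qed

lemma lorentz_1_norm_mono:
  assumes "f \<in> borel_measurable M" "g \<in> borel_measurable M" "AE x in M. \<bar>f x\<bar> \<le> \<bar>g x\<bar>"
  shows "lorentz_1_norm M p f \<le> lorentz_1_norm M p g"
  unfolding lorentz_1_norm_def
  by (intro nn_integral_mono mult_left_mono rearr_mono assms) auto

lemma lorentz_1_norm_abs: "lorentz_1_norm M p (\<lambda>y. \<bar>f y\<bar>) = lorentz_1_norm M p f"
  unfolding lorentz_1_norm_def rearr_def by simp

lemma lorentz_inf_norm_mono:
  assumes "f \<in> borel_measurable M" "g \<in> borel_measurable M" "AE x in M. \<bar>f x\<bar> \<le> \<bar>g x\<bar>"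
  shows "lorentz_inf_norm M p f \<le> lorentz_inf_norm M p g"
  unfolding lorentz_inf_norm_def
  by (intro SUP_mono' mult_left_mono rearr_mono assms) auto

text \<open>The exceptional sets of both summands, each of measure at most s, are united; this
  doubles the argument.\<close>

lemma rearr_add:
  assumes [measurable]: "f \<in> borel_measurable M" "g \<in> borel_measurable M" and s: "0 \<le> s"
  shows "rearr M (\<lambda>x. f x + g x) (2 * s) \<le> rearr M f s + rearr M g s"
proof (cases "rearr M f s = top \<or> rearr M g s = top")
  case False
  show ?thesis
  proof (rule ennreal_le_epsilon)
    fix e :: real assume e: "0 < e"
    have "rearr M f s < rearr M f s + ennreal (e/2)" "rearr M g s < rearr M g s + ennreal (e/2)"
      using False e ennreal_add_left_cancel_less[of "rearr M f s" 0 "ennreal (e/2)"]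
        ennreal_add_left_cancel_less[of "rearr M g s" 0 "ennreal (e/2)"] by auto
    then obtain l k where l: "0 \<le> l" "emeasure M {x \<in> space M. l < \<bar>f x\<bar>} \<le> ennreal s"
        "ennreal l < rearr M f s + ennreal (e/2)"
      and k: "0 \<le> k" "emeasure M {x \<in> space M. k < \<bar>g x\<bar>} \<le> ennreal s"
        "ennreal k < rearr M g s + ennreal (e/2)"
      unfolding rearr_def[of M f] rearr_def[of M g] Inf_less_iff by auto
    have "emeasure M {x \<in> space M. l + k < \<bar>f x + g x\<bar>}
        \<le> emeasure M ({x \<in> space M. l < \<bar>f x\<bar>} \<union> {x \<in> space M. k < \<bar>g x\<bar>})"
      by (intro emeasure_mono) auto
    also have "\<dots> \<le> emeasure M {x \<in> space M. l < \<bar>f x\<bar>} + emeasure M {x \<in> space M. k < \<bar>g x\<bar>}"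
      by (intro emeasure_subadditive) auto
    also have "\<dots> \<le> ennreal s + ennreal s" using l k by (intro add_mono) auto
    also have "\<dots> = ennreal (2 * s)" using s by (simp add: ennreal_plus[symmetric] del: ennreal_plus)
    finally have "rearr M (\<lambda>x. f x + g x) (2 * s) \<le> ennreal (l + k)" using l k by (intro rearr_le) auto
    also have "\<dots> = ennreal l + ennreal k" using l k by simp
    also have "\<dots> \<le> (rearr M f s + ennreal (e/2)) + (rearr M g s + ennreal (e/2))"
      using l k by (intro add_mono) auto
    also have "\<dots> = rearr M f s + rearr M g s + (ennreal (e/2) + ennreal (e/2))" by (simp add: ac_simps)
    also have "ennreal (e/2) + ennreal (e/2) = ennreal e"
      using e by (simp add: ennreal_plus[symmetric] del: ennreal_plus)
    finally show "rearr M (\<lambda>x. f x + g x) (2 * s) \<le> rearr M f s + rearr M g s + ennreal e" .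
  qed
qed auto

lemma rearr_cmult:
  assumes a: "a \<noteq> 0"
  shows "rearr M (\<lambda>x. a * f x) s \<le> ennreal \<bar>a\<bar> * rearr M f s"
proof -
  have "ennreal (1 / \<bar>a\<bar>) * rearr M (\<lambda>x. a * f x) s \<le> rearr M f s"
    unfolding rearr_def[of M f]
  proof (rule Inf_greatest, safe)
    fix l :: real assume l: "0 \<le> l" "emeasure M {x \<in> space M. l < \<bar>f x\<bar>} \<le> ennreal s"
    have "rearr M (\<lambda>x. a * f x) s \<le> ennreal (\<bar>a\<bar> * l)"
      using l a by (intro rearr_le) (auto simp: abs_mult)
    then have "ennreal (1 / \<bar>a\<bar>) * rearr M (\<lambda>x. a * f x) s \<le> ennreal (1 / \<bar>a\<bar>) * ennreal (\<bar>a\<bar> * l)"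
      by (intro mult_left_mono) auto
    also have "\<dots> = ennreal l" using a l by (simp add: ennreal_mult[symmetric])
    finally show "ennreal (1 / \<bar>a\<bar>) * rearr M (\<lambda>x. a * f x) s \<le> ennreal l" .
  qed
  then have "ennreal \<bar>a\<bar> * (ennreal (1 / \<bar>a\<bar>) * rearr M (\<lambda>x. a * f x) s) \<le> ennreal \<bar>a\<bar> * rearr M f s"
    by (intro mult_left_mono) auto
  then show ?thesis using a by (simp add: mult.assoc[symmetric] ennreal_mult[symmetric])
qed

lemma Lp1_measurable [measurable_dest]: "f \<in> Lp1 N p \<Longrightarrow> f \<in> borel_measurable N"
  by (simp add: Lp1_def)

lemma Lp1_dominated:
  assumes "g \<in> borel_measurable N" "f \<in> Lp1 N p" "AE y in N. \<bar>g y\<bar> \<le> \<bar>f y\<bar>"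
  shows "g \<in> Lp1 N p"
  using lorentz_1_norm_mono[of g N f p] assms by (auto simp: Lp1_def)

lemma Lp1_abs: "f \<in> Lp1 N p \<Longrightarrow> (\<lambda>y. \<bar>f y\<bar>) \<in> Lp1 N p"
  by (rule Lp1_dominated[of _ N f]) auto

lemma Lp1_cmult:
  assumes "f \<in> Lp1 N p" shows "(\<lambda>y. a * f y) \<in> Lp1 N p"
proof (cases "a = 0")
  case True
  then show ?thesis by (intro Lp1_dominated[OF _ assms]) auto
next
  case False
  have "lorentz_1_norm N p (\<lambda>y. a * f y) \<le>
     (\<integral>\<^sup>+ s. ennreal \<bar>a\<bar> * (indicator {0<..} s * ennreal (s powr (1/p) / s) * rearr N f s) \<partial>lborel)"
    unfolding lorentz_1_norm_def
  proof (intro nn_integral_mono)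
    fix s
    show "indicator {0<..} s * ennreal (s powr (1 / p) / s) * rearr N (\<lambda>y. a * f y) s
         \<le> ennreal \<bar>a\<bar> * (indicator {0<..} s * ennreal (s powr (1 / p) / s) * rearr N f s)"
      using mult_left_mono[OF rearr_cmult[OF False, of N f s], of "indicator {0<..} s * ennreal (s powr (1 / p) / s)"]
      by (simp add: mult_ac)
  qed
  also have "\<dots> = ennreal \<bar>a\<bar> * lorentz_1_norm N p f"
    unfolding lorentz_1_norm_def by (subst nn_integral_cmult) auto
  also have "\<dots> < top" using assms by (simp add: Lp1_def ennreal_mult_less_top)
  finally show ?thesis using Lp1_measurable[OF assms] by (simp add: Lp1_def)
qed

lemma Lp1_add:
  assumes f: "f \<in> Lp1 N p" and g: "g \<in> Lp1 N p"
  shows "(\<lambda>y. f y + g y) \<in> Lp1 N p"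
proof -
  note [measurable] = f[THEN Lp1_measurable] g[THEN Lp1_measurable]
  define w :: "real \<Rightarrow> ennreal" where "w s = indicator {0<..} s * ennreal (s powr (1/p) / s)" for s
  have w[measurable]: "w \<in> borel_measurable borel" unfolding w_def by measurable
  have nrm: "lorentz_1_norm N p h = (\<integral>\<^sup>+ s. w s * rearr N h s \<partial>lborel)" for h
    unfolding lorentz_1_norm_def w_def ..
  have fin: "(\<integral>\<^sup>+ s. w s * rearr N f s \<partial>lborel) < top" "(\<integral>\<^sup>+ s. w s * rearr N g s \<partial>lborel) < top"
    using f g by (auto simp: Lp1_def nrm)
  \<comment> \<open>Substituting 2s for s brings the integrand into the form to which
    \<open>rearr_add\<close> applies.\<close>
  have 1: "lorentz_1_norm N p (\<lambda>y. f y + g y)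
      = ennreal 2 * (\<integral>\<^sup>+ s. w (2 * s) * rearr N (\<lambda>y. f y + g y) (2 * s) \<partial>lborel)"
    unfolding nrm by (subst nn_integral_real_affine[where c=2 and t=0]) auto
  have 2: "(\<integral>\<^sup>+ s. w (2 * s) * rearr N (\<lambda>y. f y + g y) (2 * s) \<partial>lborel) \<le>
     (\<integral>\<^sup>+ s. ennreal (2 powr (1/p)) * (w s * rearr N f s + w s * rearr N g s) \<partial>lborel)"
  proof (intro nn_integral_mono)
    fix s :: real
    show "w (2 * s) * rearr N (\<lambda>y. f y + g y) (2 * s) \<le>
       ennreal (2 powr (1/p)) * (w s * rearr N f s + w s * rearr N g s)"
    proof (cases "0 < s")
      case True
      have "w (2 * s) \<le> ennreal (2 powr (1/p)) * w s"
        using True unfolding w_def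
        by (auto simp: ennreal_mult[symmetric] powr_mult field_simps intro!: ennreal_leI)
      then have "w (2 * s) * rearr N (\<lambda>y. f y + g y) (2 * s)
          \<le> ennreal (2 powr (1/p)) * w s * (rearr N f s + rearr N g s)"
        using True by (intro mult_mono[OF _ rearr_add]) auto
      then show ?thesis by (simp add: algebra_simps)
    qed (simp add: w_def)
  qed
  have 3: "(\<integral>\<^sup>+ s. ennreal (2 powr (1/p)) * (w s * rearr N f s + w s * rearr N g s) \<partial>lborel)
      = ennreal (2 powr (1/p)) * ((\<integral>\<^sup>+ s. w s * rearr N f s \<partial>lborel) + (\<integral>\<^sup>+ s. w s * rearr N g s \<partial>lborel))"
    by (subst nn_integral_cmult) (auto simp: nn_integral_add)
  have "(\<integral>\<^sup>+ s. w (2 * s) * rearr N (\<lambda>y. f y + g y) (2 * s) \<partial>lborel) < top"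
    using fin by (intro le_less_trans[OF 2]) (simp add: 3 ennreal_mult_less_top)
  then show ?thesis using 1 by (simp add: Lp1_def ennreal_mult_less_top)
qed

text \<open>On an infinite level set the rearrangement would stay above \<open>l\<close> for all s,
  and s^(\<theta>-1) is not integrable at infinity.\<close>

lemma Lp1_distribution_finite:
  assumes th: "0 < \<theta>" and f: "f \<in> Lp1 N (1/\<theta>)" and l: "0 < l"
  shows "{y \<in> space N. l < \<bar>f y\<bar>} \<in> fmeasurable N"
proof -
  note [measurable] = f[THEN Lp1_measurable]
  let ?E = "{y \<in> space N. l < \<bar>f y\<bar>}"
  obtain c where c: "0 \<le> c" "lorentz_1_norm N (1/\<theta>) f = ennreal c"
    using f by (cases "lorentz_1_norm N (1/\<theta>) f") (auto simp: Lp1_def)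
  have "emeasure N ?E \<noteq> \<infinity>"
  proof
    assume inf: "emeasure N ?E = \<infinity>"
    \<comment> \<open>Chosen so that the part of the integral over (0, d) alone is at least l
      d^\<theta> / \<theta> = c + 1.\<close>
    define d where "d = ((c + 1) * \<theta> / l) powr (1/\<theta>)"
    have "ennreal l * ennreal (d powr \<theta> / \<theta>)
       = (\<integral>\<^sup>+s. ennreal l * (indicator {0<..} s * ennreal (s powr \<theta> / s) * indicator {..<d} s) \<partial>lborel)"
      using th by (subst nn_integral_cmult) (auto simp: nn_integral_powr_0 d_def)
    also have "\<dots> \<le> lorentz_1_norm N (1/\<theta>) f"
      unfolding lorentz_1_norm_def
    proof (intro nn_integral_mono)
      fix s :: real
      have "ennreal l \<le> rearr N f s" using inf by (intro rearr_ge) auto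
      then have "ennreal (s powr \<theta> / s) * ennreal l \<le> ennreal (s powr \<theta> / s) * rearr N f s"
        by (intro mult_left_mono) auto
      then show "ennreal l * (indicator {0<..} s * ennreal (s powr \<theta> / s) * indicator {..<d} s)
         \<le> indicator {0<..} s * ennreal (s powr (1 / (1 / \<theta>)) / s) * rearr N f s"
        by (auto split: split_indicator simp: mult_ac)
    qed
    also have "\<dots> = ennreal c" by fact
    also have "d powr \<theta> = (c + 1) * \<theta> / l" unfolding d_def using th c l by (simp add: powr_powr)
    finally have "c + 1 \<le> c" using th l c by (simp add: ennreal_mult[symmetric])
    then show False by simp
  qed
  then show ?thesis by (auto simp: fmeasurable_def less_top)
qed

text \<open>Each d^\<theta>/\<theta> is the integral of s^(\<theta>-1) over (0, d). After exchanging
  sum and integral, the levels that count at a given s form a geometric sum, which is at most twice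
  its largest possible term, and that term is below the rearrangement at s.\<close>

lemma dyadic_le_lorentz_1_norm:
  assumes th: "0 < \<theta>" and f: "f \<in> Lp1 N (1/\<theta>)" and e: "0 < e"
  shows "ennreal (\<Sum>k<n. e * 2^k * measure N {y \<in> space N. e * 2^k < \<bar>f y\<bar>} powr \<theta>)
     \<le> ennreal (2 * \<theta>) * lorentz_1_norm N (1/\<theta>) f"
proof -
  note [measurable] = f[THEN Lp1_measurable]
  define d where "d k = measure N {y \<in> space N. e * 2^k < \<bar>f y\<bar>}" for k :: nat
  let ?w = "\<lambda>s::real. indicator {0<..} s * ennreal (s powr \<theta> / s) :: ennreal"
  have d: "emeasure N {y \<in> space N. e * 2^k < \<bar>f y\<bar>} = ennreal (d k)" for k
    unfolding d_def using e by (intro emeasure_eq_measure2 Lp1_distribution_finite[OF th f]) auto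
  have pt: "(\<Sum>k<n. ennreal (e * 2^k) * indicator {..<d k} s) \<le> 2 * rearr N f s" if s: "0 < s" for s
  proof (cases "\<exists>k<n. s < d k")
    case False
    then have "(\<Sum>k<n. ennreal (e * 2^k) * indicator {..<d k} s) = (\<Sum>k<n. 0)"
      by (intro sum.cong) (auto split: split_indicator)
    then show ?thesis by simp
  next
    case True
    define m where "m = Max {k. k < n \<and> s < d k}"
    have "m \<in> {k. k < n \<and> s < d k}" unfolding m_def using True by (intro Max_in) auto
    then have m: "m < n" "s < d m" by auto
    have le: "k \<le> m" if "k < n" "s < d k" for k unfolding m_def using that by (intro Max_ge) auto
    have "(\<Sum>k<n. ennreal (e * 2^k) * indicator {..<d k} s) = (\<Sum>k\<in>{k. k < n \<and> s < d k}. ennreal (e * 2^k))"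
      by (intro sum.mono_neutral_cong_right) auto
    also have "\<dots> \<le> (\<Sum>k\<in>{..m}. ennreal (e * 2^k))"
      using le by (intro sum_mono2) auto
    also have "\<dots> = ennreal (e * (2 * 2^m - 1))"
      using e by (subst sum_ennreal)
        (auto simp: sum_distrib_left[symmetric] lessThan_Suc_atMost[symmetric] sum_gp_strict)
    also have "\<dots> \<le> ennreal (2 * (e * 2^m))" using e by (intro ennreal_leI) (simp add: algebra_simps)
    also have "\<dots> = 2 * ennreal (e * 2^m)" using e by (simp add: ennreal_mult)
    also have "\<dots> \<le> 2 * rearr N f s"
      using m s by (intro mult_left_mono rearr_ge) (auto simp: d ennreal_less_iff)
    finally show ?thesis .
  qed
  have "ennreal (\<Sum>k<n. e * 2^k * (d k powr \<theta> / \<theta>)) = (\<Sum>k<n. ennreal (e * 2^k) * ennreal (d k powr \<theta> / \<theta>))"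
    using e th by (subst sum_ennreal[symmetric]) (auto simp: ennreal_mult[symmetric])
  also have "\<dots> = (\<Sum>k<n. (\<integral>\<^sup>+s. ennreal (e * 2^k) * (?w s * indicator {..<d k} s) \<partial>lborel))"
    using th by (intro sum.cong refl, subst nn_integral_cmult) (auto simp: nn_integral_powr_0 d_def)
  also have "\<dots> = (\<integral>\<^sup>+s. (\<Sum>k<n. ennreal (e * 2^k) * (?w s * indicator {..<d k} s)) \<partial>lborel)"
    by (subst nn_integral_sum) auto
  also have "\<dots> \<le> (\<integral>\<^sup>+s. 2 * (?w s * rearr N f s) \<partial>lborel)"
  proof (intro nn_integral_mono)
    fix s :: real
    have "(\<Sum>k<n. ennreal (e * 2^k) * (?w s * indicator {..<d k} s))
       = ?w s * (\<Sum>k<n. ennreal (e * 2^k) * indicator {..<d k} s)"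
      unfolding sum_distrib_left by (intro sum.cong refl) (simp only: mult_ac)
    also have "\<dots> \<le> ?w s * (2 * rearr N f s)"
      using pt[of s] by (cases "0 < s") (auto intro: mult_left_mono)
    finally show "(\<Sum>k<n. ennreal (e * 2^k) * (?w s * indicator {..<d k} s)) \<le> 2 * (?w s * rearr N f s)"
      by (simp add: mult_ac)
  qed
  also have "\<dots> = 2 * lorentz_1_norm N (1/\<theta>) f"
    unfolding lorentz_1_norm_def by (subst nn_integral_cmult) auto
  finally have "ennreal \<theta> * ennreal (\<Sum>k<n. e * 2^k * (d k powr \<theta> / \<theta>)) \<le> ennreal \<theta> * (2 * lorentz_1_norm N (1/\<theta>) f)"
    by (intro mult_left_mono) auto
  also have "ennreal \<theta> * ennreal (\<Sum>k<n. e * 2^k * (d k powr \<theta> / \<theta>)) = ennreal (\<Sum>k<n. e * 2^k * d k powr \<theta>)"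
    using th e by (subst ennreal_mult[symmetric])
      (auto intro!: sum_nonneg arg_cong[of _ _ ennreal] sum.cong simp: sum_distrib_left)
  also have "ennreal \<theta> * (2 * lorentz_1_norm N (1/\<theta>) f) = ennreal (2 * \<theta>) * lorentz_1_norm N (1/\<theta>) f"
    using th by (simp add: ennreal_mult mult_ac)
  finally show ?thesis by (simp add: d_def)
qed

section \<open>Essential suprema in weak Lebesgue spaces\<close>


text \<open>The constant 0 does occur, for slices that live on null sets; then all level sets of
  \<open>g\<close> are null and g = 0 a.e.\<close>

lemma weak_bound_integral_nonneg:
  assumes th: "0 < \<theta>" "\<theta> < 1" and c: "0 \<le> c" and w: "weak_bound M \<theta> c g"
    and [measurable]: "g \<in> borel_measurable M" and E: "E \<in> fmeasurable M"
  shows "(\<integral>\<^sup>+x\<in>E. ennreal \<bar>g x\<bar> \<partial>M) \<le> ennreal (C_weak \<theta> * c * measure M E powr (1 - \<theta>))"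
proof (cases "c = 0")
  case True
  have "AE x in M. \<forall>n. \<bar>g x\<bar> \<le> 1 / Suc n"
    unfolding AE_all_countable
  proof
    fix n
    have "emeasure M {x \<in> space M. 1 / Suc n < \<bar>g x\<bar>} \<le> ennreal ((c / (1 / Suc n)) powr (1/\<theta>))"
      using w unfolding weak_bound_def by (elim allE[of _ "1 / Suc n"]) simp
    then have "emeasure M {x \<in> space M. 1 / Suc n < \<bar>g x\<bar>} = 0" using True by simp
    then show "AE x in M. \<bar>g x\<bar> \<le> 1 / Suc n"
      by (subst AE_iff_measurable[OF _ refl]) (auto simp: not_le)
  qed
  then have "AE x in M. g x = 0"
  proof eventually_elim
    case (elim x)
    show ?case
    proof (rule ccontr)
      assume "g x \<noteq> 0"
      then obtain n where "inverse (real (Suc n)) < \<bar>g x\<bar>" using reals_Archimedean[of "\<bar>g x\<bar>"] by auto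
      then show False using elim[rule_format, of n] by (simp add: inverse_eq_divide)
    qed
  qed
  then have "(\<integral>\<^sup>+x\<in>E. ennreal \<bar>g x\<bar> \<partial>M) = (\<integral>\<^sup>+x. 0 \<partial>M)"
    by (intro nn_integral_cong_AE) (auto elim!: eventually_mono)
  then show ?thesis by simp
next
  case False
  then show ?thesis using assms by (intro weak_bound_integral) auto
qed

lemma weak_bound_finite_AE:
  fixes F :: "'a \<Rightarrow> ennreal"
  assumes th: "0 < \<theta>" "\<theta> < 1" and c: "0 \<le> c" and [measurable]: "F \<in> borel_measurable M"
    and b: "\<And>l. 0 < l \<Longrightarrow> emeasure M {x \<in> space M. ennreal l < F x} \<le> ennreal ((c / l) powr (1 / \<theta>))"
  shows "AE x in M. F x < top"
proof -
  have "((\<lambda>n. (c / real (Suc n)) powr (1/\<theta>)) \<longlonglongrightarrow> 0 powr (1/\<theta>))"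
  proof (rule tendsto_powr')
    show "(\<lambda>n. c / real (Suc n)) \<longlonglongrightarrow> 0"
      using LIMSEQ_inverse_real_of_nat[THEN tendsto_mult_right, of c] by (simp add: field_simps)
  qed (use th c in \<open>auto intro: tendsto_const\<close>)
  then have lim: "((\<lambda>n. ennreal ((c / real (Suc n)) powr (1/\<theta>))) \<longlonglongrightarrow> ennreal 0)"
    by (intro tendsto_ennrealI) simp
  have "emeasure M {x \<in> space M. F x = top} \<le> ennreal ((c / real (Suc n)) powr (1/\<theta>))" for n
  proof -
    have "emeasure M {x \<in> space M. F x = top} \<le> emeasure M {x \<in> space M. ennreal (real (Suc n)) < F x}"
      by (intro emeasure_mono) auto
    also have "\<dots> \<le> ennreal ((c / real (Suc n)) powr (1/\<theta>))" by (rule b) simp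
    finally show ?thesis .
  qed
  then have "emeasure M {x \<in> space M. F x = top} \<le> ennreal 0"
    by (intro LIMSEQ_le_const[OF lim]) auto
  then have "emeasure M {x \<in> space M. F x = top} = 0" by simp
  then show ?thesis
    by (subst AE_iff_measurable[OF _ refl]) (auto simp: less_top[symmetric])
qed

text \<open>No localizability of \<open>M\<close> is needed: since all level sets have bounded measure, a sequence
  that exhausts the suprema of the measures of all rational level sets already attains the
  essential supremum of the whole family.\<close>
lemma directed_weak_essential_supremum:
  fixes G :: "('a \<Rightarrow> real) set"
  assumes th: "0 < \<theta>" "\<theta> < 1" and c: "0 \<le> c" and ne: "G \<noteq> {}"
    and meas: "\<And>g. g \<in> G \<Longrightarrow> g \<in> borel_measurable M"
    and nonneg: "\<And>g x. g \<in> G \<Longrightarrow> 0 \<le> g x"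
    and weak: "\<And>g. g \<in> G \<Longrightarrow> weak_bound M \<theta> c g"
    and dir: "\<And>g h. g \<in> G \<Longrightarrow> h \<in> G \<Longrightarrow> \<exists>k\<in>G. (AE x in M. g x \<le> k x) \<and> (AE x in M. h x \<le> k x)"
  shows "\<exists>F h. F \<in> borel_measurable M \<and> (\<forall>g\<in>G. AE x in M. g x \<le> F x) \<and> weak_bound M \<theta> c F
      \<and> (\<forall>n::nat. h n \<in> G) \<and> (AE x in M. (\<lambda>n. h n x) \<longlonglongrightarrow> F x)"
proof -
  let ?m = "\<lambda>q g. emeasure M {x \<in> space M. q < g x}"
  have "\<exists>\<gamma> :: nat \<Rightarrow> 'a \<Rightarrow> real. (\<forall>n. \<gamma> n \<in> G) \<and> (SUP g\<in>G. ?m q g) = (SUP n. ?m q (\<gamma> n))" for q :: real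
  proof -
    obtain v :: "nat \<Rightarrow> ennreal" where v: "range v \<subseteq> ?m q ` G" "Sup (?m q ` G) = Sup (range v)"
      using ennreal_SUP_countable_SUP[OF ne, of "?m q"] by blast
    then have "\<forall>n. \<exists>g\<in>G. v n = ?m q g" by blast
    then obtain \<gamma> where "\<forall>n. \<gamma> n \<in> G \<and> v n = ?m q (\<gamma> n)" by metis
    then show ?thesis using v(2) by (intro exI[of _ \<gamma>]) auto
  qed
  then have "\<forall>q. \<exists>\<gamma> :: nat \<Rightarrow> 'a \<Rightarrow> real. (\<forall>n. \<gamma> n \<in> G) \<and> (SUP g\<in>G. ?m q g) = (SUP n. ?m q (\<gamma> n))"
    by blast
  from choice[OF this] obtain \<gamma> :: "real \<Rightarrow> nat \<Rightarrow> 'a \<Rightarrow> real" where \<gamma>: "\<And>q n. \<gamma> q n \<in> G"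
    "\<And>q. (SUP g\<in>G. ?m q g) = (SUP n. ?m q (\<gamma> q n))" by blast
  \<comment> \<open>Decoding n as a pair enumerates the maximizing sequences of all rational levels
    in one sequence.\<close>
  define g where "g n = \<gamma> (real_of_rat (from_nat (fst (prod_decode n)))) (snd (prod_decode n))" for n
  have gG: "g n \<in> G" for n by (simp add: g_def \<gamma>)
  \<comment> \<open>Directedness yields an a.e. increasing sequence in G that dominates the
    enumerated one.\<close>
  have "\<exists>h. \<forall>n. (h n \<in> G \<and> (AE x in M. g n x \<le> h n x)) \<and> (AE x in M. h n x \<le> h (Suc n) x)"
  proof (rule dependent_nat_choice)
    show "\<exists>k. k \<in> G \<and> (AE x in M. g 0 x \<le> k x)" using gG[of 0] by auto
    fix k n assume "k \<in> G \<and> (AE x in M. g n x \<le> k x)"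
    then show "\<exists>k'. (k' \<in> G \<and> (AE x in M. g (Suc n) x \<le> k' x)) \<and> (AE x in M. k x \<le> k' x)"
      using dir[of k "g (Suc n)"] gG[of "Suc n"] by blast
  qed
  then obtain h where h: "\<And>n. h n \<in> G" "\<And>n. AE x in M. g n x \<le> h n x"
      "\<And>n. AE x in M. h n x \<le> h (Suc n) x" by blast
  note [measurable] = meas[OF h(1)]
  \<comment> \<open>Running maxima agree with \<open>h\<close> a.e. but increase everywhere, so that
    level sets form honest increasing unions.\<close>
  define H where "H n x = (MAX i\<in>{..n}. h i x)" for n x
  have HM[measurable]: "H n \<in> borel_measurable M" for n
    unfolding H_def by (intro borel_measurable_Max) auto
  have H_mono: "H m x \<le> H n x" if "m \<le> n" for m n x
    unfolding H_def using that by (intro Max_mono) auto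
  have H0: "0 \<le> H n x" for n x
    unfolding H_def using nonneg[OF h(1), of 0 x] by (subst Max_ge_iff) auto
  have "AE x in M. \<forall>n. h n x \<le> h (Suc n) x" using h(3) by (subst AE_all_countable) auto
  then have Hh: "AE x in M. \<forall>n. H n x = h n x"
  proof eventually_elim
    case (elim x)
    then have inc: "incseq (\<lambda>n. h n x)" by (intro incseq_SucI) auto
    show ?case unfolding H_def
      by (intro allI Max_eqI) (use incseqD[OF inc] in auto)
  qed
  define F where "F x = (SUP n. ennreal (H n x))" for x
  have [measurable]: "F \<in> borel_measurable M" unfolding F_def by measurable
  have levF: "{x \<in> space M. ennreal l < F x} = (\<Union>n. {x \<in> space M. l < H n x})" if "0 \<le> l" for l
    using that H0 unfolding F_def by (auto simp: less_SUP_iff ennreal_less_iff)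
  have mF: "?m l (H n) \<le> ennreal ((c / l) powr (1 / \<theta>))" if "0 < l" for l n
  proof -
    have "?m l (H n) = ?m l (h n)" using Hh by (intro emeasure_eq_AE) auto
    also have "\<dots> = emeasure M {x \<in> space M. l < \<bar>h n x\<bar>}" using nonneg[OF h(1)] by simp
    also have "\<dots> \<le> ennreal ((c / l) powr (1 / \<theta>))"
      using weak[OF h(1)] that unfolding weak_bound_def by blast
    finally show ?thesis .
  qed
  have bF: "emeasure M {x \<in> space M. ennreal l < F x} \<le> ennreal ((c / l) powr (1 / \<theta>))" if l: "0 < l" for l
  proof -
    have "emeasure M (\<Union>n. {x \<in> space M. l < H n x}) = (SUP n. ?m l (H n))"
      by (intro SUP_emeasure_incseq[symmetric] incseq_SucI)
         (auto intro: less_le_trans[OF _ H_mono])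
    also have "\<dots> \<le> ennreal ((c / l) powr (1 / \<theta>))" using mF[OF l] by (intro SUP_least)
    finally show ?thesis using l by (subst levF) auto
  qed
  have Ffin: "AE x in M. F x < top" by (rule weak_bound_finite_AE[OF th c _ bF]) auto
  \<comment> \<open>For rational q the level set of F has the largest measure that members of G can
    reach. Joining the level set of k does not exceed it, by directedness, and since this measure is
    finite the difference is null.\<close>
  have dom: "AE x in M. ennreal (k x) \<le> F x" if k: "k \<in> G" for k
  proof -
    note [measurable] = meas[OF k]
    have "AE x in M. 0 < q \<longrightarrow> q < k x \<longrightarrow> ennreal q < F x" if q: "q \<in> \<rat>" for q :: real
    proof (cases "0 < q")
      case True
      obtain r where r: "q = real_of_rat r" using q by (auto elim: Rats_cases)
      let ?A = "{x \<in> space M. ennreal q < F x}" and ?B = "{x \<in> space M. q < k x}"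
      have "(SUP k\<in>G. ?m q k) \<le> emeasure M ?A"
        unfolding \<gamma>(2)
      proof (rule SUP_least)
        fix n
        define i where "i = prod_encode (to_nat r, n)"
        have gi: "g i = \<gamma> q n" by (simp add: g_def i_def r)
        have "AE x in M. \<gamma> q n x \<le> H i x" using h(2)[of i] Hh by eventually_elim (simp add: gi)
        then have "?m q (\<gamma> q n) \<le> emeasure M {x \<in> space M. q < H i x}"
          by (intro emeasure_mono_AE) auto
        also have "\<dots> \<le> emeasure M ?A" using True by (intro emeasure_mono) (auto simp: levF)
        finally show "?m q (\<gamma> q n) \<le> emeasure M ?A" .
      qed
      moreover have "emeasure M (?A \<union> ?B) \<le> (SUP k\<in>G. ?m q k)"
      proof -
        have "?A \<union> ?B = (\<Union>n. {x \<in> space M. q < H n x} \<union> ?B)" using True by (subst levF) auto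
        also have "emeasure M \<dots> = (SUP n. emeasure M ({x \<in> space M. q < H n x} \<union> ?B))"
          by (intro SUP_emeasure_incseq[symmetric] incseq_SucI)
             (auto intro: less_le_trans[OF _ H_mono])
        also have "\<dots> \<le> (SUP k\<in>G. ?m q k)"
        proof (rule SUP_least)
          fix n
          obtain k' where k': "k' \<in> G" "AE x in M. h n x \<le> k' x" "AE x in M. k x \<le> k' x"
            using dir[OF h(1)[of n] k] by blast
          note [measurable] = meas[OF k'(1)]
          have "emeasure M ({x \<in> space M. q < H n x} \<union> ?B) \<le> ?m q k'"
            using k'(2,3) Hh by (intro emeasure_mono_AE) auto
          also have "\<dots> \<le> (SUP k\<in>G. ?m q k)" using k'(1) by (rule SUP_upper)
          finally show "emeasure M ({x \<in> space M. q < H n x} \<union> ?B) \<le> (SUP k\<in>G. ?m q k)" .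
        qed
        finally show ?thesis .
      qed
      ultimately have "emeasure M (?A \<union> ?B) \<le> emeasure M ?A" by (rule order_trans[rotated])
      moreover have "emeasure M (?A \<union> ?B) = emeasure M ?A + emeasure M (?B - ?A)"
        by (subst plus_emeasure) (auto intro!: arg_cong[of _ _ "emeasure M"])
      moreover have "emeasure M ?A \<noteq> \<infinity>" using bF[OF True] by (auto simp: top_unique)
      ultimately have "emeasure M (?B - ?A) = 0"
        using ennreal_add_left_cancel_le[of "emeasure M ?A" "emeasure M (?B - ?A)" 0] by auto
      then show ?thesis
        by (intro AE_I[of _ _ "?B - ?A"]) auto
    qed simp
    then have "AE x in M. \<forall>q\<in>\<rat>. 0 < q \<longrightarrow> q < k x \<longrightarrow> ennreal q < F x"
      using countable_rat by (subst AE_ball_countable) auto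
    then show ?thesis
    proof eventually_elim
      case (elim x)
      show ?case
      proof (rule ccontr)
        assume "\<not> ?thesis"
        then have lt: "F x < ennreal (k x)" by simp
        then obtain f where f: "0 \<le> f" "F x = ennreal f" by (cases "F x") auto
        then have "f < k x" using lt by (simp add: ennreal_less_iff)
        then obtain q where "q \<in> \<rat>" "f < q" "q < k x" using Rats_dense_in_real by blast
        then show False using elim f by (fastforce simp: ennreal_less_iff)
      qed
    qed
  qed
  have lim: "AE x in M. (\<lambda>n. h n x) \<longlonglongrightarrow> enn2real (F x)"
    using Hh Ffin
  proof eventually_elim
    case (elim x)
    have "(\<lambda>n. ennreal (H n x)) \<longlonglongrightarrow> F x"
      unfolding F_def by (intro LIMSEQ_SUP) (auto simp: incseq_def intro!: ennreal_leI H_mono)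
    then have "(\<lambda>n. enn2real (ennreal (H n x))) \<longlonglongrightarrow> enn2real (F x)"
      using elim by (intro tendsto_enn2real) auto
    then show ?case using elim nonneg[OF h(1)] by simp
  qed
  show ?thesis
  proof (intro exI[of _ "\<lambda>x. enn2real (F x)"] exI[of _ h] conjI ballI allI h(1) lim)
    fix k assume k: "k \<in> G"
    show "AE x in M. k x \<le> enn2real (F x)"
      using dom[OF k] Ffin
    proof eventually_elim
      case (elim x)
      then show ?case using enn2real_mono[of "ennreal (k x)" "F x"] nonneg[OF k] by simp
    qed
  next
    show "weak_bound M \<theta> c (\<lambda>x. enn2real (F x))"
      unfolding weak_bound_def
    proof safe
      fix l :: real assume l: "0 < l"
      have "emeasure M {x \<in> space M. l < \<bar>enn2real (F x)\<bar>} \<le> emeasure M {x \<in> space M. ennreal l < F x}"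
      proof (intro emeasure_mono subsetI)
        fix x assume x: "x \<in> {x \<in> space M. l < \<bar>enn2real (F x)\<bar>}"
        then show "x \<in> {x \<in> space M. ennreal l < F x}"
          using l by (cases "F x") (auto simp: ennreal_less_iff)
      qed auto
      then show "emeasure M {x \<in> space M. l < \<bar>enn2real (F x)\<bar>} \<le> ennreal ((c / l) powr (1 / \<theta>))"
        using bF[OF l] by (rule order_trans)
    qed
  qed measurable
qed

section \<open>The positive part of a splittable operator\<close>


text \<open>The slices contribute 2KL for the bottom one and 4K times 2\<theta>L for all others
  together; \<open>C_weak\<close> is the price for adding them through integrals.\<close>

definition C_regular :: "real \<Rightarrow> real" where
  "C_regular \<theta> = 2 * C_weak \<theta> * (1 + 4 * \<theta>)"

lemma C_regular_pos: "0 < \<theta> \<Longrightarrow> \<theta> < 1 \<Longrightarrow> 0 < C_regular \<theta>"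
  using C_weak_pos[of \<theta>] by (simp add: C_regular_def)

text \<open>The bounds of the two operator norms are unfolded into inequalities with real constants
  \<open>a\<close> and \<open>b\<close>, away from \<open>ennreal\<close> infima.\<close>

definition split_op :: "'b measure \<Rightarrow> 'a measure \<Rightarrow> real \<Rightarrow> real \<Rightarrow> (('b \<Rightarrow> real) \<Rightarrow> ('a \<Rightarrow> real))
    \<Rightarrow> (('b \<Rightarrow> real) \<Rightarrow> ('a \<Rightarrow> real)) \<Rightarrow> (('b \<Rightarrow> real) \<Rightarrow> ('a \<Rightarrow> real)) \<Rightarrow> bool" where
  "split_op N M a b T T0 T1 \<longleftrightarrow> lin_op_on N M (Dint N) T0 \<and> lin_op_on N M (Dint N) T1 \<and>
     (\<forall>f\<in>Dint N. AE x in M. T f x = T0 f x + T1 f x) \<and>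
     (\<forall>f\<in>Dint N. \<forall>h\<ge>0. (AE y in N. \<bar>f y\<bar> \<le> h) \<longrightarrow> (AE x in M. \<bar>T0 f x\<bar> \<le> a * h)) \<and>
     (\<forall>f\<in>Dint N. (\<integral>\<^sup>+x. ennreal \<bar>T1 f x\<bar> \<partial>M) \<le> ennreal b * (\<integral>\<^sup>+y. ennreal \<bar>f y\<bar> \<partial>N))"

lemma borel_measurable_sum_list:
  fixes \<phi> :: "'c \<Rightarrow> 'a \<Rightarrow> real"
  assumes "\<And>a. a \<in> set fs \<Longrightarrow> \<phi> a \<in> borel_measurable M"
  shows "(\<lambda>x. \<Sum>a\<leftarrow>fs. \<phi> a x) \<in> borel_measurable M"
  using assms
proof (induction fs)
  case (Cons a fs)
  then have "\<phi> a \<in> borel_measurable M" "(\<lambda>x. \<Sum>a\<leftarrow>fs. \<phi> a x) \<in> borel_measurable M" by auto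
  then show ?case by (simp add: borel_measurable_add)
qed simp

text \<open>The powers of t come from a K-functional below K t^\<theta>: this bounds the first norm
  directly, and the second one after division by t.\<close>

locale splittable_operator =
  fixes N :: "'b measure" and M :: "'a measure" and \<theta> K :: real
    and T :: "('b \<Rightarrow> real) \<Rightarrow> ('a \<Rightarrow> real)"
  assumes th: "0 < \<theta>" "\<theta> < 1" and K: "0 < K"
    and lin: "lin_op_on N M (Dint N) T"
    and split: "\<And>t. 0 < t \<Longrightarrow> \<exists>T0 T1. split_op N M (K * t powr \<theta>) (K * t powr (\<theta> - 1)) T T0 T1"
begin

text \<open>Lists keep the multiplicity of equal summands. Nonnegativity holds everywhere rather
  than a.e., so quotients by the total can be handled pointwise.\<close>

definition pos_list :: "('b \<Rightarrow> real) list \<Rightarrow> bool" where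
  "pos_list fs \<longleftrightarrow> (\<forall>a\<in>set fs. a \<in> Dint N \<and> (\<forall>y. 0 \<le> a y))"

definition total :: "('b \<Rightarrow> real) list \<Rightarrow> 'b \<Rightarrow> real" where
  "total fs y = (\<Sum>a\<leftarrow>fs. a y)"

definition possum :: "('b \<Rightarrow> real) list \<Rightarrow> 'a \<Rightarrow> real" where
  "possum fs x = (\<Sum>a\<leftarrow>fs. max (T a x) 0)"

lemma pos_list_Cons: "pos_list (a # fs) \<longleftrightarrow> a \<in> Dint N \<and> (\<forall>y. 0 \<le> a y) \<and> pos_list fs"
  by (auto simp: pos_list_def)

lemma pos_list_append: "pos_list (fs @ gs) \<longleftrightarrow> pos_list fs \<and> pos_list gs"
  by (auto simp: pos_list_def)

lemma total_simps [simp]: "total [] = (\<lambda>y. 0)" "total (a # fs) = (\<lambda>y. a y + total fs y)"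
  "total (fs @ gs) = (\<lambda>y. total fs y + total gs y)"
  by (auto simp: total_def)

lemma possum_simps [simp]: "possum [] = (\<lambda>x. 0)" "possum (a # fs) = (\<lambda>x. max (T a x) 0 + possum fs x)"
  "possum (fs @ gs) = (\<lambda>x. possum fs x + possum gs x)"
  by (auto simp: possum_def)

lemma total_Dint: "pos_list fs \<Longrightarrow> total fs \<in> Dint N"
  by (induction fs) (auto simp: Dint_zero pos_list_Cons intro: Dint_add)

lemma total_nonneg: "pos_list fs \<Longrightarrow> 0 \<le> total fs y"
  by (induction fs) (auto simp: pos_list_Cons)

lemma possum_nonneg: "0 \<le> possum fs x"
  by (induction fs) auto

lemma possum_measurable: "pos_list fs \<Longrightarrow> possum fs \<in> borel_measurable M"
  unfolding possum_def[abs_def]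
  by (intro borel_measurable_sum_list borel_measurable_max borel_measurable_const
      lin_op_on_measurable[OF lin]) (auto simp: pos_list_def)

lemma member_le_total: "pos_list fs \<Longrightarrow> a \<in> set fs \<Longrightarrow> a y \<le> total fs y"
  by (induction fs) (auto simp: pos_list_Cons total_nonneg add_increasing add_increasing2)

lemma total_map_mult: "total (map (\<lambda>a y. a y * w y) fs) y = total fs y * w y"
  by (induction fs) (auto simp: distrib_right)

lemma pos_list_map_mult:
  assumes "pos_list fs" "w \<in> borel_measurable N" "\<And>y. 0 \<le> w y" "\<And>y. w y \<le> 1"
  shows "pos_list (map (\<lambda>a y. a y * w y) fs)"
  unfolding pos_list_def
proof safe
  fix b assume "b \<in> set (map (\<lambda>a y. a y * w y) fs)"
  then obtain a where a: "a \<in> set fs" "b = (\<lambda>y. a y * w y)" by auto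
  then have a': "a \<in> Dint N" "\<And>y. 0 \<le> a y" using assms(1) by (auto simp: pos_list_def)
  show "b \<in> Dint N"
    unfolding a(2) using a' assms
    by (intro Dint_dominated[OF _ a'(1)]) (auto simp: abs_mult intro!: AE_I2 mult_left_le)
  show "0 \<le> b y" for y using a a' assms by simp
qed

lemma T_total: "pos_list fs \<Longrightarrow> AE x in M. T (total fs) x = (\<Sum>a\<leftarrow>fs. T a x)"
proof (induction fs)
  case Nil
  then show ?case using lin_op_on_zero[OF lin Dint_zero] by simp
next
  case (Cons a fs)
  then have "AE x in M. T (total fs) x = (\<Sum>a\<leftarrow>fs. T a x)" by (simp add: pos_list_Cons)
  moreover have "AE x in M. T (\<lambda>y. a y + total fs y) x = T a x + T (total fs) x"
    using Cons.prems by (intro lin_op_on_add[OF lin] total_Dint) (auto simp: pos_list_Cons)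
  ultimately show ?case by eventually_elim simp
qed

lemma possum_ge: "pos_list fs \<Longrightarrow> AE x in M. max (T (total fs) x) 0 \<le> possum fs x"
proof -
  have *: "(\<Sum>a\<leftarrow>fs. T a x) \<le> possum fs x" for x by (induction fs) auto
  assume "pos_list fs"
  from T_total[OF this] show ?thesis
    by eventually_elim (use * possum_nonneg in auto)
qed

text \<open>Absorbing one function after the other into \<open>g\<close> bounds the sum of the positive parts by
  the images of all partial sums.\<close>
lemma possum_bounded_part:
  assumes lin0: "lin_op_on N M (Dint N) T0"
    and bd: "\<And>f. f \<in> Dint N \<Longrightarrow> AE y in N. \<bar>f y\<bar> \<le> h \<Longrightarrow> AE x in M. \<bar>T0 f x\<bar> \<le> c"
  shows "pos_list fs \<Longrightarrow> g \<in> Dint N \<Longrightarrow> (\<And>y. 0 \<le> g y) \<Longrightarrow> AE y in N. g y + total fs y \<le> h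
    \<Longrightarrow> AE x in M. T0 g x + (\<Sum>a\<leftarrow>fs. max (T0 a x) 0) \<le> c"
proof (induction fs arbitrary: g)
  case Nil
  then have "AE x in M. \<bar>T0 g x\<bar> \<le> c" by (intro bd) auto
  then show ?case by eventually_elim auto
next
  case (Cons a fs)
  then have a: "a \<in> Dint N" "\<And>y. 0 \<le> a y" "pos_list fs" by (auto simp: pos_list_Cons)
  have "AE y in N. g y + total fs y \<le> h" "AE y in N. (g y + a y) + total fs y \<le> h"
    using Cons.prems(4) by (eventually_elim, use a in \<open>auto simp: algebra_simps intro: order_trans[rotated]\<close>)+
  then have "AE x in M. T0 g x + (\<Sum>a\<leftarrow>fs. max (T0 a x) 0) \<le> c"
     "AE x in M. T0 (\<lambda>y. g y + a y) x + (\<Sum>a\<leftarrow>fs. max (T0 a x) 0) \<le> c"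
    using Cons.prems a by (intro Cons.IH Dint_add; auto)+
  moreover have "AE x in M. T0 (\<lambda>y. g y + a y) x = T0 g x + T0 a x"
    using Cons.prems a by (intro lin_op_on_add[OF lin0])
  ultimately show ?case by eventually_elim (auto simp: max_def)
qed

text \<open>The L^1 norm is additive on nonnegative functions, so the bounds for the single summands
  add up to the bound for the total.\<close>

lemma possum_integrable_part:
  assumes lin1: "lin_op_on N M (Dint N) T1"
    and bd: "\<And>f. f \<in> Dint N \<Longrightarrow> (\<integral>\<^sup>+x. ennreal \<bar>T1 f x\<bar> \<partial>M) \<le> ennreal b * (\<integral>\<^sup>+y. ennreal \<bar>f y\<bar> \<partial>N)"
  shows "pos_list fs \<Longrightarrow> (\<integral>\<^sup>+x. ennreal (\<Sum>a\<leftarrow>fs. \<bar>T1 a x\<bar>) \<partial>M) \<le> ennreal b * (\<integral>\<^sup>+y. ennreal (total fs y) \<partial>N)"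
proof (induction fs)
  case (Cons a fs)
  then have a: "a \<in> Dint N" "\<And>y. 0 \<le> a y" "pos_list fs" by (auto simp: pos_list_Cons)
  have m: "T1 b \<in> borel_measurable M" if "b \<in> set (a # fs)" for b
    using that Cons.prems by (intro lin_op_on_measurable[OF lin1]) (auto simp: pos_list_def)
  have [measurable]: "(\<lambda>x. \<Sum>a\<leftarrow>fs. \<bar>T1 a x\<bar>) \<in> borel_measurable M"
    using m by (intro borel_measurable_sum_list borel_measurable_abs) auto
  have [measurable]: "T1 a \<in> borel_measurable M" using m by simp
  have "(\<integral>\<^sup>+x. ennreal (\<Sum>b\<leftarrow>a # fs. \<bar>T1 b x\<bar>) \<partial>M)
      = (\<integral>\<^sup>+x. ennreal \<bar>T1 a x\<bar> + ennreal (\<Sum>b\<leftarrow>fs. \<bar>T1 b x\<bar>) \<partial>M)"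
    by (intro nn_integral_cong) (auto intro!: ennreal_plus sum_list_nonneg)
  also have "\<dots> = (\<integral>\<^sup>+x. ennreal \<bar>T1 a x\<bar> \<partial>M) + (\<integral>\<^sup>+x. ennreal (\<Sum>b\<leftarrow>fs. \<bar>T1 b x\<bar>) \<partial>M)"
    by (rule nn_integral_add) auto
  also have "\<dots> \<le> ennreal b * (\<integral>\<^sup>+y. ennreal \<bar>a y\<bar> \<partial>N) + ennreal b * (\<integral>\<^sup>+y. ennreal (total fs y) \<partial>N)"
    using a by (intro add_mono bd Cons.IH)
  also have "\<dots> = ennreal b * ((\<integral>\<^sup>+y. ennreal (a y) \<partial>N) + (\<integral>\<^sup>+y. ennreal (total fs y) \<partial>N))"
    using a by (simp add: distrib_left)
  also have "(\<integral>\<^sup>+y. ennreal (a y) \<partial>N) + (\<integral>\<^sup>+y. ennreal (total fs y) \<partial>N) = (\<integral>\<^sup>+y. ennreal (a y) + ennreal (total fs y) \<partial>N)"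
    using a total_Dint[OF a(3)] by (intro nn_integral_add[symmetric]) auto
  also have "\<dots> = (\<integral>\<^sup>+y. ennreal (total (a # fs) y) \<partial>N)"
    using a total_nonneg[OF a(3)] by simp
  finally show ?case .
qed simp

text \<open>Marcinkiewicz argument: every level \<open>l\<close> is treated with its own splitting
  of T. Neither part depends on the number of summands.\<close>

lemma possum_weak_bound_Dint:
  assumes fs: "pos_list fs" and h: "0 < h" and k: "0 \<le> k"
    and hb: "AE y in N. total fs y \<le> h" and kb: "(\<integral>\<^sup>+y. ennreal (total fs y) \<partial>N) \<le> ennreal k"
  shows "weak_bound M \<theta> (2 * K * h powr (1 - \<theta>) * k powr \<theta>) (possum fs)"
  unfolding weak_bound_def
proof safe
  fix l :: real assume l: "0 < l"
  \<comment> \<open>With this t the bounded part is at most K t^\<theta> h = l/2, so exceeding l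
    forces the integrable part above l/2, where Chebyshev applies.\<close>
  define t where "t = (l / (2 * K * h)) powr (1/\<theta>)"
  have t: "0 < t" using l K h by (simp add: t_def)
  have tt: "t powr \<theta> = l / (2 * K * h)" unfolding t_def using th l K h by (simp add: powr_powr)
  obtain T0 T1 where sp: "split_op N M (K * t powr \<theta>) (K * t powr (\<theta> - 1)) T T0 T1"
    using split[OF t] by blast
  have lin0: "lin_op_on N M (Dint N) T0" and lin1: "lin_op_on N M (Dint N) T1"
    using sp by (auto simp: split_op_def)
  have K0: "K * t powr \<theta> * h = l / 2" using K h by (simp add: tt)
  have A: "AE x in M. (\<Sum>a\<leftarrow>fs. max (T0 a x) 0) \<le> l / 2"
  proof -
    have "AE x in M. T0 (\<lambda>y. 0) x + (\<Sum>a\<leftarrow>fs. max (T0 a x) 0) \<le> l / 2"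
    proof (rule possum_bounded_part[OF lin0 _ fs Dint_zero])
      show "AE x in M. \<bar>T0 f x\<bar> \<le> l / 2" if "f \<in> Dint N" "AE y in N. \<bar>f y\<bar> \<le> h" for f
        using sp that h unfolding split_op_def K0[symmetric] by (meson less_imp_le)
    qed (use hb in auto)
    with lin_op_on_zero[OF lin0 Dint_zero] show ?thesis by eventually_elim simp
  qed
  have B: "(\<integral>\<^sup>+x. ennreal (\<Sum>a\<leftarrow>fs. \<bar>T1 a x\<bar>) \<partial>M) \<le> ennreal (K * t powr (\<theta> - 1) * k)"
  proof -
    have "(\<integral>\<^sup>+x. ennreal (\<Sum>a\<leftarrow>fs. \<bar>T1 a x\<bar>) \<partial>M) \<le> ennreal (K * t powr (\<theta> - 1)) * (\<integral>\<^sup>+y. ennreal (total fs y) \<partial>N)"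
      using sp fs by (intro possum_integrable_part[OF lin1]) (auto simp: split_op_def)
    also have "\<dots> \<le> ennreal (K * t powr (\<theta> - 1)) * ennreal k" by (intro mult_left_mono kb) auto
    also have "\<dots> = ennreal (K * t powr (\<theta> - 1) * k)" using K k by (simp add: ennreal_mult)
    finally show ?thesis .
  qed
  have C: "AE x in M. possum fs x \<le> (\<Sum>a\<leftarrow>fs. max (T0 a x) 0) + (\<Sum>a\<leftarrow>fs. \<bar>T1 a x\<bar>)"
    using fs
  proof (induction fs)
    case (Cons a fs)
    then have a: "a \<in> Dint N" "pos_list fs" by (auto simp: pos_list_Cons)
    then have "AE x in M. T a x = T0 a x + T1 a x" using sp by (simp add: split_op_def)
    with Cons.IH[OF a(2)] show ?case by eventually_elim auto
  qed simp
  have [measurable]: "(\<lambda>x. \<Sum>a\<leftarrow>fs. \<bar>T1 a x\<bar>) \<in> borel_measurable M"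
  proof -
    have "T1 b \<in> borel_measurable M" if "b \<in> set fs" for b
      using that fs by (intro lin_op_on_measurable[OF lin1]) (auto simp: pos_list_def)
    then show ?thesis by (intro borel_measurable_sum_list borel_measurable_abs)
  qed
  note [measurable] = possum_measurable[OF fs]
  let ?E = "{x \<in> space M. l / 2 < (\<Sum>a\<leftarrow>fs. \<bar>T1 a x\<bar>)}"
  have "ennreal (l / 2) * emeasure M {x \<in> space M. l < \<bar>possum fs x\<bar>} \<le> ennreal (l / 2) * emeasure M ?E"
  proof (intro mult_left_mono emeasure_mono_AE)
    show "AE x in M. x \<in> {x \<in> space M. l < \<bar>possum fs x\<bar>} \<longrightarrow> x \<in> ?E"
      using A C by eventually_elim (use possum_nonneg[of fs] in auto)
  qed auto
  also have "\<dots> = (\<integral>\<^sup>+x. ennreal (l / 2) * indicator ?E x \<partial>M)"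
    by (subst nn_integral_cmult_indicator) auto
  also have "\<dots> \<le> (\<integral>\<^sup>+x. ennreal (\<Sum>a\<leftarrow>fs. \<bar>T1 a x\<bar>) \<partial>M)"
    by (intro nn_integral_mono) (auto split: split_indicator intro!: ennreal_leI)
  also have "\<dots> \<le> ennreal (K * t powr (\<theta> - 1) * k)" by (rule B)
  also have "\<dots> = ennreal (l / 2) * ennreal (k / (h * t))"
  proof -
    have eq: "K * t powr (\<theta> - 1) * k = l / 2 * (k / (h * t))"
      using K h t l by (simp add: powr_diff tt field_simps)
    show ?thesis unfolding eq using l h t k by (intro ennreal_mult) auto
  qed
  finally have "emeasure M {x \<in> space M. l < \<bar>possum fs x\<bar>} \<le> ennreal (k / (h * t))"
    using l by (subst (asm) ennreal_mult_le_mult_iff) (auto simp: ennreal_eq_0_iff)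
  also have "k / (h * t) = (2 * K * h powr (1 - \<theta>) * k powr \<theta> / l) powr (1 / \<theta>)"
  proof -
    have "2 * K * h powr (1 - \<theta>) * k powr \<theta> / l = k powr \<theta> / (h powr \<theta> * t powr \<theta>)"
      using l h K by (simp add: tt powr_diff field_simps)
    also have "\<dots> = (k / (h * t)) powr \<theta>" using k h t by (simp add: powr_divide powr_mult)
    finally show ?thesis using th k h t by (simp add: powr_powr)
  qed
  finally show "emeasure M {x \<in> space M. l < \<bar>possum fs x\<bar>}
      \<le> ennreal ((2 * K * h powr (1 - \<theta>) * k powr \<theta> / l) powr (1 / \<theta>))" .
qed

text \<open>Cutting every summand by a partition of unity can only increase the sum of positive
  parts, because the positive part is subadditive.\<close>

lemma possum_split:
  assumes fs: "pos_list fs" and I: "finite I"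
    and w: "\<And>i. i \<in> I \<Longrightarrow> w i \<in> borel_measurable N" "\<And>i y. 0 \<le> w i y" "\<And>i y. w i y \<le> 1"
    and one: "AE y in N. (\<Sum>i\<in>I. w i y) = 1"
  shows "AE x in M. possum fs x \<le> (\<Sum>i\<in>I. possum (map (\<lambda>a y. a y * w i y) fs) x)"
  using fs
proof (induction fs)
  case (Cons a fs)
  then have a: "a \<in> Dint N" "\<And>y. 0 \<le> a y" "pos_list fs" by (auto simp: pos_list_Cons)
  have aw: "(\<lambda>y. a y * w i y) \<in> Dint N" if "i \<in> I" for i
    using that w a(2) by (intro Dint_dominated[OF _ a(1)] borel_measurable_times Dint_measurable[OF a(1)])
      (auto simp: abs_mult intro!: AE_I2 mult_left_le)
  have "AE x in M. T (\<lambda>y. \<Sum>i\<in>I. a y * w i y) x = (\<Sum>i\<in>I. T (\<lambda>y. a y * w i y) x)"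
    by (intro lin_op_on_sum[OF lin I] aw)
  moreover have "AE x in M. T a x = T (\<lambda>y. \<Sum>i\<in>I. a y * w i y) x"
    using one by (intro lin_op_on_cong[OF lin a(1)] Dint_sum aw)
      (auto simp: sum_distrib_left[symmetric])
  ultimately show ?case using Cons.IH[OF a(3)]
  proof eventually_elim
    case (elim x)
    have "T a x \<le> (\<Sum>i\<in>I. max (T (\<lambda>y. a y * w i y) x) 0)"
      using elim by (auto intro!: sum_mono)
    moreover have "0 \<le> (\<Sum>i\<in>I. max (T (\<lambda>y. a y * w i y) x) 0)" by (intro sum_nonneg) auto
    ultimately show ?case using elim by (simp add: sum.distrib)
  qed
qed (simp add: sum_nonneg)

text \<open>This is the uniform estimate behind the suprema: the constant sees \<open>f\<close> only
  through its norm, and neither the bound nor the integral of the decomposition. The total is cut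
  into dyadic slices according to its own values; since it lies below \<open>f\<close>, each slice
  lives on a level set of \<open>f\<close>.\<close>

lemma possum_weak_bound:
  assumes fs: "pos_list fs" and f: "f \<in> Lp1 N (1/\<theta>)" and le: "AE y in N. total fs y \<le> f y"
    and L: "0 < L" "lorentz_1_norm N (1/\<theta>) f \<le> ennreal L"
  shows "weak_bound M \<theta> (C_regular \<theta> * K * L) (possum fs)"
proof -
  define H where "H = total fs"
  have H: "H \<in> Dint N" "\<And>y. 0 \<le> H y" using fs by (auto simp: H_def total_Dint total_nonneg)
  note [measurable] = Dint_measurable[OF H(1)] Lp1_measurable[OF f] possum_measurable[OF fs]
  obtain h where h: "h > 0" "AE y in N. \<bar>H y\<bar> \<le> h" using H by (auto simp: Dint_iff)
  define k where "k = (\<integral>y. H y \<partial>N) + 1"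
  have "0 \<le> (\<integral>y. H y \<partial>N)" using H by (intro integral_nonneg_AE) auto
  then have k: "0 < k" by (simp add: k_def)
  have Hk: "(\<integral>\<^sup>+y. ennreal (H y) \<partial>N) \<le> ennreal k"
    using Dint_integrable[OF H(1)] H by (subst nn_integral_eq_integral) (auto simp: k_def intro!: ennreal_leI)
  \<comment> \<open>The lowest level is so small that the bottom slice, with supremum e and integral
    at most k, satisfies e^(1-\<theta>) k^\<theta> = L.\<close>
  define e where "e = (L / k powr \<theta>) powr (1 / (1 - \<theta>))"
  have e: "0 < e" using L k by (simp add: e_def)
  have ek: "e powr (1 - \<theta>) * k powr \<theta> = L"
    unfolding e_def using th L k by (simp add: powr_powr)
  obtain n where n: "h < e * 2 ^ n"
    using real_arch_pow[of 2 "h / e"] e by (auto simp: field_simps)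
  define d where "d j = measure N {y \<in> space N. e * 2^j < \<bar>f y\<bar>}" for j :: nat
  have dsum: "(\<Sum>j<n. e * 2^j * d j powr \<theta>) \<le> 2 * \<theta> * L"
  proof -
    have "ennreal (\<Sum>j<n. e * 2^j * d j powr \<theta>) \<le> ennreal (2 * \<theta>) * lorentz_1_norm N (1/\<theta>) f"
      unfolding d_def using th by (intro dyadic_le_lorentz_1_norm f e) auto
    also have "\<dots> \<le> ennreal (2 * \<theta>) * ennreal L" by (intro mult_left_mono L) auto
    also have "\<dots> = ennreal (2 * \<theta> * L)" using th L by (simp add: ennreal_mult)
    finally show ?thesis using th L by (subst (asm) ennreal_le_iff) auto
  qed
  \<comment> \<open>Index 0 is the bottom slice H \<le> e; the index shift by one pairs slice
    \<open>Suc i\<close> with the level e 2^i that bounds its support.\<close>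
  define w where "w j = (case j of 0 \<Rightarrow> indicat_real {y. H y \<le> e}
      | Suc i \<Rightarrow> indicat_real {y. e * 2^i < H y \<and> H y \<le> e * 2 ^ Suc i})" for j
  have w: "w j \<in> borel_measurable N" "0 \<le> w j y" "w j y \<le> 1" for j y
  proof -
    have "indicat_real {y. H y \<le> e} \<in> borel_measurable N"
      by (rule borel_measurable_indicator') measurable
    moreover have "indicat_real {y. e * 2^i < H y \<and> H y \<le> e * 2 ^ Suc i} \<in> borel_measurable N" for i
      by (rule borel_measurable_indicator') measurable
    ultimately show "w j \<in> borel_measurable N" by (auto simp: w_def split: nat.split)
    show "0 \<le> w j y" "w j y \<le> 1" by (auto simp: w_def split: nat.split)
  qed
  have one: "AE y in N. (\<Sum>j\<le>n. w j y) = 1"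
    using h(2)
  proof eventually_elim
    case (elim y)
    then have y: "H y < e * 2 ^ n" using n by simp
    have "(\<Sum>j\<le>m. w j y) = indicat_real {y. H y \<le> e * 2 ^ m} y" for m
    proof (induction m)
      case (Suc m)
      have "e * 2 ^ m \<le> e * 2 ^ Suc m" using e by simp
      then show ?case using Suc unfolding sum.atMost_Suc
        by (auto simp: w_def indicator_def)
    qed (simp add: w_def)
    then show ?case using y by simp
  qed
  define F where "F j = map (\<lambda>a y. a y * w j y) fs" for j
  have Fpos: "pos_list (F j)" for j unfolding F_def by (intro pos_list_map_mult fs w)
  note [measurable] = possum_measurable[OF Fpos]
  have Ftot: "total (F j) y = H y * w j y" for j y by (simp add: F_def total_map_mult H_def)
  define c where "c j = (case j of 0 \<Rightarrow> 2 * K * L | Suc i \<Rightarrow> 4 * K * (e * 2^i * d i powr \<theta>))" for j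
  have c0: "0 \<le> c j" for j using K L e by (auto simp: c_def split: nat.split)
  have wb: "weak_bound M \<theta> (c j) (possum (F j))" for j
  proof (cases j)
    case 0
    have "weak_bound M \<theta> (2 * K * e powr (1 - \<theta>) * k powr \<theta>) (possum (F j))"
    proof (rule possum_weak_bound_Dint[OF Fpos e])
      show "AE y in N. total (F j) y \<le> e" using 0 e by (auto simp: Ftot w_def indicator_def)
      show "(\<integral>\<^sup>+y. ennreal (total (F j) y) \<partial>N) \<le> ennreal k"
        using w(3) H(2) by (intro order_trans[OF nn_integral_mono Hk]) (auto simp: Ftot intro!: ennreal_leI mult_left_le)
    qed (use k in simp)
    then show ?thesis using 0 by (simp add: c_def mult.assoc ek)
  next
    case (Suc i)
    have di: "0 \<le> d i" by (simp add: d_def)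
    let ?E = "{y \<in> space N. e * 2^i < \<bar>f y\<bar>}"
    have Em: "emeasure N ?E = ennreal (d i)"
      unfolding d_def using e th by (intro emeasure_eq_measure2 Lp1_distribution_finite[OF th(1) f]) auto
    have "weak_bound M \<theta> (2 * K * (e * 2 ^ Suc i) powr (1 - \<theta>) * (e * 2 ^ Suc i * d i) powr \<theta>) (possum (F j))"
    proof (rule possum_weak_bound_Dint[OF Fpos])
      show "AE y in N. total (F j) y \<le> e * 2 ^ Suc i" using Suc e by (auto simp: Ftot w_def indicator_def)
      have "(\<integral>\<^sup>+y. ennreal (total (F j) y) \<partial>N) \<le> (\<integral>\<^sup>+y. ennreal (e * 2 ^ Suc i) * indicator ?E y \<partial>N)"
      proof (intro nn_integral_mono_AE)
        show "AE y in N. ennreal (total (F j) y) \<le> ennreal (e * 2 ^ Suc i) * indicator ?E y"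
          using le AE_space
        proof eventually_elim
          case (elim y)
          then have "w j y = 0 \<or> (e * 2^i < \<bar>f y\<bar> \<and> H y \<le> e * 2 ^ Suc i \<and> w j y = 1)"
            using Suc by (auto simp: w_def indicator_def H_def)
          then show ?case using elim(2) by (auto simp: Ftot intro!: ennreal_leI)
        qed
      qed
      also have "\<dots> = ennreal (e * 2 ^ Suc i * d i)"
        using e di by (subst nn_integral_cmult_indicator) (auto simp: Em ennreal_mult)
      finally show "(\<integral>\<^sup>+y. ennreal (total (F j) y) \<partial>N) \<le> ennreal (e * 2 ^ Suc i * d i)" .
    qed (use e di in auto)
    moreover have "(e * 2 ^ Suc i) powr (1 - \<theta>) * (e * 2 ^ Suc i * d i) powr \<theta> = e * 2 ^ Suc i * d i powr \<theta>"
      using e di by (simp add: powr_mult powr_diff)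
    ultimately show ?thesis using Suc by (simp add: c_def mult_ac)
  qed
  have csum: "(\<Sum>j\<le>n. c j) \<le> 2 * K * (1 + 4 * \<theta>) * L"
  proof -
    have "(\<Sum>j\<le>n. c j) = 2 * K * L + (\<Sum>j<n. 4 * K * (e * 2^j * d j powr \<theta>))"
      by (subst sum.atMost_shift) (simp add: c_def)
    also have "\<dots> = 2 * K * L + 4 * K * (\<Sum>j<n. e * 2^j * d j powr \<theta>)" by (simp add: sum_distrib_left)
    also have "\<dots> \<le> 2 * K * L + 4 * K * (2 * \<theta> * L)" using dsum K by (intro add_left_mono mult_left_mono) auto
    finally show ?thesis by (simp add: algebra_simps)
  qed
  have total_le: "AE x in M. possum fs x \<le> (\<Sum>j\<le>n. possum (F j) x)"
    unfolding F_def by (rule possum_split[OF fs]) (use w one in auto)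
  \<comment> \<open>Its constant depends on the decomposition; it only supplies the finite level
    sets required by \<open>weak_bound_if_integral\<close>.\<close>
  have w0: "weak_bound M \<theta> (2 * K * h powr (1 - \<theta>) * k powr \<theta>) (possum fs)"
    using h k Hk H by (intro possum_weak_bound_Dint fs) (auto simp: H_def[symmetric])
  show ?thesis
  proof (rule weak_bound_if_integral[OF th _ w0])
    fix E assume E: "E \<in> fmeasurable M"
    then have [measurable]: "E \<in> sets M" by simp
    let ?m = "measure M E powr (1 - \<theta>)"
    have "(\<integral>\<^sup>+x\<in>E. ennreal \<bar>possum fs x\<bar> \<partial>M) \<le> (\<integral>\<^sup>+x. (\<Sum>j\<le>n. ennreal \<bar>possum (F j) x\<bar> * indicator E x) \<partial>M)"
    proof (intro nn_integral_mono_AE)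
      show "AE x in M. ennreal \<bar>possum fs x\<bar> * indicator E x \<le> (\<Sum>j\<le>n. ennreal \<bar>possum (F j) x\<bar> * indicator E x)"
        using total_le
      proof eventually_elim
        case (elim x)
        have "ennreal \<bar>possum fs x\<bar> \<le> ennreal (\<Sum>j\<le>n. possum (F j) x)"
          using elim possum_nonneg by (intro ennreal_leI) simp
        also have "\<dots> = (\<Sum>j\<le>n. ennreal \<bar>possum (F j) x\<bar>)"
          using possum_nonneg by (subst sum_ennreal[symmetric]) (auto intro!: sum.cong)
        finally show ?case by (simp add: sum_distrib_right[symmetric] mult_right_mono)
      qed
    qed
    also have "\<dots> = (\<Sum>j\<le>n. \<integral>\<^sup>+x\<in>E. ennreal \<bar>possum (F j) x\<bar> \<partial>M)"
      by (rule nn_integral_sum) measurable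
    also have "\<dots> \<le> (\<Sum>j\<le>n. ennreal (C_weak \<theta> * c j * ?m))"
      by (intro sum_mono weak_bound_integral_nonneg[OF th c0 wb _ E]) measurable
    also have "\<dots> = ennreal (\<Sum>j\<le>n. C_weak \<theta> * c j * ?m)"
      using c0 C_weak_pos[OF th] by (intro sum_ennreal) auto
    also have "(\<Sum>j\<le>n. C_weak \<theta> * c j * ?m) = C_weak \<theta> * (\<Sum>j\<le>n. c j) * ?m"
      by (simp add: sum_distrib_left sum_distrib_right)
    also have "ennreal \<dots> \<le> ennreal (C_weak \<theta> * (2 * K * (1 + 4 * \<theta>) * L) * ?m)"
      using csum C_weak_pos[OF th] by (intro ennreal_leI mult_right_mono mult_left_mono) auto
    finally show "(\<integral>\<^sup>+x\<in>E. ennreal \<bar>possum fs x\<bar> \<partial>M) \<le> ennreal (C_regular \<theta> * K * L * ?m)"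
      by (simp add: C_regular_def mult_ac)
  qed (use C_regular_pos[OF th] K L in auto)
qed

end


section \<open>Riesz-Kantorovich suprema and their extension to a linear operator\<close>

lemma sum_list_swap:
  fixes \<phi> :: "'a \<Rightarrow> 'b \<Rightarrow> real"
  shows "(\<Sum>a\<leftarrow>fs. \<Sum>b\<leftarrow>gs. \<phi> a b) = (\<Sum>b\<leftarrow>gs. \<Sum>a\<leftarrow>fs. \<phi> a b)"
  by (induction fs) (simp_all add: sum_list_addf)

context splittable_operator
begin

text \<open>Totals need only stay below f: an f outside \<open>Dint N\<close> is not a finite sum of
  members of \<open>Dint N\<close>, yet has decompositions below it.\<close>

definition parts :: "('b \<Rightarrow> real) \<Rightarrow> ('b \<Rightarrow> real) list set" where
  "parts f = {fs. pos_list fs \<and> (AE y in N. total fs y \<le> f y)}"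

lemma Nil_in_parts: "AE y in N. 0 \<le> f y \<Longrightarrow> [] \<in> parts f"
  by (simp add: parts_def pos_list_def)

text \<open>The Riesz decomposition matrix: for equal totals the entries a b / total have the
  members of both lists as row and column sums. Where the total vanishes all entries do, in
  accordance with division by zero.\<close>

definition refine :: "('b \<Rightarrow> real) list \<Rightarrow> ('b \<Rightarrow> real) list \<Rightarrow> ('b \<Rightarrow> real) list" where
  "refine fs gs = concat (map (\<lambda>a. map (\<lambda>b y. a y * b y / total fs y) gs) fs)"

lemma total_concat_map: "total (concat (map \<phi> fs)) y = (\<Sum>a\<leftarrow>fs. total (\<phi> a) y)"
  by (induction fs) simp_all

lemma possum_concat_map: "possum (concat (map \<phi> fs)) x = (\<Sum>a\<leftarrow>fs. possum (\<phi> a) x)"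
  by (induction fs) simp_all

lemma total_map_scaled: "total (map (\<lambda>b y. c y * b y / H y) gs) y = c y * total gs y / H y"
  by (induction gs) (simp_all add: distrib_left add_divide_distrib)

lemma pos_list_map_scaled:
  assumes gs: "pos_list gs" and c: "c \<in> borel_measurable N" "H \<in> borel_measurable N"
    "\<And>y. 0 \<le> c y" "\<And>y. c y \<le> H y"
  shows "pos_list (map (\<lambda>b y. c y * b y / H y) gs)"
proof -
  have "pos_list (map (\<lambda>b y. b y * (c y / H y)) gs)"
  proof (rule pos_list_map_mult[OF gs])
    show "(\<lambda>y. c y / H y) \<in> borel_measurable N" using c by measurable
    show "0 \<le> c y / H y" "c y / H y \<le> 1" for y
      using c(3,4)[of y] by (auto intro!: divide_nonneg_nonneg simp: divide_le_eq_1)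
  qed
  then show ?thesis by (simp add: mult.commute)
qed

text \<open>Each row decomposes one member of \<open>fs\<close>, so \<open>possum_ge\<close> applies
  row by row. The matrix is symmetric in the two lists, which gives the same conclusion for
  \<open>gs\<close>.\<close>

lemma refine_props:
  assumes fs: "pos_list fs" and gs: "pos_list gs" and eq: "total fs = total gs"
  shows "pos_list (refine fs gs)" "total (refine fs gs) = total fs"
    "AE x in M. possum fs x \<le> possum (refine fs gs) x"
    "possum (refine fs gs) = possum (refine gs fs)"
proof -
  have tm: "total fs \<in> borel_measurable N" using Dint_measurable[OF total_Dint[OF fs]] .
  have am: "a \<in> borel_measurable N" "\<And>y. 0 \<le> a y" "\<And>y. a y \<le> total fs y" if "a \<in> set fs" for a
    using that fs member_le_total[OF fs that] by (auto simp: pos_list_def intro: Dint_measurable)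
  have row: "pos_list (map (\<lambda>b y. a y * b y / total fs y) gs)" if "a \<in> set fs" for a
    using am[OF that] by (intro pos_list_map_scaled gs tm) auto
  then show "pos_list (refine fs gs)" by (auto simp: pos_list_def refine_def)
  have rowsum: "total (map (\<lambda>b y. a y * b y / total fs y) gs) = a" if "a \<in> set fs" for a
  proof
    fix y
    have "a y = 0" if "total fs y = 0" using am(2,3)[OF \<open>a \<in> set fs\<close>, of y] that by (metis antisym)
    then show "total (map (\<lambda>b y. a y * b y / total fs y) gs) y = a y"
      unfolding total_map_scaled eq[symmetric] by auto
  qed
  show "total (refine fs gs) = total fs"
  proof
    fix y
    have "total (refine fs gs) y = (\<Sum>a\<leftarrow>fs. a y)"
      unfolding refine_def total_concat_map by (intro arg_cong[of _ _ sum_list] map_cong refl) (simp add: rowsum)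
    then show "total (refine fs gs) y = total fs y" by (simp add: total_def)
  qed
  have "AE x in M. \<forall>a\<in>set fs. max (T a x) 0 \<le> possum (map (\<lambda>b y. a y * b y / total fs y) gs) x"
    unfolding AE_ball_countable[OF countable_finite[OF finite_set]]
    using possum_ge[OF row] rowsum by auto
  then show "AE x in M. possum fs x \<le> possum (refine fs gs) x"
  proof eventually_elim
    case (elim x)
    then show ?case unfolding refine_def possum_concat_map possum_def[of fs]
      by (intro sum_list_mono) auto
  qed
  show "possum (refine fs gs) = possum (refine gs fs)"
  proof
    fix x
    show "possum (refine fs gs) x = possum (refine gs fs) x"
      unfolding refine_def possum_concat_map unfolding possum_def eq map_map o_def
      by (subst sum_list_swap) (simp add: mult.commute)
  qed
qed

lemma parts_directed:
  assumes fs: "fs \<in> parts f" and gs: "gs \<in> parts f"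
  shows "\<exists>r\<in>parts f. (AE x in M. possum fs x \<le> possum r x) \<and> (AE x in M. possum gs x \<le> possum r x)"
proof -
  have pf: "pos_list fs" and pg: "pos_list gs" using fs gs by (auto simp: parts_def)
  note D = total_Dint[OF pf] total_Dint[OF pg]
  define H where "H y = max (total fs y) (total gs y)" for y
  have HD: "H \<in> Dint N" unfolding H_def[abs_def] by (intro Dint_max D)
  \<comment> \<open>Both lists are padded to the common total H, the pointwise maximum, which is
    still below f a.e.\<close>
  define fs' where "fs' = (\<lambda>y. H y - total fs y) # fs"
  define gs' where "gs' = (\<lambda>y. H y - total gs y) # gs"
  have p': "pos_list fs'" "pos_list gs'"
    unfolding fs'_def gs'_def pos_list_Cons using pf pg HD D by (auto intro: Dint_diff) (auto simp: H_def)
  have t': "total fs' = H" "total gs' = H" by (auto simp: fs'_def gs'_def)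
  have eq: "total fs' = total gs'" by (simp add: t')
  note R = refine_props[OF p' eq] refine_props[OF p'(2,1) eq[symmetric]]
  have "AE y in N. total (refine fs' gs') y \<le> f y"
    using fs gs unfolding R(2) t' H_def parts_def by auto
  then have "refine fs' gs' \<in> parts f" using R(1) by (simp add: parts_def)
  moreover have "AE x in M. possum fs x \<le> possum (refine fs' gs') x"
    using R(3) by eventually_elim (auto simp: fs'_def intro: order_trans[rotated])
  moreover have "AE x in M. possum gs x \<le> possum (refine fs' gs') x"
    using R(7) unfolding R(4) by eventually_elim (auto simp: gs'_def intro: order_trans[rotated])
  ultimately show ?thesis by blast
qed

text \<open>The sequence encodes minimality: an a.e. upper bound of its countably many members
  passes to the limit F.\<close>

definition is_pospart :: "('b \<Rightarrow> real) \<Rightarrow> ('a \<Rightarrow> real) \<Rightarrow> bool" where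
  "is_pospart f F \<longleftrightarrow> F \<in> borel_measurable M \<and> (\<forall>fs\<in>parts f. AE x in M. possum fs x \<le> F x) \<and>
     (\<exists>r::nat \<Rightarrow> _. (\<forall>n. r n \<in> parts f) \<and> (AE x in M. (\<lambda>n. possum (r n) x) \<longlonglongrightarrow> F x))"

text \<open>The positive part of \<open>T\<close> on the positive cone (Riesz-Kantorovich formula).\<close>
definition pospart :: "('b \<Rightarrow> real) \<Rightarrow> 'a \<Rightarrow> real" where
  "pospart f = (SOME F. is_pospart f F)"

lemma is_pospart_exists:
  assumes f: "f \<in> Lp1 N (1/\<theta>)" "AE y in N. 0 \<le> f y"
    and L: "0 < L" "lorentz_1_norm N (1/\<theta>) f \<le> ennreal L"
  shows "\<exists>F. is_pospart f F \<and> weak_bound M \<theta> (C_regular \<theta> * K * L) F"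
proof -
  have "\<exists>F h. F \<in> borel_measurable M \<and> (\<forall>g\<in>possum ` parts f. AE x in M. g x \<le> F x)
      \<and> weak_bound M \<theta> (C_regular \<theta> * K * L) F
      \<and> (\<forall>n::nat. h n \<in> possum ` parts f) \<and> (AE x in M. (\<lambda>n. h n x) \<longlonglongrightarrow> F x)"
  proof (rule directed_weak_essential_supremum[OF th])
    show "0 \<le> C_regular \<theta> * K * L" using C_regular_pos[OF th] K L by simp
    show "possum ` parts f \<noteq> {}" using Nil_in_parts[OF f(2)] by blast
    show "\<exists>k\<in>possum ` parts f. (AE x in M. g x \<le> k x) \<and> (AE x in M. h x \<le> k x)"
      if "g \<in> possum ` parts f" "h \<in> possum ` parts f" for g h
      using that parts_directed by fastforce
  qed (use f L in \<open>auto simp: parts_def intro: possum_measurable possum_nonneg possum_weak_bound\<close>)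
  then obtain F h where F: "F \<in> borel_measurable M" "\<forall>g\<in>possum ` parts f. AE x in M. g x \<le> F x"
      "weak_bound M \<theta> (C_regular \<theta> * K * L) F" "\<forall>n::nat. h n \<in> possum ` parts f"
      "AE x in M. (\<lambda>n. h n x) \<longlonglongrightarrow> F x" by blast
  from F(4) have "\<forall>n. \<exists>r\<in>parts f. h n = possum r" by blast
  then obtain r where "\<forall>n. r n \<in> parts f \<and> h n = possum (r n)" by metis
  then have "is_pospart f F" using F unfolding is_pospart_def by (auto intro!: exI[of _ r])
  with F(3) show ?thesis by blast
qed

lemma pospart:
  assumes f: "f \<in> Lp1 N (1/\<theta>)" "AE y in N. 0 \<le> f y"
  shows "is_pospart f (pospart f)"
proof -
  obtain L where L: "0 \<le> L" "lorentz_1_norm N (1/\<theta>) f = ennreal L"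
    using f by (cases "lorentz_1_norm N (1/\<theta>) f") (auto simp: Lp1_def)
  then have "lorentz_1_norm N (1/\<theta>) f \<le> ennreal (L + 1)" by (simp add: ennreal_leI)
  with is_pospart_exists[OF f, of "L + 1"] L(1) have "\<exists>F. is_pospart f F" by auto
  then show ?thesis unfolding pospart_def by (rule someI_ex)
qed

lemma is_pospart_least:
  assumes "is_pospart f F" "\<And>fs. fs \<in> parts f \<Longrightarrow> AE x in M. possum fs x \<le> G x"
  shows "AE x in M. F x \<le> G x"
proof -
  obtain r where r: "\<And>n::nat. r n \<in> parts f" "AE x in M. (\<lambda>n. possum (r n) x) \<longlonglongrightarrow> F x"
    using assms(1) unfolding is_pospart_def by blast
  have "AE x in M. \<forall>n. possum (r n) x \<le> G x" using assms(2) r(1) by (subst AE_all_countable) auto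
  with r(2) show ?thesis by eventually_elim (auto intro: LIMSEQ_le_const2)
qed

lemma is_pospart_upper: "is_pospart f F \<Longrightarrow> fs \<in> parts f \<Longrightarrow> AE x in M. possum fs x \<le> F x"
  by (simp add: is_pospart_def)

lemma pospart_measurable:
  "f \<in> Lp1 N (1/\<theta>) \<Longrightarrow> AE y in N. 0 \<le> f y \<Longrightarrow> pospart f \<in> borel_measurable M"
  using pospart by (simp add: is_pospart_def)

lemma pospart_nonneg:
  "f \<in> Lp1 N (1/\<theta>) \<Longrightarrow> AE y in N. 0 \<le> f y \<Longrightarrow> AE x in M. 0 \<le> pospart f x"
  using is_pospart_upper[OF pospart Nil_in_parts] by simp

text \<open>The function F with the bound for this L need not be the one selected by
  \<open>SOME\<close>, but leastness puts the selected one below F a.e.\<close>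

lemma pospart_weak_bound:
  assumes f: "f \<in> Lp1 N (1/\<theta>)" "AE y in N. 0 \<le> f y"
    and L: "0 < L" "lorentz_1_norm N (1/\<theta>) f \<le> ennreal L"
  shows "weak_bound M \<theta> (C_regular \<theta> * K * L) (pospart f)"
proof -
  obtain F where F: "is_pospart f F" "weak_bound M \<theta> (C_regular \<theta> * K * L) F"
    using is_pospart_exists[OF f L] by blast
  have "AE x in M. pospart f x \<le> F x"
    by (rule is_pospart_least[OF pospart[OF f]]) (rule is_pospart_upper[OF F(1)])
  with pospart_nonneg[OF f] have "AE x in M. \<bar>pospart f x\<bar> \<le> \<bar>F x\<bar>" by eventually_elim auto
  then show ?thesis using F pospart_measurable[OF f]
    by (intro weak_bound_mono[OF F(2)]) (auto simp: is_pospart_def)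
qed

text \<open>The set of decompositions depends only on the a.e. class, so the choice operator selects
  literally the same function.\<close>

lemma pospart_cong:
  assumes "AE y in N. f y = g y" shows "pospart f = pospart g"
proof -
  have "(AE y in N. total fs y \<le> f y) = (AE y in N. total fs y \<le> g y)" for fs
    using assms by (intro eventually_subst) (auto elim!: eventually_mono)
  then have "parts f = parts g" by (simp add: parts_def)
  then show ?thesis by (simp add: pospart_def is_pospart_def)
qed

text \<open>For the upper estimate a decomposition below f + g is cut in the proportion f : g; for
  the lower one, decompositions of f and g are concatenated.\<close>

lemma pospart_add:
  assumes f: "f \<in> Lp1 N (1/\<theta>)" "AE y in N. 0 \<le> f y" and g: "g \<in> Lp1 N (1/\<theta>)" "AE y in N. 0 \<le> g y"
  shows "AE x in M. pospart (\<lambda>y. f y + g y) x = pospart f x + pospart g x"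
proof -
  have fg: "(\<lambda>y. f y + g y) \<in> Lp1 N (1/\<theta>)" "AE y in N. 0 \<le> f y + g y"
    using f g by (auto intro: Lp1_add)
  note [measurable] = Lp1_measurable[OF f(1)] Lp1_measurable[OF g(1)]
  have "AE x in M. pospart (\<lambda>y. f y + g y) x \<le> pospart f x + pospart g x"
  proof (rule is_pospart_least[OF pospart[OF fg]])
    fix fs assume fs: "fs \<in> parts (\<lambda>y. f y + g y)"
    then have p: "pos_list fs" and tf: "AE y in N. total fs y \<le> f y + g y" by (auto simp: parts_def)
    \<comment> \<open>The maxima make the weight lie in [0, 1] everywhere although f and g are
      nonnegative only a.e.\<close>
    define w where "w y = max (f y) 0 / (max (f y) 0 + max (g y) 0)" for y
    have w: "w \<in> borel_measurable N" "\<And>y. 0 \<le> w y" "\<And>y. w y \<le> 1"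
      unfolding w_def[abs_def] by (auto simp: divide_le_eq_1)
    let ?W = "\<lambda>i::bool. if i then w else (\<lambda>y. 1 - w y)"
    have W: "?W i \<in> borel_measurable N" "0 \<le> ?W i y" "?W i y \<le> 1" for i y using w by auto
    let ?F = "\<lambda>i. map (\<lambda>a y. a y * ?W i y) fs"
    have pF: "pos_list (?F i)" for i by (intro pos_list_map_mult p W)
    have "AE x in M. possum fs x \<le> (\<Sum>i\<in>UNIV. possum (?F i) x)"
      by (rule possum_split[OF p]) (use W in \<open>auto simp: UNIV_bool\<close>)
    moreover have "?F True \<in> parts f" "?F False \<in> parts g"
    proof -
      have "AE y in N. total fs y * w y \<le> f y \<and> total fs y * (1 - w y) \<le> g y"
        using f(2) g(2) tf
      proof eventually_elim
        case (elim y)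
        show ?case
        proof (cases "f y + g y = 0")
          case True
          then have "f y = 0" "g y = 0" using elim by auto
          then show ?thesis using elim total_nonneg[OF p, of y] by (simp add: antisym)
        next
          case False
          then have s: "0 < f y + g y" using elim by auto
          have wy: "w y = f y / (f y + g y)" using elim by (simp add: w_def)
          have wy': "1 - w y = g y / (f y + g y)" using s by (simp add: wy field_simps)
          have "total fs y * w y \<le> (f y + g y) * w y" "total fs y * (1 - w y) \<le> (f y + g y) * (1 - w y)"
            using elim w(2,3)[of y] by (auto intro!: mult_right_mono)
          then show ?thesis using s unfolding wy' by (simp add: wy)
        qed
      qed
      then show "?F True \<in> parts f" "?F False \<in> parts g"
        using pF[of True] pF[of False] by (auto simp: parts_def total_map_mult)
    qed
    then have "AE x in M. possum (?F True) x \<le> pospart f x" "AE x in M. possum (?F False) x \<le> pospart g x"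
      using is_pospart_upper[OF pospart[OF f]] is_pospart_upper[OF pospart[OF g]] by blast+
    ultimately show "AE x in M. possum fs x \<le> pospart f x + pospart g x"
      by eventually_elim (simp add: UNIV_bool)
  qed
  moreover have "AE x in M. pospart f x + pospart g x \<le> pospart (\<lambda>y. f y + g y) x"
  proof -
    obtain r where r: "\<And>n::nat. r n \<in> parts f" "AE x in M. (\<lambda>n. possum (r n) x) \<longlonglongrightarrow> pospart f x"
      using pospart[OF f] unfolding is_pospart_def by blast
    obtain s where s: "\<And>n::nat. s n \<in> parts g" "AE x in M. (\<lambda>n. possum (s n) x) \<longlonglongrightarrow> pospart g x"
      using pospart[OF g] unfolding is_pospart_def by blast
    have "r n @ s n \<in> parts (\<lambda>y. f y + g y)" for n
      using r(1)[of n] s(1)[of n] by (auto simp: parts_def pos_list_append)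
    then have "AE x in M. possum (r n @ s n) x \<le> pospart (\<lambda>y. f y + g y) x" for n
      using is_pospart_upper[OF pospart[OF fg]] by blast
    then have "AE x in M. \<forall>n. possum (r n) x + possum (s n) x \<le> pospart (\<lambda>y. f y + g y) x"
      by (subst AE_all_countable) simp
    with r(2) s(2) show ?thesis
      by eventually_elim (auto intro!: LIMSEQ_le_const2[OF tendsto_add])
  qed
  ultimately show ?thesis by eventually_elim simp
qed

lemma pospart_zero: "AE x in M. pospart (\<lambda>y. 0) x = 0"
proof -
  have "(\<lambda>y. 0) \<in> Lp1 N (1/\<theta>)" using Dint_subset_Lp1[OF th] Dint_zero by blast
  from pospart_add[OF this _ this] show ?thesis by auto
qed

lemma possum_map_cmult:
  assumes "pos_list fs" "0 \<le> c"
  shows "pos_list (map (\<lambda>b y. c * b y) fs)" "total (map (\<lambda>b y. c * b y) fs) y = c * total fs y"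
    "AE x in M. possum (map (\<lambda>b y. c * b y) fs) x = c * possum fs x"
proof -
  show "pos_list (map (\<lambda>b y. c * b y) fs)" using assms by (auto simp: pos_list_def intro: Dint_cmult)
  show "total (map (\<lambda>b y. c * b y) fs) y = c * total fs y" by (induction fs) (auto simp: distrib_left)
  show "AE x in M. possum (map (\<lambda>b y. c * b y) fs) x = c * possum fs x"
    using assms(1)
  proof (induction fs)
    case (Cons a fs)
    then have "a \<in> Dint N" "pos_list fs" by (auto simp: pos_list_Cons)
    then have "AE x in M. T (\<lambda>y. c * a y) x = c * T a x"
      "AE x in M. possum (map (\<lambda>b y. c * b y) fs) x = c * possum fs x"
      using lin_op_on_cmult[OF lin] Cons.IH by auto
    then show ?case
      by eventually_elim (use assms(2) in \<open>auto simp: distrib_left max_mult_distrib_left\<close>)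
  qed simp
qed

text \<open>One inequality for all positive factors suffices: applied to the factor 1/a and the
  function a f it becomes the reverse one.\<close>

lemma pospart_cmult:
  assumes f: "f \<in> Lp1 N (1/\<theta>)" "AE y in N. 0 \<le> f y" and a: "0 \<le> a"
  shows "AE x in M. pospart (\<lambda>y. a * f y) x = a * pospart f x"
proof (cases "a = 0")
  case True
  then show ?thesis using pospart_zero by simp
next
  case False
  have one: "AE x in M. pospart (\<lambda>y. c * g y) x \<le> c * pospart g x"
    if g: "g \<in> Lp1 N (1/\<theta>)" "AE y in N. 0 \<le> g y" and c: "0 < c" for c g
  proof (rule is_pospart_least[OF pospart])
    show "(\<lambda>y. c * g y) \<in> Lp1 N (1/\<theta>)" by (rule Lp1_cmult[OF g(1)])
    show "AE y in N. 0 \<le> c * g y" using g(2) c by auto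
    fix fs assume fs: "fs \<in> parts (\<lambda>y. c * g y)"
    then have p: "pos_list fs" and tf: "AE y in N. total fs y \<le> c * g y" by (auto simp: parts_def)
    note R = possum_map_cmult[OF p, of "1 / c"]
    have "map (\<lambda>b y. (1 / c) * b y) fs \<in> parts g"
    proof -
      have "AE y in N. total (map (\<lambda>b y. (1 / c) * b y) fs) y \<le> g y"
        using tf
      proof eventually_elim
        case (elim y)
        have t: "total (map (\<lambda>b y. (1 / c) * b y) fs) y = (1 / c) * total fs y"
          using R(2) c by simp
        show ?case unfolding t using elim c by (simp add: pos_divide_le_eq mult.commute)
      qed
      then show ?thesis using R(1) c unfolding parts_def by simp
    qed
    then have "AE x in M. possum (map (\<lambda>b y. (1 / c) * b y) fs) x \<le> pospart g x"
      by (rule is_pospart_upper[OF pospart[OF g]])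
    moreover have "AE x in M. possum (map (\<lambda>b y. (1 / c) * b y) fs) x = (1 / c) * possum fs x"
      using R(3) c by simp
    ultimately have "AE x in M. (1 / c) * possum fs x \<le> pospart g x"
      by eventually_elim simp
    then show "AE x in M. possum fs x \<le> c * pospart g x"
      by eventually_elim (use c in \<open>simp add: pos_divide_le_eq mult.commute\<close>)
  qed
  have a: "0 < a" using a False by simp
  have af: "(\<lambda>y. a * f y) \<in> Lp1 N (1/\<theta>)" "AE y in N. 0 \<le> a * f y"
    using f a by (auto intro: Lp1_cmult)
  have "AE x in M. pospart (\<lambda>y. (1 / a) * (a * f y)) x \<le> (1 / a) * pospart (\<lambda>y. a * f y) x"
    using a by (intro one af) auto
  moreover have "(\<lambda>y. (1 / a) * (a * f y)) = f" using a by auto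
  ultimately have "AE x in M. pospart f x \<le> (1 / a) * pospart (\<lambda>y. a * f y) x" by simp
  with one[OF f a] show ?thesis by eventually_elim (use a in \<open>auto simp: field_simps\<close>)
qed

definition pos_op :: "('b \<Rightarrow> real) \<Rightarrow> 'a \<Rightarrow> real" where
  "pos_op f x = pospart (\<lambda>y. max (f y) 0) x - pospart (\<lambda>y. max (- f y) 0) x"

lemma Lp1_max:
  assumes "f \<in> Lp1 N p" shows "(\<lambda>y. max (f y) 0) \<in> Lp1 N p" "(\<lambda>y. max (- f y) 0) \<in> Lp1 N p"
  using Lp1_measurable[OF assms] by (intro Lp1_dominated[OF _ assms]; auto)+

text \<open>Independence of the representation as a difference, from additivity and f^+ + h = f^- +
  g. Linearity of \<open>pos_op\<close> is read off by choosing convenient representations.\<close>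

lemma pos_op_diff:
  assumes f: "f \<in> Lp1 N (1/\<theta>)" and g: "g \<in> Lp1 N (1/\<theta>)" "AE y in N. 0 \<le> g y"
    and h: "h \<in> Lp1 N (1/\<theta>)" "AE y in N. 0 \<le> h y" and eq: "AE y in N. f y = g y - h y"
  shows "AE x in M. pos_op f x = pospart g x - pospart h x"
proof -
  note F = Lp1_max[OF f]
  have "pospart (\<lambda>y. max (f y) 0 + h y) = pospart (\<lambda>y. max (- f y) 0 + g y)"
    using eq by (intro pospart_cong) (auto elim!: eventually_mono)
  moreover have "AE x in M. pospart (\<lambda>y. max (f y) 0 + h y) x = pospart (\<lambda>y. max (f y) 0) x + pospart h x"
    using F h by (intro pospart_add) auto
  moreover have "AE x in M. pospart (\<lambda>y. max (- f y) 0 + g y) x = pospart (\<lambda>y. max (- f y) 0) x + pospart g x"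
    using F g by (intro pospart_add) auto
  ultimately show ?thesis unfolding pos_op_def by auto
qed

lemma pos_op_nonneg:
  assumes "f \<in> Lp1 N (1/\<theta>)" "AE y in N. 0 \<le> f y"
  shows "AE x in M. pos_op f x = pospart f x"
proof -
  have z: "(\<lambda>y. 0) \<in> Lp1 N (1/\<theta>)" using Dint_subset_Lp1[OF th] Dint_zero by blast
  have "AE x in M. pos_op f x = pospart f x - pospart (\<lambda>y. 0) x"
    using assms z by (intro pos_op_diff) auto
  with pospart_zero show ?thesis by eventually_elim simp
qed

lemma pos_op_lin: "lin_op_on N M (Lp1 N (1/\<theta>)) pos_op"
  unfolding lin_op_on_def
proof (intro conjI ballI allI impI)
  fix f assume f: "f \<in> Lp1 N (1/\<theta>)"
  show "pos_op f \<in> borel_measurable M"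
    unfolding pos_op_def[abs_def] using Lp1_max[OF f]
    by (intro borel_measurable_diff pospart_measurable) auto
next
  fix f g :: "'b \<Rightarrow> real" assume "AE y in N. f y = g y"
  then have "pospart (\<lambda>y. max (f y) 0) = pospart (\<lambda>y. max (g y) 0)"
     "pospart (\<lambda>y. max (- f y) 0) = pospart (\<lambda>y. max (- g y) 0)"
    by (intro pospart_cong; auto elim!: eventually_mono)+
  then show "AE x in M. pos_op f x = pos_op g x" by (simp add: pos_op_def)
next
  fix f g and a b :: real assume f: "f \<in> Lp1 N (1/\<theta>)" and g: "g \<in> Lp1 N (1/\<theta>)"
  have scal: "AE x in M. pos_op (\<lambda>y. a * f y) x = a * pos_op f x" if f: "f \<in> Lp1 N (1/\<theta>)" for a f
  proof (cases "0 \<le> a")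
    case True
    note F = Lp1_max[OF f]
    have "AE x in M. pos_op (\<lambda>y. a * f y) x = pospart (\<lambda>y. a * max (f y) 0) x - pospart (\<lambda>y. a * max (- f y) 0) x"
      using F True by (intro pos_op_diff Lp1_cmult f) (auto simp: max_def algebra_simps)
    moreover have "AE x in M. pospart (\<lambda>y. a * max (f y) 0) x = a * pospart (\<lambda>y. max (f y) 0) x"
      using F True by (intro pospart_cmult) auto
    moreover have "AE x in M. pospart (\<lambda>y. a * max (- f y) 0) x = a * pospart (\<lambda>y. max (- f y) 0) x"
      using F True by (intro pospart_cmult) auto
    ultimately show ?thesis by eventually_elim (simp add: pos_op_def algebra_simps)
  next
    case False
    note F = Lp1_max[OF f]
    have "AE x in M. pos_op (\<lambda>y. a * f y) x = pospart (\<lambda>y. (- a) * max (- f y) 0) x - pospart (\<lambda>y. (- a) * max (f y) 0) x"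
      using F False by (intro pos_op_diff Lp1_cmult f) (auto simp: max_def algebra_simps mult_nonpos_nonneg)
    moreover have "AE x in M. pospart (\<lambda>y. (- a) * max (f y) 0) x = (- a) * pospart (\<lambda>y. max (f y) 0) x"
      using F False by (intro pospart_cmult) auto
    moreover have "AE x in M. pospart (\<lambda>y. (- a) * max (- f y) 0) x = (- a) * pospart (\<lambda>y. max (- f y) 0) x"
      using F False by (intro pospart_cmult) auto
    ultimately show ?thesis by eventually_elim (simp add: pos_op_def algebra_simps)
  qed
  have add: "AE x in M. pos_op (\<lambda>y. f y + g y) x = pos_op f x + pos_op g x"
    if f: "f \<in> Lp1 N (1/\<theta>)" and g: "g \<in> Lp1 N (1/\<theta>)" for f g
  proof -
    note F = Lp1_max[OF f] Lp1_max[OF g]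
    have "AE x in M. pos_op (\<lambda>y. f y + g y) x = pospart (\<lambda>y. max (f y) 0 + max (g y) 0) x
        - pospart (\<lambda>y. max (- f y) 0 + max (- g y) 0) x"
      using F by (intro pos_op_diff Lp1_add f g) (auto simp: max_def)
    moreover have "AE x in M. pospart (\<lambda>y. max (f y) 0 + max (g y) 0) x = pospart (\<lambda>y. max (f y) 0) x + pospart (\<lambda>y. max (g y) 0) x"
      using F by (intro pospart_add) auto
    moreover have "AE x in M. pospart (\<lambda>y. max (- f y) 0 + max (- g y) 0) x = pospart (\<lambda>y. max (- f y) 0) x + pospart (\<lambda>y. max (- g y) 0) x"
      using F by (intro pospart_add) auto
    ultimately show ?thesis by eventually_elim (simp add: pos_op_def)
  qed
  show "AE x in M. pos_op (\<lambda>y. a * f y + b * g y) x = a * pos_op f x + b * pos_op g x"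
    using add[OF Lp1_cmult[OF f] Lp1_cmult[OF g], of a b] scal[OF f, of a] scal[OF g, of b]
    by eventually_elim simp
qed

lemma pos_op_abs:
  assumes f: "f \<in> Lp1 N (1/\<theta>)"
  shows "AE x in M. \<bar>pos_op f x\<bar> \<le> pos_op (\<lambda>y. \<bar>f y\<bar>) x"
proof -
  note F = Lp1_max[OF f]
  have "AE x in M. pos_op (\<lambda>y. \<bar>f y\<bar>) x = pospart (\<lambda>y. \<bar>f y\<bar>) x"
    by (rule pos_op_nonneg[OF Lp1_abs[OF f]]) simp
  moreover have "(\<lambda>y. \<bar>f y\<bar>) = (\<lambda>y. max (f y) 0 + max (- f y) 0)" by auto
  moreover have "AE x in M. pospart (\<lambda>y. max (f y) 0 + max (- f y) 0) x = pospart (\<lambda>y. max (f y) 0) x + pospart (\<lambda>y. max (- f y) 0) x"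
    using F by (intro pospart_add) auto
  moreover have "AE x in M. 0 \<le> pospart (\<lambda>y. max (f y) 0) x" "AE x in M. 0 \<le> pospart (\<lambda>y. max (- f y) 0) x"
    using F by (intro pospart_nonneg; auto)+
  ultimately show ?thesis unfolding pos_op_def by auto
qed

end

text \<open>For a decomposition of all of f, the sum of positive parts is the sum of negative parts
  plus T f. Exchanging T and -T gives the opposite inequality, hence T^+ - T^- = T on nonnegative
  functions in \<open>Dint N\<close>.\<close>

lemma pospart_le_negpart:
  assumes A: "splittable_operator N M \<theta> K T" and B: "splittable_operator N M \<theta> K (\<lambda>f x. - T f x)"
    and f: "f \<in> Dint N" "\<And>y. 0 \<le> f y"
  shows "AE x in M. splittable_operator.pospart N M T f x
    \<le> splittable_operator.pospart N M (\<lambda>f x. - T f x) f x + T f x"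
proof -
  interpret A: splittable_operator N M \<theta> K T by fact
  interpret B: splittable_operator N M \<theta> K "\<lambda>f x. - T f x" by fact
  have fL: "f \<in> Lp1 N (1/\<theta>)" "AE y in N. 0 \<le> f y" using f Dint_subset_Lp1[OF A.th] by auto
  show ?thesis
  proof (rule A.is_pospart_least[OF A.pospart[OF fL]])
    fix fs assume fs: "fs \<in> A.parts f"
    then have p: "A.pos_list fs" by (simp add: A.parts_def)
    \<comment> \<open>Adding the remainder makes the total equal to f a.e.; this is possible because
      here f itself is in \<open>Dint N\<close>.\<close>
    define r where "r = (\<lambda>y. max (f y - A.total fs y) 0) # fs"
    have pr: "A.pos_list r" unfolding r_def A.pos_list_Cons
      using p f A.total_Dint[OF p] by (auto intro!: Dint_max Dint_diff Dint_zero)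
    have tr: "AE y in N. A.total r y = f y"
      using fs unfolding r_def A.parts_def by auto
    then have "r \<in> B.parts f" using pr by (auto simp: B.parts_def)
    then have "AE x in M. B.possum r x \<le> B.pospart f x" by (rule B.is_pospart_upper[OF B.pospart[OF fL]])
    moreover have "AE x in M. T (A.total r) x = T f x"
      using A.total_Dint[OF pr] f tr by (intro lin_op_on_cong[OF A.lin])
    moreover note A.T_total[OF pr]
    ultimately have "AE x in M. B.possum r x + (\<Sum>a\<leftarrow>r. T a x) \<le> B.pospart f x + T f x"
      by eventually_elim simp
    moreover have "A.possum r x = B.possum r x + (\<Sum>a\<leftarrow>r. T a x)" for x
      unfolding A.possum_def B.possum_def by (induction r) auto
    moreover have "A.possum fs x \<le> A.possum r x" for x by (simp add: r_def)
    ultimately show "AE x in M. A.possum fs x \<le> B.pospart f x + T f x"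
      by (elim eventually_mono) (metis order_trans)
  qed
qed

section \<open>From the interpolation norm to the regular norm\<close>


text \<open>Halving the level costs one factor 2; the sum of two measures costs another, since 2
  \<le> 2^(1/\<theta>).\<close>

lemma weak_bound_add:
  assumes th: "0 < \<theta>" "\<theta> < 1" and c: "0 \<le> c"
    and g: "weak_bound M \<theta> c g" "g \<in> borel_measurable M"
    and h: "weak_bound M \<theta> c h" "h \<in> borel_measurable M"
  shows "weak_bound M \<theta> (4 * c) (\<lambda>x. g x + h x)"
  unfolding weak_bound_def
proof safe
  fix l :: real assume l: "0 < l"
  note [measurable] = g(2) h(2)
  let ?p = "1 / \<theta>"
  have "emeasure M {x \<in> space M. l < \<bar>g x + h x\<bar>}
      \<le> emeasure M ({x \<in> space M. l / 2 < \<bar>g x\<bar>} \<union> {x \<in> space M. l / 2 < \<bar>h x\<bar>})"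
    by (intro emeasure_mono) auto
  also have "\<dots> \<le> emeasure M {x \<in> space M. l / 2 < \<bar>g x\<bar>} + emeasure M {x \<in> space M. l / 2 < \<bar>h x\<bar>}"
    by (intro emeasure_subadditive) auto
  also have "\<dots> \<le> ennreal ((c / (l / 2)) powr ?p) + ennreal ((c / (l / 2)) powr ?p)"
    using l by (intro add_mono g(1)[unfolded weak_bound_def, rule_format]
        h(1)[unfolded weak_bound_def, rule_format]) auto
  also have "\<dots> = ennreal (2 * (c / (l / 2)) powr ?p)"
    by (simp add: ennreal_plus[symmetric] del: ennreal_plus)
  also have "\<dots> \<le> ennreal ((4 * c / l) powr ?p)"
  proof (rule ennreal_leI)
    have "2 powr 1 \<le> (2::real) powr ?p" using th by (intro powr_mono) auto
    then have "2 * (c / (l / 2)) powr ?p \<le> 2 powr ?p * (c / (l / 2)) powr ?p"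
      by (intro mult_right_mono) auto
    also have "\<dots> = (4 * c / l) powr ?p" using c l by (simp add: powr_mult[symmetric])
    finally show "2 * (c / (l / 2)) powr ?p \<le> (4 * c / l) powr ?p" .
  qed
  finally show "emeasure M {x \<in> space M. l < \<bar>g x + h x\<bar>} \<le> ennreal ((4 * c / l) powr (1 / \<theta>))" .
qed

text \<open>The strict inequality lets each of the infima in the K-functional and the two operator
  norms be undercut by an actual decomposition or constant.\<close>

lemma splittable_operatorI:
  assumes th: "0 < \<theta>" "\<theta> < 1" and amb: "amb_op N M T"
    and K: "0 < K" "interp_norm N M \<theta> T < ennreal K"
  shows "splittable_operator N M \<theta> K T"
proof
  show "lin_op_on N M (Dint N) T" using amb by (simp add: amb_op_def)
  fix t :: real assume t: "0 < t"
  have "ennreal (t powr (- \<theta>)) * Kfun N M t T \<le> interp_norm N M \<theta> T"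
    unfolding interp_norm_def using t by (intro SUP_upper) auto
  then have "ennreal (t powr (- \<theta>)) * Kfun N M t T < ennreal K" using K(2) by (rule le_less_trans)
  then have "ennreal (t powr \<theta>) * (ennreal (t powr (- \<theta>)) * Kfun N M t T) < ennreal (t powr \<theta>) * ennreal K"
    using t by (intro ennreal_mult_strict_left_mono) (auto simp: ennreal_eq_0_iff)
  then have "Kfun N M t T < ennreal (K * t powr \<theta>)"
    using t K by (simp add: mult.assoc[symmetric] ennreal_mult[symmetric] powr_add[symmetric] mult.commute)
  then obtain T0 T1 where T: "amb_op N M T0" "amb_op N M T1"
      "\<forall>f\<in>Dint N. AE x in M. T f x = T0 f x + T1 f x"
      and nrm: "B0_norm N M T0 + ennreal t * B1_norm N M T1 < ennreal (K * t powr \<theta>)"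
    unfolding Kfun_def Inf_less_iff by blast
  have "B0_norm N M T0 < ennreal (K * t powr \<theta>)"
    by (rule le_less_trans[OF _ nrm]) simp
  then obtain C0 where C0: "C0 < ennreal (K * t powr \<theta>)"
      "\<forall>f\<in>Dint N. Linf_norm M (T0 f) \<le> C0 * Linf_norm N f"
    unfolding B0_norm_def Inf_less_iff by blast
  have "ennreal t * B1_norm N M T1 < ennreal (K * t powr \<theta>)"
    by (rule le_less_trans[OF _ nrm]) simp
  then have "ennreal (1 / t) * (ennreal t * B1_norm N M T1) < ennreal (1 / t) * ennreal (K * t powr \<theta>)"
    using t by (intro ennreal_mult_strict_left_mono) (auto simp: ennreal_eq_0_iff)
  then have "B1_norm N M T1 < ennreal (K * t powr (\<theta> - 1))"
    using t K by (simp add: mult.assoc[symmetric] ennreal_mult[symmetric] powr_diff)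
  then obtain C1 where C1: "C1 < ennreal (K * t powr (\<theta> - 1))"
      "\<forall>f\<in>Dint N. L1_norm M (T1 f) \<le> C1 * L1_norm N f"
    unfolding B1_norm_def Inf_less_iff by blast
  have "split_op N M (K * t powr \<theta>) (K * t powr (\<theta> - 1)) T T0 T1"
    unfolding split_op_def
  proof (intro conjI ballI allI impI)
    show "lin_op_on N M (Dint N) T0" "lin_op_on N M (Dint N) T1" using T by (auto simp: amb_op_def)
    show "AE x in M. T f x = T0 f x + T1 f x" if "f \<in> Dint N" for f using T that by blast
    fix f assume f: "f \<in> Dint N"
    show "AE x in M. \<bar>T0 f x\<bar> \<le> K * t powr \<theta> * h" if h: "0 \<le> h" "AE y in N. \<bar>f y\<bar> \<le> h" for h
    proof -
      have "Linf_norm M (T0 f) \<le> C0 * Linf_norm N f" using C0 f by blast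
      also have "\<dots> \<le> ennreal (K * t powr \<theta>) * ennreal h"
        using C0(1) h Linf_norm_le_iff[of h N f] by (intro mult_mono) auto
      also have "\<dots> = ennreal (K * t powr \<theta> * h)" using K h by (simp add: ennreal_mult)
      finally show ?thesis using K h by (subst (asm) Linf_norm_le_iff) auto
    qed
    have "L1_norm M (T1 f) \<le> C1 * L1_norm N f" using C1 f by blast
    also have "\<dots> \<le> ennreal (K * t powr (\<theta> - 1)) * L1_norm N f"
      using C1(1) by (intro mult_right_mono) auto
    finally show "(\<integral>\<^sup>+x. ennreal \<bar>T1 f x\<bar> \<partial>M) \<le> ennreal (K * t powr (\<theta> - 1)) * (\<integral>\<^sup>+y. ennreal \<bar>f y\<bar> \<partial>N)"
      by (simp add: L1_norm_def)
  qed
  then show "\<exists>T0 T1. split_op N M (K * t powr \<theta>) (K * t powr (\<theta> - 1)) T T0 T1" by blast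
qed (use th K in auto)

lemma lin_op_on_uminus: "lin_op_on N M S T \<Longrightarrow> lin_op_on N M S (\<lambda>f x. - T f x)"
  unfolding lin_op_on_def
proof (elim conjE, intro conjI ballI allI impI)
  fix f g and a b :: real
  assume *: "\<forall>f\<in>S. \<forall>g\<in>S. \<forall>a b. AE x in M. T (\<lambda>y. a * f y + b * g y) x = a * T f x + b * T g x"
    "f \<in> S" "g \<in> S"
  then have "AE x in M. T (\<lambda>y. a * f y + b * g y) x = a * T f x + b * T g x" by blast
  then show "AE x in M. - T (\<lambda>y. a * f y + b * g y) x = a * - T f x + b * - T g x"
    by eventually_elim simp
qed auto

lemma splittable_operator_uminus:
  assumes "splittable_operator N M \<theta> K T"
  shows "splittable_operator N M \<theta> K (\<lambda>f x. - T f x)"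
proof -
  interpret splittable_operator N M \<theta> K T by fact
  show ?thesis
  proof
    fix t :: real assume "0 < t"
    then obtain T0 T1 where "split_op N M (K * t powr \<theta>) (K * t powr (\<theta> - 1)) T T0 T1" using split by blast
    then have "split_op N M (K * t powr \<theta>) (K * t powr (\<theta> - 1)) (\<lambda>f x. - T f x) (\<lambda>f x. - T0 f x) (\<lambda>f x. - T1 f x)"
      unfolding split_op_def by (auto intro: lin_op_on_uminus)
    then show "\<exists>T0 T1. split_op N M (K * t powr \<theta>) (K * t powr (\<theta> - 1)) (\<lambda>f x. - T f x) T0 T1" by blast
  qed (use th K lin in \<open>auto intro: lin_op_on_uminus\<close>)
qed

lemma lin_op_on_lincomb_op:
  assumes "lin_op_on N M S A" "lin_op_on N M S B"
  shows "lin_op_on N M S (\<lambda>f x. A f x + c * B f x)"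
  unfolding lin_op_on_def
proof (intro conjI ballI allI impI)
  show "(\<lambda>x. A f x + c * B f x) \<in> borel_measurable M" if "f \<in> S" for f
    using lin_op_on_measurable[OF assms(1) that] lin_op_on_measurable[OF assms(2) that] by measurable
  show "AE x in M. A f x + c * B f x = A g x + c * B g x" if "f \<in> S" "g \<in> S" "AE y in N. f y = g y" for f g
    using lin_op_on_cong[OF assms(1) that] lin_op_on_cong[OF assms(2) that] by eventually_elim simp
  show "AE x in M. A (\<lambda>y. a * f y + b * g y) x + c * B (\<lambda>y. a * f y + b * g y) x
      = a * (A f x + c * B f x) + b * (A g x + c * B g x)" if "f \<in> S" "g \<in> S" for f g a b
    using lin_op_on_lincomb[OF assms(1) that, of a b] lin_op_on_lincomb[OF assms(2) that, of a b]
    by eventually_elim (simp add: algebra_simps)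
qed

lemma lor_opnorm_le:
  assumes "\<And>f. f \<in> Lp1 N p \<Longrightarrow> lorentz_inf_norm M p (u f) \<le> C * lorentz_1_norm N p f"
  shows "lor_opnorm N M p u \<le> C"
  unfolding lor_opnorm_def using assms by (auto intro: Inf_lower)

lemma Br_norm_le:
  assumes th: "0 < \<theta>" "\<theta> < 1" and amb: "amb_op N M T"
    and K: "0 < K" "interp_norm N M \<theta> T < ennreal K"
  shows "Br_norm N M (1/\<theta>) T \<le> ennreal (4 * C_regular \<theta> * K)"
proof -
  have sA: "splittable_operator N M \<theta> K T" by (rule splittable_operatorI[OF assms])
  have sB: "splittable_operator N M \<theta> K (\<lambda>f x. - T f x)" by (rule splittable_operator_uminus[OF sA])
  interpret A: splittable_operator N M \<theta> K T by fact
  interpret B: splittable_operator N M \<theta> K "\<lambda>f x. - T f x" by fact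
  let ?S = "Lp1 N (1/\<theta>)"
  \<comment> \<open>The factors 1 and -1 give the sum and the difference of T^+ and T^- the common
    shape of \<open>lin_op_on_lincomb_op\<close>.\<close>
  define v where "v = (\<lambda>f x. A.pos_op f x + 1 * B.pos_op f x)"
  define u where "u = (\<lambda>f x. A.pos_op f x + (-1) * B.pos_op f x)"
  have lin_v: "lin_op_on N M ?S v" and lin_u: "lin_op_on N M ?S u"
    unfolding v_def u_def by (intro lin_op_on_lincomb_op A.pos_op_lin B.pos_op_lin)+
  have C: "0 < 4 * C_regular \<theta> * K" using C_regular_pos[OF th] K by simp
  have v_pos: "AE x in M. v f x = A.pospart f x + B.pospart f x" if "f \<in> ?S" "AE y in N. 0 \<le> f y" for f
    using A.pos_op_nonneg[OF that] B.pos_op_nonneg[OF that] by eventually_elim (simp add: v_def)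
  have v_abs: "AE x in M. \<bar>v f x\<bar> \<le> v (\<lambda>y. \<bar>f y\<bar>) x" "AE x in M. \<bar>u f x\<bar> \<le> v (\<lambda>y. \<bar>f y\<bar>) x"
    if "f \<in> ?S" for f
    using A.pos_op_abs[OF that] B.pos_op_abs[OF that] by (eventually_elim, auto simp: v_def u_def)+
  have v_bound: "lorentz_inf_norm M (1/\<theta>) (v (\<lambda>y. \<bar>f y\<bar>)) \<le> ennreal (4 * C_regular \<theta> * K) * lorentz_1_norm N (1/\<theta>) f"
    if f: "f \<in> ?S" for f
  proof -
    let ?f = "\<lambda>y. \<bar>f y\<bar>"
    have f': "?f \<in> ?S" "AE y in N. 0 \<le> ?f y" using f by (auto intro: Lp1_abs)
    obtain L where L: "0 \<le> L" "lorentz_1_norm N (1/\<theta>) f = ennreal L"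
      using f by (cases "lorentz_1_norm N (1/\<theta>) f") (auto simp: Lp1_def)
    have "lorentz_inf_norm M (1/\<theta>) (v ?f) \<le> ennreal (4 * C_regular \<theta> * K * L)"
    proof (rule ennreal_le_epsilon)
      fix e :: real assume e: "0 < e"
      \<comment> \<open>\<open>pospart_weak_bound\<close> needs a strictly positive bound of the
        norm; the excess is scaled to cost exactly \<open>e\<close> in the end.\<close>
      define L' where "L' = L + e / (4 * C_regular \<theta> * K)"
      have L': "0 < L'" using L e C by (simp add: L'_def add_nonneg_pos)
      have L'': "lorentz_1_norm N (1/\<theta>) ?f \<le> ennreal L'"
        unfolding lorentz_1_norm_abs L(2) L'_def using e C by (intro ennreal_leI) simp
      have c0: "0 \<le> C_regular \<theta> * K * L'" using C_regular_pos[OF th] K L' by simp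
      have m: "A.pospart ?f \<in> borel_measurable M" "B.pospart ?f \<in> borel_measurable M"
        using f' by (auto intro: A.pospart_measurable B.pospart_measurable)
      have "weak_bound M \<theta> (4 * (C_regular \<theta> * K * L')) (\<lambda>x. A.pospart ?f x + B.pospart ?f x)"
        by (rule weak_bound_add[OF th c0 A.pospart_weak_bound[OF f' L' L''] m(1) B.pospart_weak_bound[OF f' L' L''] m(2)])
      then have "weak_bound M \<theta> (4 * (C_regular \<theta> * K * L')) (v ?f)"
        using v_pos[OF f'] m lin_op_on_measurable[OF lin_v f'(1)]
        by (elim weak_bound_mono) auto
      then have "lorentz_inf_norm M (1/\<theta>) (v ?f) \<le> ennreal (4 * (C_regular \<theta> * K * L'))"
        using c0 by (intro weak_bound_imp_lorentz_inf[OF th]) auto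
      also have "4 * (C_regular \<theta> * K * L') = 4 * C_regular \<theta> * K * L + e"
        using C_regular_pos[OF th] K unfolding L'_def by (simp add: field_simps)
      finally show "lorentz_inf_norm M (1/\<theta>) (v ?f) \<le> ennreal (4 * C_regular \<theta> * K * L) + ennreal e"
        using C L e by simp
    qed
    then show ?thesis using L C by (simp add: ennreal_mult)
  qed
  have bound: "lorentz_inf_norm M (1/\<theta>) (w f) \<le> ennreal (4 * C_regular \<theta> * K) * lorentz_1_norm N (1/\<theta>) f"
    if f: "f \<in> ?S" and w: "lin_op_on N M ?S w" "AE x in M. \<bar>w f x\<bar> \<le> v (\<lambda>y. \<bar>f y\<bar>) x" for f w
  proof -
    have "AE x in M. \<bar>w f x\<bar> \<le> \<bar>v (\<lambda>y. \<bar>f y\<bar>) x\<bar>" using w(2) by eventually_elim auto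
    then have "lorentz_inf_norm M (1/\<theta>) (w f) \<le> lorentz_inf_norm M (1/\<theta>) (v (\<lambda>y. \<bar>f y\<bar>))"
      using lin_op_on_measurable[OF w(1) f] lin_op_on_measurable[OF lin_v Lp1_abs[OF f]]
      by (intro lorentz_inf_norm_mono)
    then show ?thesis using v_bound[OF f] by (rule order_trans)
  qed
  have opn: "lor_opnorm N M (1/\<theta>) v \<le> ennreal (4 * C_regular \<theta> * K)"
      "lor_opnorm N M (1/\<theta>) u \<le> ennreal (4 * C_regular \<theta> * K)"
    using lin_u lin_v v_abs bound by (auto intro!: lor_opnorm_le)
  then have bdd: "lor_bdd_op N M (1/\<theta>) v" "lor_bdd_op N M (1/\<theta>) u"
    using lin_u lin_v by (auto simp: lor_bdd_op_def intro: le_less_trans)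
  have pos: "positive_op N M ?S v"
    unfolding positive_op_def
  proof (intro ballI impI)
    fix f assume f: "f \<in> ?S" "AE y in N. 0 \<le> f y"
    show "AE x in M. 0 \<le> v f x"
      using v_pos[OF f] A.pospart_nonneg[OF f] B.pospart_nonneg[OF f] by eventually_elim simp
  qed
  have ext: "AE x in M. u f x = T f x" if f: "f \<in> Dint N" for f
  proof -
    have eq: "AE x in M. A.pospart g x - B.pospart g x = T g x" if g: "g \<in> Dint N" "\<And>y. 0 \<le> g y" for g
    proof -
      have "AE x in M. A.pospart g x \<le> B.pospart g x + T g x"
        by (rule pospart_le_negpart[OF sA sB g])
      moreover have "AE x in M. B.pospart g x \<le> A.pospart g x + - T g x"
        using pospart_le_negpart[OF sB _ g] sA by simp
      ultimately show ?thesis by eventually_elim simp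
    qed
    have D: "(\<lambda>y. max (f y) 0) \<in> Dint N" "(\<lambda>y. max (- f y) 0) \<in> Dint N"
      using Dint_max[OF f Dint_zero] Dint_max[OF Dint_cmult[OF f, of "-1"] Dint_zero] by auto
    have "AE x in M. T (\<lambda>y. max (f y) 0 - max (- f y) 0) x = T (\<lambda>y. max (f y) 0) x - T (\<lambda>y. max (- f y) 0) x"
      by (rule lin_op_on_diff[OF A.lin D])
    moreover have "(\<lambda>y. max (f y) 0 - max (- f y) 0) = f" by auto
    ultimately have "AE x in M. T f x = T (\<lambda>y. max (f y) 0) x - T (\<lambda>y. max (- f y) 0) x" by simp
    moreover have "AE x in M. A.pospart (\<lambda>y. max (f y) 0) x - B.pospart (\<lambda>y. max (f y) 0) x = T (\<lambda>y. max (f y) 0) x"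
      "AE x in M. A.pospart (\<lambda>y. max (- f y) 0) x - B.pospart (\<lambda>y. max (- f y) 0) x = T (\<lambda>y. max (- f y) 0) x"
      by (intro eq D; simp)+
    ultimately show ?thesis by eventually_elim (simp add: u_def A.pos_op_def B.pos_op_def)
  qed
  have "Br_norm N M (1/\<theta>) T \<le> regular_norm N M (1/\<theta>) u"
    unfolding Br_norm_def using bdd ext by (intro Inf_lower) auto
  also have "\<dots> \<le> lor_opnorm N M (1/\<theta>) v"
    unfolding regular_norm_def using bdd pos v_abs by (intro Inf_lower) auto
  also have "\<dots> \<le> ennreal (4 * C_regular \<theta> * K)" by (rule opn)
  finally show ?thesis .
qed

section \<open>Orienting a finite bipartite graph and passing to the limit\<close>


text \<open>Some vertex has degree at most twice its capacity; it takes all of its edges and is removed.\<close>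
lemma bipartite_orientation:
  fixes c :: "'i \<Rightarrow> 'j \<Rightarrow> real" and m :: "'i \<Rightarrow> real" and n :: "'j \<Rightarrow> real"
  assumes "finite I" "finite J"
    and "\<And>I' J'. I' \<subseteq> I \<Longrightarrow> J' \<subseteq> J \<Longrightarrow> (\<Sum>i\<in>I'. \<Sum>j\<in>J'. c i j) \<le> (\<Sum>i\<in>I'. m i) + (\<Sum>j\<in>J'. n j)"
  shows "\<exists>S. (\<forall>i\<in>I. (\<Sum>j\<in>J. if S i j then c i j else 0) \<le> 2 * m i) \<and>
    (\<forall>j\<in>J. (\<Sum>i\<in>I. if S i j then 0 else c i j) \<le> 2 * n j)"
  using assms
proof (induction "card I + card J" arbitrary: I J)
  case 0
  then have "I = {}" "J = {}" by auto
  then show ?case by simp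
next
  case (Suc k)
  note fin = Suc.prems(1,2)
  \<comment> \<open>Otherwise the sum of all degrees, in which every edge counts at both ends,
    exceeds twice the total capacity, against the hypothesis for the full vertex sets. This is the
    origin of the factor 2.\<close>
  have "(\<exists>i\<in>I. (\<Sum>j\<in>J. c i j) \<le> 2 * m i) \<or> (\<exists>j\<in>J. (\<Sum>i\<in>I. c i j) \<le> 2 * n j)"
  proof (rule ccontr)
    assume "\<not> ?thesis"
    then have 1: "\<forall>i\<in>I. 2 * m i < (\<Sum>j\<in>J. c i j)" and 2: "\<forall>j\<in>J. 2 * n j < (\<Sum>i\<in>I. c i j)"
      by auto
    have "I \<noteq> {} \<or> J \<noteq> {}" using Suc.hyps(2) by auto
    then have "(\<Sum>i\<in>I. 2 * m i) + (\<Sum>j\<in>J. 2 * n j) < (\<Sum>i\<in>I. \<Sum>j\<in>J. c i j) + (\<Sum>j\<in>J. \<Sum>i\<in>I. c i j)"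
    proof
      assume "I \<noteq> {}"
      then show ?thesis using 1 2 fin by (intro add_less_le_mono sum_strict_mono sum_mono) (auto intro: less_imp_le)
    next
      assume "J \<noteq> {}"
      then show ?thesis using 1 2 fin by (intro add_le_less_mono sum_strict_mono sum_mono) (auto intro: less_imp_le)
    qed
    moreover have "(\<Sum>j\<in>J. \<Sum>i\<in>I. c i j) = (\<Sum>i\<in>I. \<Sum>j\<in>J. c i j)" by (rule sum.swap)
    moreover have "(\<Sum>i\<in>I. \<Sum>j\<in>J. c i j) \<le> (\<Sum>i\<in>I. m i) + (\<Sum>j\<in>J. n j)" by (rule Suc.prems(3)) auto
    ultimately show False by (simp add: sum_distrib_left[symmetric])
  qed
  then consider i where "i \<in> I" "(\<Sum>j\<in>J. c i j) \<le> 2 * m i" | j where "j \<in> J" "(\<Sum>i\<in>I. c i j) \<le> 2 * n j"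
    by blast
  then show ?case
  proof cases
    case 1
    have "\<exists>S. (\<forall>i\<in>I - {i}. (\<Sum>j\<in>J. if S i j then c i j else 0) \<le> 2 * m i) \<and>
        (\<forall>j\<in>J. (\<Sum>i\<in>I - {i}. if S i j then 0 else c i j) \<le> 2 * n j)"
    proof (rule Suc.hyps(1))
      show "k = card (I - {i}) + card J" using Suc.hyps(2) 1 fin card_gt_0_iff[of I] by auto
    qed (use fin in \<open>auto intro!: Suc.prems(3)\<close>)
    then obtain S where S: "\<forall>i\<in>I - {i}. (\<Sum>j\<in>J. if S i j then c i j else 0) \<le> 2 * m i"
        "\<forall>j\<in>J. (\<Sum>i\<in>I - {i}. if S i j then 0 else c i j) \<le> 2 * n j" by blast
    let ?S = "\<lambda>i' j. i' = i \<or> S i' j"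
    show ?thesis
    proof (intro exI[of _ ?S] conjI ballI)
      show "(\<Sum>j\<in>J. if ?S i' j then c i' j else 0) \<le> 2 * m i'" if "i' \<in> I" for i'
        using S(1) 1 that by (cases "i' = i") auto
      fix j assume j: "j \<in> J"
      have "(\<Sum>i'\<in>I. if ?S i' j then 0 else c i' j) = (\<Sum>i'\<in>I - {i}. if ?S i' j then 0 else c i' j)"
        using 1 fin by (subst sum.remove[of _ i]) auto
      also have "\<dots> = (\<Sum>i'\<in>I - {i}. if S i' j then 0 else c i' j)" by (intro sum.cong) auto
      finally show "(\<Sum>i'\<in>I. if ?S i' j then 0 else c i' j) \<le> 2 * n j" using S(2) j by simp
    qed
  next
    case 2
    have "\<exists>S. (\<forall>i\<in>I. (\<Sum>j\<in>J - {j}. if S i j then c i j else 0) \<le> 2 * m i) \<and>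
        (\<forall>j\<in>J - {j}. (\<Sum>i\<in>I. if S i j then 0 else c i j) \<le> 2 * n j)"
    proof (rule Suc.hyps(1))
      show "k = card I + card (J - {j})" using Suc.hyps(2) 2 fin card_gt_0_iff[of J] by auto
    qed (use fin in \<open>auto intro!: Suc.prems(3)\<close>)
    then obtain S where S: "\<forall>i\<in>I. (\<Sum>j\<in>J - {j}. if S i j then c i j else 0) \<le> 2 * m i"
        "\<forall>j\<in>J - {j}. (\<Sum>i\<in>I. if S i j then 0 else c i j) \<le> 2 * n j" by blast
    let ?S = "\<lambda>i j'. j' \<noteq> j \<and> S i j'"
    show ?thesis
    proof (intro exI[of _ ?S] conjI ballI)
      show "(\<Sum>i\<in>I. if ?S i j' then 0 else c i j') \<le> 2 * n j'" if "j' \<in> J" for j'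
        using S(2) 2 that by (cases "j' = j") auto
      fix i assume i: "i \<in> I"
      have "(\<Sum>j'\<in>J. if ?S i j' then c i j' else 0) = (\<Sum>j'\<in>J - {j}. if ?S i j' then c i j' else 0)"
        using 2 fin by (subst sum.remove[of _ j]) auto
      also have "\<dots> = (\<Sum>j'\<in>J - {j}. if S i j' then c i j' else 0)" by (intro sum.cong) auto
      finally show "(\<Sum>j'\<in>J. if ?S i j' then c i j' else 0) \<le> 2 * m i" using S(1) i by simp
    qed
  qed
qed

text \<open>The functions \<open>B i\<close> lie in a product of compact intervals; a cluster point
  of their image filter exists by Tychonoff. A finer filter plays the role of the subnet.\<close>

lemma bounded_net_has_convergent_subfilter:
  fixes B :: "'i \<Rightarrow> 'z \<Rightarrow> real"
  assumes F: "F \<noteq> bot" and bd: "\<And>i z. \<bar>B i z\<bar> \<le> c z"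
  shows "\<exists>F' L. F' \<noteq> bot \<and> F' \<le> F \<and> (\<forall>z. ((\<lambda>i. B i z) \<longlongrightarrow> L z) F')"
proof -
  let ?K = "PiE UNIV (\<lambda>z. {- c z..c z})"
  have "compactin (product_topology (\<lambda>z. euclidean) UNIV) ?K"
    by (subst compactin_PiE) auto
  then have "compact ?K" by (simp add: euclidean_product_topology)
  moreover have "eventually (\<lambda>x. x \<in> ?K) (filtermap B F)"
    unfolding eventually_filtermap
    by (rule always_eventually) (use bd in \<open>auto simp: abs_le_iff minus_le_iff\<close>)
  moreover have "filtermap B F \<noteq> bot" using F by (simp add: filtermap_bot_iff)
  ultimately obtain L where L: "inf (nhds L) (filtermap B F) \<noteq> bot"
    unfolding compact_filter by blast
  \<comment> \<open>The original filter is refined by the requirement that \<open>B\<close> be close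
    to the cluster point.\<close>
  define F' where "F' = inf F (filtercomap B (nhds L))"
  have "F' \<noteq> bot"
  proof
    assume "F' = bot"
    then have "eventually (\<lambda>_. False) (inf F (filtercomap B (nhds L)))" by (simp add: F'_def)
    then obtain P Q where P: "eventually P F" and Q: "eventually Q (filtercomap B (nhds L))"
      and PQ: "\<And>x. P x \<Longrightarrow> Q x \<Longrightarrow> False" unfolding eventually_inf by blast
    obtain R where R: "eventually R (nhds L)" "\<And>x. R (B x) \<Longrightarrow> Q x"
      using Q unfolding eventually_filtercomap by blast
    have "eventually (\<lambda>y. \<not> R y) (filtermap B F)"
      unfolding eventually_filtermap using P by (rule eventually_mono) (use PQ R in blast)
    with R(1) have "eventually (\<lambda>_. False) (inf (nhds L) (filtermap B F))"
      unfolding eventually_inf by blast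
    with L show False by (simp add: trivial_limit_def)
  qed
  moreover have "F' \<le> F" by (simp add: F'_def)
  moreover have "((\<lambda>i. B i z) \<longlongrightarrow> L z) F'" for z
  proof -
    have "filterlim B (nhds L) (filtercomap B (nhds L))" by (rule filterlim_filtercomap)
    then have "filterlim B (nhds L) F'" by (rule filterlim_mono) (auto simp: F'_def)
    then show ?thesis
      by (rule continuous_on_tendsto_compose[OF continuous_on_product_coordinates[of z]]) simp_all
  qed
  ultimately show ?thesis by blast
qed

section \<open>Densities of finitely additive set functions dominated by a measure\<close>

definition lipschitz_content :: "'a measure \<Rightarrow> real \<Rightarrow> ('a set \<Rightarrow> real) \<Rightarrow> bool" where
  "lipschitz_content M c \<Psi> \<longleftrightarrow>
     (\<forall>A\<in>fmeasurable M. \<forall>B\<in>fmeasurable M. A \<inter> B = {} \<longrightarrow> \<Psi> (A \<union> B) = \<Psi> A + \<Psi> B) \<and>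
     (\<forall>A\<in>fmeasurable M. \<bar>\<Psi> A\<bar> \<le> c * measure M A)"

text \<open>The Lipschitz bound forces continuity at the empty set within D, so finite additivity
  becomes countable additivity and Radon-Nikodym applies.\<close>

lemma lipschitz_content_density_on:
  assumes P: "lipschitz_content M c \<Psi>" and D: "D \<in> fmeasurable M" and c: "0 \<le> c"
  shows "\<exists>g\<in>borel_measurable M. (\<forall>x. \<bar>g x\<bar> \<le> c) \<and>
     (\<forall>A\<in>sets M. A \<subseteq> D \<longrightarrow> \<Psi> A = (\<integral>x. indicator A x * g x \<partial>M))"
proof -
  have D'[measurable]: "D \<in> sets M" using D by simp
  have AD: "A \<inter> D \<in> fmeasurable M" if "A \<in> sets M" for A 
    using fmeasurable_Int_fmeasurable[OF D that] by (simp add: Int_commute)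
  \<comment> \<open>Adding c times the measure makes the content nonnegative and at most 2c times
    the measure.\<close>
  define \<phi> where "\<phi> A = \<Psi> (A \<inter> D) + c * measure M (A \<inter> D)" for A
  have \<phi>0: "0 \<le> \<phi> A" and \<phi>1: "\<phi> A \<le> 2 * c * measure M (A \<inter> D)" if "A \<in> sets M" for A
    using P AD[OF that] unfolding \<phi>_def lipschitz_content_def by (auto simp: abs_le_iff minus_le_iff)
  have add: "\<phi> (A \<union> B) = \<phi> A + \<phi> B" if "A \<in> sets M" "B \<in> sets M" "A \<inter> B = {}" for A B
  proof -
    have "\<Psi> ((A \<inter> D) \<union> (B \<inter> D)) = \<Psi> (A \<inter> D) + \<Psi> (B \<inter> D)"
      using that by (intro P[unfolded lipschitz_content_def, THEN conjunct1, rule_format] AD) auto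
    moreover have "measure M ((A \<inter> D) \<union> (B \<inter> D)) = measure M (A \<inter> D) + measure M (B \<inter> D)"
      using AD[OF that(1)] AD[OF that(2)] that(3) by (intro measure_Union) (auto simp: fmeasurable_def)
    ultimately show ?thesis by (simp add: \<phi>_def Int_Un_distrib2 distrib_left)
  qed
  have emp: "\<phi> {} = 0" using \<phi>0[of "{}"] \<phi>1[of "{}"] by simp
  have ca: "countably_additive (sets M) (\<lambda>A. ennreal (\<phi> A))"
  proof (rule sets.empty_continuous_imp_countably_additive)
    show "positive (sets M) (\<lambda>A. ennreal (\<phi> A))" by (simp add: positive_def emp)
    show "additive (sets M) (\<lambda>A. ennreal (\<phi> A))"
      unfolding additive_def using add \<phi>0 by (auto simp: ennreal_plus)
    fix A :: "nat \<Rightarrow> 'a set" assume A: "range A \<subseteq> sets M" "decseq A" "(\<Inter>i. A i) = {}"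
    have "(\<lambda>i. measure M (A i \<inter> D)) \<longlonglongrightarrow> measure M (\<Inter>i. A i \<inter> D)"
    proof (rule Lim_measure_decseq)
      show "range (\<lambda>i. A i \<inter> D) \<subseteq> sets M" using A by auto
      show "decseq (\<lambda>i. A i \<inter> D)" using A by (auto simp: decseq_def)
      show "emeasure M (A i \<inter> D) \<noteq> \<infinity>" for i using AD[of "A i"] A by (auto simp: fmeasurable_def)
    qed
    moreover have "(\<Inter>i. A i \<inter> D) = {}" using A(3) by blast
    ultimately have "(\<lambda>i. measure M (A i \<inter> D)) \<longlonglongrightarrow> 0" by (simp only: measure_empty)
    then have "(\<lambda>i. 2 * c * measure M (A i \<inter> D)) \<longlonglongrightarrow> 2 * c * 0"
      by (intro tendsto_mult tendsto_const)
    then have up: "(\<lambda>i. 2 * c * measure M (A i \<inter> D)) \<longlonglongrightarrow> 0" by simp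
    have Ai: "A i \<in> sets M" for i using A(1) by auto
    have "(\<lambda>i. \<phi> (A i)) \<longlonglongrightarrow> 0"
      by (rule tendsto_sandwich[OF _ _ tendsto_const up]) (auto intro!: always_eventually \<phi>0 \<phi>1 Ai)
    then show "(\<lambda>i. ennreal (\<phi> (A i))) \<longlonglongrightarrow> 0"
      using tendsto_ennrealI[of "\<lambda>i. \<phi> (A i)" 0] by simp
  qed simp
  define Q where "Q = measure_of (space M) (sets M) (\<lambda>A. ennreal (\<phi> A))"
  have sQ: "sets Q = sets M" by (simp add: Q_def)
  have eQ: "emeasure Q A = ennreal (\<phi> A)" if "A \<in> sets M" for A
    unfolding Q_def using ca emp that
    by (intro emeasure_measure_of_sigma) (auto simp: positive_def sets.sigma_algebra_axioms)
  \<comment> \<open>The restriction of M to D is finite, as Radon-Nikodym demands, while M may not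
    even be sigma-finite.\<close>
  define R where "R = density M (indicator D)"
  have sR: "sets R = sets M" "space R = space M" by (auto simp: R_def)
  have eR: "emeasure R A = emeasure M (A \<inter> D)" if "A \<in> sets M" for A
    unfolding R_def using that by (subst emeasure_density) (auto simp: indicator_inter_arith[symmetric] Int_commute mult.commute)
  interpret R: finite_measure R
    by (rule finite_measureI) (use eR[of "space M"] D in \<open>auto simp: sR fmeasurable_def Int_absorb1 sets.sets_into_space\<close>)
  have "absolutely_continuous R Q"
    unfolding absolutely_continuous_def
  proof
    fix A assume A: "A \<in> null_sets R"
    then have A': "A \<in> sets M" using sR by auto
    have "emeasure M (A \<inter> D) = 0" using A eR[OF A'] by auto
    then have "measure M (A \<inter> D) = 0" by (simp add: measure_def)
    then have "\<phi> A = 0" using \<phi>0[OF A'] \<phi>1[OF A'] by simp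
    then show "A \<in> null_sets Q" using eQ[OF A'] A' sQ by auto
  qed
  then obtain f where f: "f \<in> borel_measurable R" "density R f = Q"
    using R.Radon_Nikodym[of Q] sQ sR by auto
  have fM[measurable]: "f \<in> borel_measurable M" using f(1) by (simp add: R_def)
  have int: "(\<integral>\<^sup>+x. f x * indicator A x \<partial>M) = ennreal (\<phi> A)" if A: "A \<in> sets M" "A \<subseteq> D" for A
  proof -
    have "ennreal (\<phi> A) = (\<integral>\<^sup>+x. f x * indicator A x \<partial>R)"
      unfolding eQ[OF A(1), symmetric] f(2)[symmetric] using f(1) A sR by (subst emeasure_density) auto
    also have "\<dots> = (\<integral>\<^sup>+x. indicator D x * (f x * indicator A x) \<partial>M)"
      unfolding R_def using A by (subst nn_integral_density) auto
    also have "\<dots> = (\<integral>\<^sup>+x. f x * indicator A x \<partial>M)"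
      using A by (intro nn_integral_cong) (auto split: split_indicator)
    finally show ?thesis ..
  qed
  have le: "AE x in M. x \<in> D \<longrightarrow> f x \<le> ennreal (2 * c)"
  proof -
    have "AE x in M. x \<in> D \<longrightarrow> f x \<le> ennreal (2 * c + 1 / Suc n)" for n
    proof -
      define E where "E = {x \<in> space M. x \<in> D \<and> ennreal (2 * c + 1 / Suc n) < f x}"
      have E[measurable]: "E \<in> sets M" "E \<subseteq> D" by (auto simp: E_def)
      then have ED: "E \<inter> D = E" "E \<in> fmeasurable M" using AD[of E] by (auto simp: Int_absorb2)
      have "ennreal ((2 * c + 1 / Suc n) * measure M E) = (\<integral>\<^sup>+x. ennreal (2 * c + 1 / Suc n) * indicator E x \<partial>M)"
        using ED c by (subst nn_integral_cmult_indicator) (auto simp: emeasure_eq_measure2 ennreal_mult)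
      also have "\<dots> \<le> (\<integral>\<^sup>+x. f x * indicator E x \<partial>M)"
        by (intro nn_integral_mono) (auto simp: E_def split: split_indicator)
      also have "\<dots> = ennreal (\<phi> E)" using E by (rule int)
      also have "\<dots> \<le> ennreal (2 * c * measure M E)" using \<phi>1[OF E(1)] ED by (intro ennreal_leI) simp
      finally have "(2 * c + 1 / Suc n) * measure M E \<le> 2 * c * measure M E"
        using c by (subst (asm) ennreal_le_iff) auto
      then have "measure M E * (1 / Suc n) \<le> 0" by (simp add: algebra_simps)
      then have "measure M E = 0" using measure_nonneg[of M E] by (simp add: divide_le_0_iff)
      then have "emeasure M E = 0" using ED by (simp add: emeasure_eq_measure2)
      then show ?thesis using E(1) by (intro AE_I[of _ _ E]) (auto simp: E_def)
    qed
    then have "AE x in M. \<forall>n. x \<in> D \<longrightarrow> f x \<le> ennreal (2 * c + 1 / Suc n)"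
      unfolding AE_all_countable by blast
    then show ?thesis
    proof eventually_elim
      case (elim x)
      have "(\<lambda>n. ennreal (2 * c + 1 / Suc n)) \<longlonglongrightarrow> ennreal (2 * c + 0)"
        using LIMSEQ_inverse_real_of_nat by (intro tendsto_ennrealI tendsto_add tendsto_const) (simp add: inverse_eq_divide)
      then show ?case using elim by (auto intro: LIMSEQ_le_const)
    qed
  qed
  \<comment> \<open>Undoing the shift by c; the truncation turns the bound a.e. on D into one that
    holds everywhere.\<close>
  define g where "g x = max (- c) (min c (enn2real (f x) - c))" for x
  have [measurable]: "g \<in> borel_measurable M" unfolding g_def by measurable
  have gc: "\<bar>g x\<bar> \<le> c" for x using c enn2real_nonneg[of "f x"]
    by (simp add: g_def max_def min_def abs_le_iff)
  have gc0: "0 \<le> g x + c" for x using gc[of x] by linarith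
  have fg: "AE x in M. x \<in> D \<longrightarrow> f x = ennreal (g x + c)"
    using le
  proof eventually_elim
    case (elim x)
    show ?case
    proof
      assume "x \<in> D"
      then have "f x \<le> ennreal (2 * c)" using elim by blast
      then obtain r where r: "0 \<le> r" "f x = ennreal r" "r \<le> 2 * c"
        using c by (cases "f x") (auto simp: top_unique)
      then have "g x = r - c" using c by (auto simp: g_def)
      then show "f x = ennreal (g x + c)" using r by simp
    qed
  qed
  have "\<Psi> A = (\<integral>x. indicator A x * g x \<partial>M)" if A: "A \<in> sets M" "A \<subseteq> D" for A
  proof -
    have A': "A \<in> fmeasurable M" "A \<inter> D = A" using AD[OF A(1)] A by (auto simp: Int_absorb2)
    have iA: "integrable M (indicat_real A)" using A' by (simp add: fmeasurable_def integrable_indicator_iff)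
    have ig: "integrable M (\<lambda>x. indicator A x * g x)"
      using A(1) gc c by (intro Bochner_Integration.integrable_bound[OF integrable_mult_right[OF iA, of c]]) (auto split: split_indicator)
    have "ennreal (\<phi> A) = (\<integral>\<^sup>+x. ennreal (indicator A x * g x + c * indicator A x) \<partial>M)"
      unfolding int[OF A, symmetric] using fg A
      by (intro nn_integral_cong_AE) (auto elim!: eventually_mono split: split_indicator)
    also have "\<dots> = ennreal (\<integral>x. indicator A x * g x + c * indicator A x \<partial>M)"
    proof (rule nn_integral_eq_integral)
      show "integrable M (\<lambda>x. indicator A x * g x + c * indicator A x)" using ig iA by auto
      show "AE x in M. 0 \<le> indicator A x * g x + c * indicator A x"
        using gc0 by (intro AE_I2) (auto split: split_indicator)
    qed
    also have "(\<integral>x. indicator A x * g x + c * indicator A x \<partial>M) = (\<integral>x. indicator A x * g x \<partial>M) + c * measure M A"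
      using ig iA A(1) by (subst Bochner_Integration.integral_add) (auto simp: Int_absorb2 sets.sets_into_space)
    finally have "\<phi> A = (\<integral>x. indicator A x * g x \<partial>M) + c * measure M A"
    proof (rule ennreal_inj[THEN iffD1, rotated 2])
      show "0 \<le> \<phi> A" by (rule \<phi>0[OF A(1)])
      have "0 \<le> (\<integral>x. indicator A x * g x + c * indicator A x \<partial>M)"
        using gc0 by (intro integral_nonneg_AE AE_I2) (auto split: split_indicator)
      also have "\<dots> = (\<integral>x. indicator A x * g x \<partial>M) + c * measure M A"
        using ig iA A(1) by (subst Bochner_Integration.integral_add) (auto simp: Int_absorb2 sets.sets_into_space)
      finally show "0 \<le> (\<integral>x. indicator A x * g x \<partial>M) + c * measure M A" .
    qed
    then show ?thesis using A' by (simp add: \<phi>_def)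
  qed
  then show ?thesis using gc by (intro bexI[of _ g]) auto
qed

lemma integrable_indicator_bounded:
  fixes g :: "'a \<Rightarrow> real"
  assumes A: "A \<in> fmeasurable M" and g: "g \<in> borel_measurable M" "\<And>x. \<bar>g x\<bar> \<le> c"
  shows "integrable M (\<lambda>x. indicator A x * g x)"
proof -
  have iA: "integrable M (indicat_real A)" using A by (simp add: fmeasurable_def integrable_indicator_iff)
  have c: "0 \<le> c" using g(2)[of undefined] by linarith
  have "A \<in> sets M" using A by simp
  then show ?thesis using g c
    by (intro Bochner_Integration.integrable_bound[OF integrable_mult_right[OF iA, of c]])
       (auto split: split_indicator)
qed

text \<open>Densities on disjoint pieces of finite measure are glued together. The hypothesis
  \<open>zero\<close> takes the place of sigma-finiteness: nothing lives outside the countable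
  union.\<close>

lemma lipschitz_content_density:
  fixes W :: "nat \<Rightarrow> 'a set"
  assumes P: "lipschitz_content M c \<Psi>" and c: "0 \<le> c" and W: "\<And>n. W n \<in> fmeasurable M"
    and zero: "\<And>A. A \<in> fmeasurable M \<Longrightarrow> A \<inter> (\<Union>n. W n) = {} \<Longrightarrow> \<Psi> A = 0"
  shows "\<exists>g\<in>borel_measurable M. (\<forall>x. \<bar>g x\<bar> \<le> c) \<and> (\<forall>x. x \<notin> (\<Union>n. W n) \<longrightarrow> g x = 0) \<and>
     (\<forall>A\<in>fmeasurable M. \<Psi> A = (\<integral>x. indicator A x * g x \<partial>M))"
proof -
  have add: "\<Psi> (A \<union> B) = \<Psi> A + \<Psi> B" if "A \<in> fmeasurable M" "B \<in> fmeasurable M" "A \<inter> B = {}" for A B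
    using P that unfolding lipschitz_content_def by blast
  have lip: "\<bar>\<Psi> A\<bar> \<le> c * measure M A" if "A \<in> fmeasurable M" for A
    using P that unfolding lipschitz_content_def by blast
  define D where "D = disjointed W"
  have Dsets: "D n \<in> sets M" for n
    unfolding D_def disjointed_def using W by (auto intro!: sets.Diff sets.finite_UN)
  have D: "D n \<in> fmeasurable M" for n
    by (rule fmeasurableI2[OF W _ Dsets]) (auto simp: D_def disjointed_def)
  have DU: "(\<Union>n. D n) = (\<Union>n. W n)" unfolding D_def by (rule UN_disjointed_eq)
  have Ddisj: "D m \<inter> D n = {}" if "m \<noteq> n" for m n
    using disjoint_family_disjointed[of W] that by (auto simp: disjoint_family_on_def D_def)
  have "\<forall>n. \<exists>g. g \<in> borel_measurable M \<and> (\<forall>x. \<bar>g x\<bar> \<le> c) \<and>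
     (\<forall>A\<in>sets M. A \<subseteq> D n \<longrightarrow> \<Psi> A = (\<integral>x. indicator A x * g x \<partial>M))"
    using lipschitz_content_density_on[OF P D c] by blast
  from choice[OF this] obtain G where G: "\<And>n. G n \<in> borel_measurable M" "\<And>n x. \<bar>G n x\<bar> \<le> c"
      "\<And>n A. A \<in> sets M \<Longrightarrow> A \<subseteq> D n \<Longrightarrow> \<Psi> A = (\<integral>x. indicator A x * G n x \<partial>M)" by blast
  define g where "g x = (\<Sum>n. indicator (D n) x * G n x)" for x
  have gM: "g \<in> borel_measurable M"
    unfolding g_def using G(1) Dsets by (intro borel_measurable_suminf) auto
  have gD: "g x = G n x" if x: "x \<in> D n" for x n
  proof -
    have "indicator (D k) x * G k x = 0" if "k \<notin> {n}" for k
      using Ddisj[of k n] x that by (auto split: split_indicator)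
    then have "g x = (\<Sum>k\<in>{n}. indicator (D k) x * G k x)"
      unfolding g_def by (intro suminf_finite) auto
    then show ?thesis using x by simp
  qed
  have g0: "g x = 0" if "x \<notin> (\<Union>n. W n)" for x
    using that unfolding g_def DU[symmetric] by simp
  have gc: "\<bar>g x\<bar> \<le> c" for x
  proof (cases "x \<in> (\<Union>n. W n)")
    case True
    then obtain n where "x \<in> D n" using DU by blast
    then show ?thesis using gD G(2) by simp
  qed (use g0 c in simp)
  have "\<Psi> A = (\<integral>x. indicator A x * g x \<partial>M)" if A: "A \<in> fmeasurable M" for A
  proof -
    define A' where "A' n = A \<inter> (\<Union>k<n. D k)" for n :: nat
    have As: "A \<in> sets M" using A by simp
    have A'[simp]: "A' n \<in> fmeasurable M" for n
      unfolding A'_def using Dsets by (intro fmeasurable_Int_fmeasurable A) auto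
    have AD: "A \<inter> D n \<in> fmeasurable M" for n by (intro fmeasurable_Int_fmeasurable A Dsets)
    have eq: "\<Psi> (A' n) = (\<integral>x. indicator (A' n) x * g x \<partial>M)" for n
    proof (induction n)
      case 0
      have "\<Psi> {} = 0" using zero[of "{}"] by simp
      then show ?case by (simp add: A'_def)
    next
      case (Suc n)
      have U: "A' (Suc n) = A' n \<union> (A \<inter> D n)" by (auto simp: A'_def lessThan_Suc)
      have dj: "A' n \<inter> (A \<inter> D n) = {}"
      proof -
        have "D k \<inter> D n = {}" if "k < n" for k using Ddisj[of k n] that by simp
        then show ?thesis unfolding A'_def by blast
      qed
      have "\<Psi> (A \<inter> D n) = (\<integral>x. indicator (A \<inter> D n) x * G n x \<partial>M)" using AD by (intro G(3)) auto
      also have "\<dots> = (\<integral>x. indicator (A \<inter> D n) x * g x \<partial>M)"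
        using gD by (intro Bochner_Integration.integral_cong) (auto split: split_indicator)
      finally have "\<Psi> (A' (Suc n)) = (\<integral>x. indicator (A' n) x * g x \<partial>M) + (\<integral>x. indicator (A \<inter> D n) x * g x \<partial>M)"
        unfolding U using add[OF A' AD dj] Suc by simp
      also have "\<dots> = (\<integral>x. indicator (A' n) x * g x + indicator (A \<inter> D n) x * g x \<partial>M)"
        by (intro Bochner_Integration.integral_add[symmetric] integrable_indicator_bounded[OF _ gM gc] A' AD)
      also have "\<dots> = (\<integral>x. indicator (A' (Suc n)) x * g x \<partial>M)"
        unfolding U using dj by (intro Bochner_Integration.integral_cong) (auto split: split_indicator)
      finally show ?case .
    qed
    have "(\<lambda>n. \<integral>x. indicator (A' n) x * g x \<partial>M) \<longlonglongrightarrow> (\<integral>x. indicator A x * g x \<partial>M)"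
    proof (rule integral_dominated_convergence[where w="\<lambda>x. indicator A x * c"])
      show "(\<lambda>x. indicator A x * g x) \<in> borel_measurable M" using As gM by auto
      show "(\<lambda>x. indicator (A' n) x * g x) \<in> borel_measurable M" for n
        using A'[of n, THEN fmeasurableD] gM by auto
      show "integrable M (\<lambda>x. indicator A x * c)" using c by (intro integrable_indicator_bounded[OF A]) auto
      show "AE x in M. (\<lambda>n. indicator (A' n) x * g x) \<longlonglongrightarrow> indicator A x * g x"
      proof (intro AE_I2)
        fix x
        show "(\<lambda>n. indicator (A' n) x * g x) \<longlonglongrightarrow> indicator A x * g x"
        proof (cases "x \<in> (\<Union>n. W n)")
          case True
          then obtain m where m: "x \<in> D m" using DU by blast
          have "\<forall>n\<ge>Suc m. indicator (A' n) x * g x = indicator A x * g x"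
            using m by (auto simp: A'_def indicator_def)
          then have "eventually (\<lambda>n. indicator (A' n) x * g x = indicator A x * g x) sequentially"
            unfolding eventually_sequentially by blast
          then show ?thesis by (rule tendsto_eventually)
        qed (simp add: g0)
      qed
      show "AE x in M. norm (indicator (A' n) x * g x) \<le> indicator A x * c" for n
        using gc c by (intro AE_I2) (auto simp: A'_def split: split_indicator)
    qed
    moreover have "(\<lambda>n. \<Psi> (A' n)) \<longlonglongrightarrow> \<Psi> A"
    proof -
      \<comment> \<open>The part of A not yet covered decreases to the empty set within a set of
        finite measure, so its content tends to 0.\<close>
      define R where "R n = (A \<inter> (\<Union>n. W n)) - A' n" for n
      have RM: "R n \<in> fmeasurable M" for n
        unfolding R_def using A A'[of n] W by (intro fmeasurable.Diff fmeasurable_Int_fmeasurable) auto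
      have "\<Psi> A - \<Psi> (A' n) = \<Psi> (R n)" for n
      proof -
        let ?Z = "A - (\<Union>n. W n)"
        have Z: "?Z \<in> fmeasurable M" using A W by (intro fmeasurable_Diff) auto
        have "A = A' n \<union> (R n \<union> ?Z)" using DU by (auto simp: R_def A'_def)
        moreover have "\<Psi> (R n \<union> ?Z) = \<Psi> (R n) + \<Psi> ?Z" by (rule add[OF RM Z]) (auto simp: R_def)
        moreover have "\<Psi> (A' n \<union> (R n \<union> ?Z)) = \<Psi> (A' n) + \<Psi> (R n \<union> ?Z)"
        proof (rule add[OF A' fmeasurable.Un[OF RM Z]])
          show "A' n \<inter> (R n \<union> ?Z) = {}" unfolding R_def A'_def DU[symmetric] by blast
        qed
        moreover have "\<Psi> ?Z = 0" by (rule zero[OF Z]) auto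
        ultimately show ?thesis by simp
      qed
      then have bd: "\<bar>\<Psi> A - \<Psi> (A' n)\<bar> \<le> c * measure M (R n)" for n using lip[OF RM] by simp
      have "(\<lambda>n. measure M (R n)) \<longlonglongrightarrow> measure M (\<Inter>n. R n)"
      proof (rule Lim_measure_decseq)
        show "range R \<subseteq> sets M" using RM by auto
        show "decseq R" by (rule decseq_SucI) (auto simp: R_def A'_def lessThan_Suc)
        show "emeasure M (R i) \<noteq> \<infinity>" for i using RM[of i] by (auto simp: fmeasurable_def)
      qed
      moreover have "(\<Inter>n. R n) = {}" unfolding R_def A'_def DU[symmetric] by blast
      ultimately have "(\<lambda>n. measure M (R n)) \<longlonglongrightarrow> 0" by (simp only: measure_empty)
      then have "(\<lambda>n. c * measure M (R n)) \<longlonglongrightarrow> c * 0" by (intro tendsto_mult tendsto_const)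
      then have lim0: "(\<lambda>n. c * measure M (R n)) \<longlonglongrightarrow> 0" by simp
      have "(\<lambda>n. \<bar>\<Psi> A - \<Psi> (A' n)\<bar>) \<longlonglongrightarrow> 0"
        by (rule tendsto_sandwich[OF _ _ tendsto_const lim0]) (use bd in \<open>auto intro!: always_eventually\<close>)
      then have "(\<lambda>n. \<Psi> A - \<Psi> (A' n)) \<longlonglongrightarrow> 0" by (simp add: tendsto_rabs_zero_iff)
      then have "(\<lambda>n. \<Psi> A - (\<Psi> A - \<Psi> (A' n))) \<longlonglongrightarrow> \<Psi> A - 0" by (intro tendsto_diff tendsto_const)
      then show ?thesis by simp
    qed
    ultimately show ?thesis unfolding eq using LIMSEQ_unique by blast
  qed
  then show ?thesis using gM gc g0 by blast
qed

text \<open>Integrating over the parts of \<open>W n\<close> where g is positive and where it is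
  negative shows both to be null; the sign \<open>s\<close> treats the two cases at once.\<close>

lemma AE_zero_if_integrals_zero:
  fixes W :: "nat \<Rightarrow> 'a set" and g :: "'a \<Rightarrow> real"
  assumes g: "g \<in> borel_measurable M" and W: "\<And>n. W n \<in> fmeasurable M"
    and out: "AE x in M. x \<notin> (\<Union>n. W n) \<longrightarrow> g x = 0"
    and int: "\<And>A. A \<in> fmeasurable M \<Longrightarrow> integrable M (\<lambda>x. indicator A x * g x)"
      "\<And>A. A \<in> fmeasurable M \<Longrightarrow> (\<integral>x. indicator A x * g x \<partial>M) = 0"
  shows "AE x in M. g x = 0"
proof -
  note [measurable] = g
  have one: "AE x in M. x \<in> W n \<longrightarrow> s * g x \<le> 0" if s: "s = 1 \<or> s = -1" for n and s :: real
  proof -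
    define A where "A = W n \<inter> {x \<in> space M. 0 < s * g x}"
    have A: "A \<in> fmeasurable M" unfolding A_def by (intro fmeasurable_Int_fmeasurable W) auto
    have i: "integrable M (\<lambda>x. s * (indicator A x * g x))" using int(1)[OF A] by auto
    have "(\<integral>x. s * (indicator A x * g x) \<partial>M) = 0" using int(2)[OF A] by simp
    moreover have "AE x in M. 0 \<le> s * (indicator A x * g x)"
      by (intro AE_I2) (auto simp: A_def split: split_indicator)
    ultimately have "AE x in M. s * (indicator A x * g x) = 0"
      using integral_nonneg_eq_0_iff_AE[OF i] by blast
    with AE_space show ?thesis
    proof eventually_elim
      case (elim x)
      then show ?case by (auto simp: A_def indicator_def split: if_splits)
    qed
  qed
  have "AE x in M. \<forall>n. x \<in> W n \<longrightarrow> g x = 0"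
    unfolding AE_all_countable
  proof
    fix n
    show "AE x in M. x \<in> W n \<longrightarrow> g x = 0"
      using one[of 1 n] one[of "-1" n] by (auto elim!: eventually_elim2)
  qed
  with out show ?thesis by eventually_elim auto
qed

section \<open>Averages over the cells of a finite family of sets\<close>


text \<open>The atoms of the ring of sets generated by X, named by the members of X that contain
  them. Many names give empty cells, which is harmless; the complement of the union of X is no cell,
  because it may have infinite measure.\<close>

definition cell :: "'a set set \<Rightarrow> 'a set set \<Rightarrow> 'a set" where
  "cell X Z = {y \<in> \<Union>X. {A \<in> X. y \<in> A} = Z}"

lemma cell_fmeasurable:
  assumes X: "finite X" "X \<subseteq> fmeasurable N"
  shows "cell X Z \<in> fmeasurable N"
proof (cases "Z \<subseteq> X")
  case True
  have U: "\<Union>X \<in> fmeasurable N" using X by (intro fmeasurable.finite_Union) auto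
  have "cell X Z = \<Union>X - (\<Union>A\<in>X. if A \<in> Z then \<Union>X - A else A)"
    using True by (auto simp: cell_def split: if_splits)
  moreover have "(\<Union>A\<in>X. if A \<in> Z then \<Union>X - A else A) \<in> fmeasurable N"
    using X U by (intro fmeasurable.finite_UN) auto
  ultimately show ?thesis using U by auto
next
  case False
  then have "cell X Z = {}" by (auto simp: cell_def)
  then show ?thesis by simp
qed

lemma cell_disjoint: "Z \<noteq> Z' \<Longrightarrow> cell X Z \<inter> cell X Z' = {}"
  by (auto simp: cell_def)

lemma indicator_cell:
  "indicat_real (cell X Z) y = (if y \<in> \<Union>X \<and> Z = {A \<in> X. y \<in> A} then 1 else 0)"
  by (auto simp: cell_def indicator_def)

lemma sum_over_cells:
  assumes X: "finite X"
  shows "(\<Sum>Z\<in>Pow X. \<phi> Z * indicat_real (cell X Z) y) = (if y \<in> \<Union>X then \<phi> {A \<in> X. y \<in> A} else 0)"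
proof -
  have "(\<Sum>Z\<in>Pow X. \<phi> Z * indicat_real (cell X Z) y)
      = (\<Sum>Z\<in>Pow X. if Z = {A \<in> X. y \<in> A} then (if y \<in> \<Union>X then \<phi> Z else 0) else 0)"
    by (intro sum.cong) (auto simp: indicator_cell)
  also have "\<dots> = (if y \<in> \<Union>X then \<phi> {A \<in> X. y \<in> A} else 0)"
    using X by (subst sum.delta) auto
  finally show ?thesis .
qed

lemma indicator_eq_sum_cells:
  assumes "finite X" "A \<in> X"
  shows "indicat_real A y = (\<Sum>Z\<in>Pow X. of_bool (A \<in> Z) * indicat_real (cell X Z) y)"
  using assms by (subst sum_over_cells) (auto simp: indicator_def)

lemma indicator_UN_cells:
  assumes "finite J" shows "indicat_real (\<Union>Z\<in>J. cell X Z) y = (\<Sum>Z\<in>J. indicat_real (cell X Z) y)"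
  using assms by (intro indicator_UN_disjoint) (auto simp: disjoint_family_on_def cell_disjoint)

text \<open>On null sets the division by zero makes the average 0.\<close>

definition avg :: "'a measure \<Rightarrow> ('a \<Rightarrow> real) \<Rightarrow> 'a set \<Rightarrow> real" where
  "avg N f F = (\<integral>y. indicator F y * f y \<partial>N) / measure N F"

lemma integrable_indicator_mult:
  fixes f :: "'a \<Rightarrow> real"
  assumes "integrable N f" "F \<in> sets N" shows "integrable N (\<lambda>y. indicator F y * f y)"
  using integrable_mult_indicator[OF assms(2,1)] by simp

lemma avg_lincomb:
  assumes "integrable N f" "integrable N g" "F \<in> sets N"
  shows "avg N (\<lambda>y. a * f y + b * g y) F = a * avg N f F + b * avg N g F"
proof -
  have "(\<integral>y. indicator F y * (a * f y + b * g y) \<partial>N)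
      = (\<integral>y. a * (indicator F y * f y) + b * (indicator F y * g y) \<partial>N)"
    by (intro Bochner_Integration.integral_cong) (auto simp: algebra_simps)
  also have "\<dots> = a * (\<integral>y. indicator F y * f y \<partial>N) + b * (\<integral>y. indicator F y * g y \<partial>N)"
    using integrable_indicator_mult[OF assms(1,3)] integrable_indicator_mult[OF assms(2,3)] by simp
  finally show ?thesis by (simp add: avg_def add_divide_distrib)
qed

lemma avg_abs: "\<bar>avg N f F\<bar> \<le> avg N (\<lambda>y. \<bar>f y\<bar>) F"
proof -
  have "\<bar>\<integral>y. indicator F y * f y \<partial>N\<bar> \<le> (\<integral>y. \<bar>indicator F y * f y\<bar> \<partial>N)" by (rule integral_abs_bound)
  also have "\<dots> = (\<integral>y. indicator F y * \<bar>f y\<bar> \<partial>N)"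
    by (intro Bochner_Integration.integral_cong) (auto simp: abs_mult)
  finally show ?thesis by (simp add: avg_def divide_right_mono)
qed

lemma avg_between:
  assumes "integrable N f" "F \<in> fmeasurable N" "0 < measure N F" "AE y in N. y \<in> F \<longrightarrow> p \<le> f y \<and> f y \<le> q"
  shows "p \<le> avg N f F" "avg N f F \<le> q"
proof -
  have F: "F \<in> sets N" using assms by simp
  have iF: "integrable N (indicat_real F)" using assms by (simp add: fmeasurable_def integrable_indicator_iff)
  have ir: "integrable N (\<lambda>y. indicator F y * r)" for r :: real by (rule integrable_mult_left) (rule iF)
  have mF: "(\<integral>y. indicator F y * r \<partial>N) = r * measure N F" for r :: real
    using F by (simp add: Int_absorb2 sets.sets_into_space)
  have "(\<integral>y. indicator F y * p \<partial>N) \<le> (\<integral>y. indicator F y * f y \<partial>N)"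
    by (rule integral_mono_AE[OF ir integrable_indicator_mult[OF assms(1) F]])
       (use assms(4) in \<open>auto elim!: eventually_mono split: split_indicator\<close>)
  then show "p \<le> avg N f F" unfolding mF avg_def using assms(3) by (simp add: pos_le_divide_eq)
  have "(\<integral>y. indicator F y * f y \<partial>N) \<le> (\<integral>y. indicator F y * q \<partial>N)"
    by (rule integral_mono_AE[OF integrable_indicator_mult[OF assms(1) F] ir])
       (use assms(4) in \<open>auto elim!: eventually_mono split: split_indicator\<close>)
  then show "avg N f F \<le> q" unfolding mF avg_def using assms(3) by (simp add: pos_divide_le_eq)
qed

lemma abs_avg_le:
  assumes "integrable N f" "F \<in> fmeasurable N" "AE y in N. \<bar>f y\<bar> \<le> h" "0 \<le> h"
  shows "\<bar>avg N f F\<bar> \<le> h"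
proof (cases "measure N F = 0")
  case True
  then show ?thesis using assms by (simp add: avg_def)
next
  case False
  then have "0 < measure N F" by (simp add: zero_less_measure_iff)
  moreover have "AE y in N. y \<in> F \<longrightarrow> - h \<le> f y \<and> f y \<le> h" using assms(3) by (auto elim!: eventually_mono)
  ultimately show ?thesis using avg_between[OF assms(1,2)] by (auto simp: abs_le_iff minus_le_iff)
qed

text \<open>The conditional expectation of f on the finite algebra generated by X, set to 0 outside
  the union of X.\<close>

definition cell_mean :: "'a measure \<Rightarrow> 'a set set \<Rightarrow> ('a \<Rightarrow> real) \<Rightarrow> 'a \<Rightarrow> real" where
  "cell_mean N X f y = (\<Sum>Z\<in>Pow X. avg N f (cell X Z) * indicator (cell X Z) y)"

lemma cell_mean_Dint:
  assumes "finite X" "X \<subseteq> fmeasurable N" shows "cell_mean N X f \<in> Dint N"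
  unfolding cell_mean_def[abs_def] using assms
  by (intro Dint_sum Dint_cmult Dint_indicator cell_fmeasurable)

lemma cell_mean_L1:
  assumes X: "finite X" "X \<subseteq> fmeasurable N" and f: "integrable N f"
  shows "(\<integral>y. \<bar>cell_mean N X f y\<bar> \<partial>N) \<le> (\<integral>y. \<bar>f y\<bar> \<partial>N)"
    "(\<Sum>Z\<in>Pow X. \<bar>avg N f (cell X Z)\<bar> * measure N (cell X Z)) \<le> (\<integral>y. \<bar>f y\<bar> \<partial>N)"
proof -
  have cm: "cell X Z \<in> fmeasurable N" for Z by (rule cell_fmeasurable[OF X])
  then have cs: "cell X Z \<in> sets N" for Z by auto
  have iC: "integrable N (indicat_real (cell X Z))" for Z
    using cm by (simp add: fmeasurable_def integrable_indicator_iff)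
  have iF: "integrable N (\<lambda>y. indicator (cell X Z) y * \<bar>f y\<bar>)" for Z
    using f cs by (intro integrable_indicator_mult) auto
  have "\<bar>avg N f (cell X Z)\<bar> * measure N (cell X Z) \<le> (\<integral>y. indicator (cell X Z) y * \<bar>f y\<bar> \<partial>N)" for Z
  proof -
    have "\<bar>avg N f (cell X Z)\<bar> * measure N (cell X Z) \<le> avg N (\<lambda>y. \<bar>f y\<bar>) (cell X Z) * measure N (cell X Z)"
      using avg_abs[of N f "cell X Z"] by (intro mult_right_mono) auto
    also have "\<dots> \<le> (\<integral>y. indicator (cell X Z) y * \<bar>f y\<bar> \<partial>N)"
      by (cases "measure N (cell X Z) = 0") (auto simp: avg_def intro!: integral_nonneg_AE)
    finally show ?thesis .
  qed
  then have "(\<Sum>Z\<in>Pow X. \<bar>avg N f (cell X Z)\<bar> * measure N (cell X Z))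
      \<le> (\<Sum>Z\<in>Pow X. \<integral>y. indicator (cell X Z) y * \<bar>f y\<bar> \<partial>N)" by (intro sum_mono)
  also have "\<dots> = (\<integral>y. (\<Sum>Z\<in>Pow X. indicator (cell X Z) y * \<bar>f y\<bar>) \<partial>N)"
    using iF by (intro Bochner_Integration.integral_sum[symmetric])
  also have "\<dots> \<le> (\<integral>y. \<bar>f y\<bar> \<partial>N)"
  proof (intro integral_mono)
    show "(\<Sum>Z\<in>Pow X. indicator (cell X Z) y * \<bar>f y\<bar>) \<le> \<bar>f y\<bar>" for y
      using sum_over_cells[OF X(1), of "\<lambda>_. \<bar>f y\<bar>" y] by (simp add: mult.commute)
  qed (use f iF in auto)
  finally show *: "(\<Sum>Z\<in>Pow X. \<bar>avg N f (cell X Z)\<bar> * measure N (cell X Z)) \<le> (\<integral>y. \<bar>f y\<bar> \<partial>N)" .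
  have "(\<integral>y. \<bar>cell_mean N X f y\<bar> \<partial>N) \<le> (\<integral>y. (\<Sum>Z\<in>Pow X. \<bar>avg N f (cell X Z)\<bar> * indicator (cell X Z) y) \<partial>N)"
  proof (intro integral_mono)
    show "integrable N (\<lambda>y. \<bar>cell_mean N X f y\<bar>)"
      using Dint_integrable[OF cell_mean_Dint[OF X]] by simp
    show "\<bar>cell_mean N X f y\<bar> \<le> (\<Sum>Z\<in>Pow X. \<bar>avg N f (cell X Z)\<bar> * indicator (cell X Z) y)" for y
      unfolding cell_mean_def by (rule order_trans[OF sum_abs]) (auto simp: abs_mult)
  qed (use iC in auto)
  also have "\<dots> = (\<Sum>Z\<in>Pow X. \<bar>avg N f (cell X Z)\<bar> * measure N (cell X Z))"
    using iC cs by (subst Bochner_Integration.integral_sum) (auto simp: Int_absorb2 sets.sets_into_space)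
  also note *
  finally show "(\<integral>y. \<bar>cell_mean N X f y\<bar> \<partial>N) \<le> (\<integral>y. \<bar>f y\<bar> \<partial>N)" .
qed

text \<open>X0 consists of strips on which f varies by at most e. For every larger X a cell lies
  inside a strip or meets none of them; in the latter case |f| \<le> e on it a.e. Either way f
  oscillates by at most 2e.\<close>

lemma cell_mean_approx:
  assumes f: "f \<in> Dint N" and e: "0 < e"
  shows "\<exists>X0. finite X0 \<and> X0 \<subseteq> fmeasurable N \<and>
     (\<forall>X. finite X \<and> X0 \<subseteq> X \<and> X \<subseteq> fmeasurable N \<longrightarrow> (AE y in N. \<bar>cell_mean N X f y - f y\<bar> \<le> 2 * e))"
proof -
  note [measurable] = Dint_measurable[OF f]
  note fi = Dint_integrable[OF f]
  obtain h where h: "h > 0" "AE y in N. \<bar>f y\<bar> \<le> h" using f by (auto simp: Dint_iff)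
  obtain n :: nat where n: "h < real n * e" using reals_Archimedean3[OF e] by blast
  define L where "L k = {y \<in> space N. of_int k * e \<le> f y \<and> f y < (of_int k + 1) * e}" for k :: int
  \<comment> \<open>The strips -1 and 0 next to the value 0 are left out: they may have infinite
    measure.\<close>
  define KS where "KS = {- int n - 1..int n} - {-1, 0}"
  \<comment> \<open>The remaining strips satisfy |f| \<ge> e, hence |f| > e/2; the exponent 1/2 is
    an arbitrary choice in the lemma on finite level sets.\<close>
  have small: "{y \<in> space N. e / 2 < \<bar>f y\<bar>} \<in> fmeasurable N"
    using Dint_subset_Lp1[of "1/2" N] f e by (intro Lp1_distribution_finite[of "1/2"]) auto
  have LF: "L k \<in> fmeasurable N" if k: "k \<in> KS" for k
  proof (rule fmeasurableI2[OF small])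
    show "L k \<in> sets N" unfolding L_def by measurable
    show "L k \<subseteq> {y \<in> space N. e / 2 < \<bar>f y\<bar>}"
    proof
      fix y assume y: "y \<in> L k"
      have "k \<ge> 1 \<or> k \<le> -2" using k by (auto simp: KS_def)
      then have "e \<le> \<bar>f y\<bar>"
      proof
        assume "1 \<le> k"
        then have "1 * e \<le> of_int k * e" using e by (intro mult_right_mono) auto
        then show ?thesis using y by (auto simp: L_def)
      next
        assume "k \<le> -2"
        then have "(of_int k + 1) * e \<le> (-1) * e" using e by (intro mult_right_mono) auto
        then show ?thesis using y by (auto simp: L_def)
      qed
      then show "y \<in> {y \<in> space N. e / 2 < \<bar>f y\<bar>}" using y e by (auto simp: L_def)
    qed
  qed
  have rest: "AE y in N. (\<forall>k\<in>KS. y \<notin> L k) \<longrightarrow> - e \<le> f y \<and> f y \<le> e"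
    using h(2) AE_space
  proof eventually_elim
    case (elim y)
    define k where "k = \<lfloor>f y / e\<rfloor>"
    have "of_int k \<le> f y / e" "f y / e < of_int k + 1" unfolding k_def by linarith+
    then have k: "of_int k * e \<le> f y" "f y < (of_int k + 1) * e"
      using e by (simp_all add: pos_le_divide_eq pos_divide_less_eq)
    then have yk: "y \<in> L k" using elim by (simp add: L_def)
    have "of_int k * e < real n * e" "- (real n) * e < (of_int k + 1) * e" using k elim n by auto
    then have "of_int k < real n" "- real n < of_int k + 1"
      using mult_right_less_imp_less[of _ e] e by (meson less_imp_le)+
    then have kk: "k \<in> {- int n - 1..int n}" by auto
    show ?case
    proof
      assume "\<forall>k\<in>KS. y \<notin> L k"
      then have "k = -1 \<or> k = 0" using yk kk by (auto simp: KS_def)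
      then show "- e \<le> f y \<and> f y \<le> e" using k e by auto
    qed
  qed
  show ?thesis
  proof (intro exI[of _ "L ` KS"] conjI allI impI)
    show "finite (L ` KS)" by (simp add: KS_def)
    show "L ` KS \<subseteq> fmeasurable N" using LF by auto
    fix X assume "finite X \<and> L ` KS \<subseteq> X \<and> X \<subseteq> fmeasurable N"
    then have X: "finite X" "L ` KS \<subseteq> X" "X \<subseteq> fmeasurable N" by auto
    have cell: "AE y in N. y \<in> cell X Z \<longrightarrow> \<bar>avg N f (cell X Z) - f y\<bar> \<le> 2 * e" for Z
    proof (cases "measure N (cell X Z) = 0")
      case True
      have cm: "cell X Z \<in> fmeasurable N" by (rule cell_fmeasurable[OF X(1,3)])
      then have "emeasure N (cell X Z) = 0" using True by (simp add: emeasure_eq_measure2)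
      then have "cell X Z \<in> null_sets N" using cm by auto
      from AE_not_in[OF this] show ?thesis by eventually_elim auto
    next
      case False
      then have pos: "0 < measure N (cell X Z)" by (simp add: zero_less_measure_iff)
      have "\<exists>p q. q - p \<le> 2 * e \<and> (AE y in N. y \<in> cell X Z \<longrightarrow> p \<le> f y \<and> f y \<le> q)"
      proof (cases "\<exists>k\<in>KS. L k \<in> Z")
        case True
        then obtain k where k: "k \<in> KS" "L k \<in> Z" by blast
        have "y \<in> cell X Z \<Longrightarrow> y \<in> L k" for y using k by (auto simp: cell_def)
        then have "AE y in N. y \<in> cell X Z \<longrightarrow> of_int k * e \<le> f y \<and> f y \<le> (of_int k + 1) * e"
          by (intro AE_I2) (auto simp: L_def less_imp_le)
        moreover have "(of_int k + 1) * e - of_int k * e \<le> 2 * e" using e by (simp add: algebra_simps)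
        ultimately show ?thesis by blast
      next
        case False
        then have no: "y \<in> cell X Z \<Longrightarrow> \<forall>k\<in>KS. y \<notin> L k" for y using X(2) by (auto simp: cell_def)
        have "AE y in N. y \<in> cell X Z \<longrightarrow> - e \<le> f y \<and> f y \<le> e"
          using rest by eventually_elim (use no in blast)
        then show ?thesis by (intro exI[of _ "- e"] exI[of _ e]) auto
      qed
      then obtain p q where pq: "q - p \<le> 2 * e" "AE y in N. y \<in> cell X Z \<longrightarrow> p \<le> f y \<and> f y \<le> q" by blast
      note B = avg_between[OF fi cell_fmeasurable[OF X(1,3)] pos pq(2)]
      show ?thesis using pq(2) by eventually_elim (use B pq(1) in auto)
    qed
    have "AE y in N. \<forall>Z\<in>Pow X. y \<in> cell X Z \<longrightarrow> \<bar>avg N f (cell X Z) - f y\<bar> \<le> 2 * e"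
      using X(1) cell by (subst AE_finite_all) auto
    then show "AE y in N. \<bar>cell_mean N X f y - f y\<bar> \<le> 2 * e"
      using rest
    proof eventually_elim
      case (elim y)
      have cmy: "cell_mean N X f y = (if y \<in> \<Union>X then avg N f (cell X {A \<in> X. y \<in> A}) else 0)"
        unfolding cell_mean_def by (rule sum_over_cells[OF X(1)])
      show ?case
      proof (cases "y \<in> \<Union>X")
        case True
        then have "y \<in> cell X {A \<in> X. y \<in> A}" by (auto simp: cell_def)
        then show ?thesis using elim(1) True cmy by auto
      next
        case False
        then have "\<forall>k\<in>KS. y \<notin> L k" using X(2) by auto
        then show ?thesis using elim(2) False cmy e by auto
      qed
    qed
  qed
qed

section \<open>Splitting an operator dominated by a positive one\<close>


text \<open>\<open>v_bound\<close> combines the weak type bound of v, integrated over E, with the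
  interpolation estimate of the L^{p,1} norm by supremum and integral. \<open>v_level\<close>
  supplies the sigma-finite carriers.\<close>

locale dominated_operator =
  fixes N :: "'b measure" and M :: "'a measure" and \<theta> \<kappa> :: real
    and T v :: "('b \<Rightarrow> real) \<Rightarrow> ('a \<Rightarrow> real)"
  assumes th: "0 < \<theta>" "\<theta> < 1" and \<kappa>: "0 < \<kappa>"
    and linT: "lin_op_on N M (Dint N) T" and linv: "lin_op_on N M (Dint N) v"
    and pos: "\<And>f. f \<in> Dint N \<Longrightarrow> AE y in N. 0 \<le> f y \<Longrightarrow> AE x in M. 0 \<le> v f x"
    and dom: "\<And>f. f \<in> Dint N \<Longrightarrow> AE x in M. \<bar>T f x\<bar> \<le> v (\<lambda>y. \<bar>f y\<bar>) x"
    and v_bound: "\<And>f h k E. f \<in> Dint N \<Longrightarrow> 0 < h \<Longrightarrow> 0 < k \<Longrightarrow> AE y in N. \<bar>f y\<bar> \<le> h \<Longrightarrow>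
      (\<integral>y. \<bar>f y\<bar> \<partial>N) \<le> k \<Longrightarrow> E \<in> fmeasurable M \<Longrightarrow>
      (\<integral>\<^sup>+x\<in>E. ennreal \<bar>v f x\<bar> \<partial>M) \<le> ennreal (\<kappa> * measure M E powr (1 - \<theta>) * (h powr (1 - \<theta>) * k powr \<theta>))"
    and v_level: "\<And>f l. f \<in> Dint N \<Longrightarrow> 0 < l \<Longrightarrow> {x \<in> space M. l < \<bar>v f x\<bar>} \<in> fmeasurable M"
begin

text \<open>T and v are both of this kind, so the facts about the bilinear form \<open>J\<close> are
  proved once for both.\<close>

definition adm :: "(('b \<Rightarrow> real) \<Rightarrow> ('a \<Rightarrow> real)) \<Rightarrow> bool" where
  "adm W \<longleftrightarrow> lin_op_on N M (Dint N) W \<and> (\<forall>f\<in>Dint N. AE x in M. \<bar>W f x\<bar> \<le> v (\<lambda>y. \<bar>f y\<bar>) x)"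

lemma admT: "adm T" using linT dom by (simp add: adm_def)

lemma admv: "adm v"
  unfolding adm_def
proof (intro conjI ballI linv)
  fix f assume f: "f \<in> Dint N"
  note a = Dint_abs[OF f]
  have "AE x in M. 0 \<le> v (\<lambda>y. \<bar>f y\<bar> - f y) x" "AE x in M. 0 \<le> v (\<lambda>y. \<bar>f y\<bar> + f y) x"
    using f a by (intro pos Dint_diff Dint_add; auto)+
  moreover note lin_op_on_diff[OF linv a f] lin_op_on_add[OF linv a f]
  ultimately show "AE x in M. \<bar>v f x\<bar> \<le> v (\<lambda>y. \<bar>f y\<bar>) x" by eventually_elim auto
qed

lemma adm_lin: "adm W \<Longrightarrow> lin_op_on N M (Dint N) W"
  by (simp add: adm_def)

definition J :: "(('b \<Rightarrow> real) \<Rightarrow> ('a \<Rightarrow> real)) \<Rightarrow> 'a set \<Rightarrow> ('b \<Rightarrow> real) \<Rightarrow> real" where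
  "J W E f = (\<integral>x. indicator E x * W f x \<partial>M)"

lemma adm_measurable: "adm W \<Longrightarrow> f \<in> Dint N \<Longrightarrow> W f \<in> borel_measurable M"
  using lin_op_on_measurable adm_lin by blast

lemma adm_integrable:
  assumes W: "adm W" and f: "f \<in> Dint N" and E: "E \<in> fmeasurable M"
  shows "integrable M (\<lambda>x. indicator E x * W f x)"
proof (rule integrableI_bounded)
  have Es: "E \<in> sets M" using E by simp
  show "(\<lambda>x. indicator E x * W f x) \<in> borel_measurable M" using adm_measurable[OF W f] Es by auto
  obtain h where h: "h > 0" "AE y in N. \<bar>f y\<bar> \<le> h" using f by (auto simp: Dint_iff)
  let ?k = "(\<integral>y. \<bar>f y\<bar> \<partial>N) + 1"
  have k: "0 < ?k" by (intro add_nonneg_pos integral_nonneg_AE) auto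
  have "(\<integral>\<^sup>+x. ennreal (norm (indicator E x * W f x)) \<partial>M) \<le> (\<integral>\<^sup>+x\<in>E. ennreal \<bar>v (\<lambda>y. \<bar>f y\<bar>) x\<bar> \<partial>M)"
  proof (intro nn_integral_mono_AE)
    have "AE x in M. \<bar>W f x\<bar> \<le> v (\<lambda>y. \<bar>f y\<bar>) x" using W f by (simp add: adm_def)
    then show "AE x in M. ennreal (norm (indicator E x * W f x)) \<le> ennreal \<bar>v (\<lambda>y. \<bar>f y\<bar>) x\<bar> * indicator E x"
      by eventually_elim (auto split: split_indicator intro!: ennreal_leI)
  qed
  also have "\<dots> \<le> ennreal (\<kappa> * measure M E powr (1 - \<theta>) * (h powr (1 - \<theta>) * ?k powr \<theta>))"
    using h k by (intro v_bound Dint_abs f E) auto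
  also have "\<dots> < \<infinity>" by simp
  finally show "(\<integral>\<^sup>+x. ennreal (norm (indicator E x * W f x)) \<partial>M) < \<infinity>" .
qed

lemma J_dominated:
  assumes W: "adm W" and f: "f \<in> Dint N" and E: "E \<in> fmeasurable M"
  shows "\<bar>J W E f\<bar> \<le> J v E (\<lambda>y. \<bar>f y\<bar>)"
proof -
  have "\<bar>J W E f\<bar> \<le> (\<integral>x. \<bar>indicator E x * W f x\<bar> \<partial>M)" unfolding J_def by (rule integral_abs_bound)
  also have "\<dots> \<le> J v E (\<lambda>y. \<bar>f y\<bar>)"
    unfolding J_def
  proof (rule integral_mono_AE)
    show "integrable M (\<lambda>x. \<bar>indicator E x * W f x\<bar>)" using adm_integrable[OF W f E] by simp
    show "integrable M (\<lambda>x. indicator E x * v (\<lambda>y. \<bar>f y\<bar>) x)" by (rule adm_integrable[OF admv Dint_abs[OF f] E])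
    have "AE x in M. \<bar>W f x\<bar> \<le> v (\<lambda>y. \<bar>f y\<bar>) x" using W f by (simp add: adm_def)
    then show "AE x in M. \<bar>indicator E x * W f x\<bar> \<le> indicator E x * v (\<lambda>y. \<bar>f y\<bar>) x"
      by eventually_elim (auto split: split_indicator)
  qed
  finally show ?thesis .
qed

lemma J_v_bound:
  assumes f: "f \<in> Dint N" and E: "E \<in> fmeasurable M" and h: "0 < h" "AE y in N. \<bar>f y\<bar> \<le> h"
    and k: "0 < k" "(\<integral>y. \<bar>f y\<bar> \<partial>N) \<le> k"
  shows "J v E f \<le> \<kappa> * measure M E powr (1 - \<theta>) * (h powr (1 - \<theta>) * k powr \<theta>)"
proof -
  have i: "integrable M (\<lambda>x. indicator E x * v f x)" by (rule adm_integrable[OF admv f E])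
  have "J v E f \<le> (\<integral>x. \<bar>indicator E x * v f x\<bar> \<partial>M)"
    unfolding J_def using i by (intro integral_mono) auto
  moreover have "(\<integral>x. \<bar>indicator E x * v f x\<bar> \<partial>M)
      \<le> \<kappa> * measure M E powr (1 - \<theta>) * (h powr (1 - \<theta>) * k powr \<theta>)"
  proof -
    have "ennreal (\<integral>x. \<bar>indicator E x * v f x\<bar> \<partial>M) = (\<integral>\<^sup>+x. ennreal \<bar>indicator E x * v f x\<bar> \<partial>M)"
      using i by (intro nn_integral_eq_integral[symmetric]) auto
    also have "\<dots> = (\<integral>\<^sup>+x\<in>E. ennreal \<bar>v f x\<bar> \<partial>M)"
      by (intro nn_integral_cong) (auto split: split_indicator)
    also have "\<dots> \<le> ennreal (\<kappa> * measure M E powr (1 - \<theta>) * (h powr (1 - \<theta>) * k powr \<theta>))"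
      by (rule v_bound[OF f h(1) k(1) h(2) k(2) E])
    finally show ?thesis using \<kappa> by (subst (asm) ennreal_le_iff) auto
  qed
  ultimately show ?thesis by (rule order_trans)
qed

lemma J_lincomb:
  assumes W: "adm W" and f: "f \<in> Dint N" and g: "g \<in> Dint N" and E: "E \<in> fmeasurable M"
  shows "J W E (\<lambda>y. a * f y + b * g y) = a * J W E f + b * J W E g"
proof -
  have Es: "E \<in> sets M" using E by simp
  have "J W E (\<lambda>y. a * f y + b * g y) = (\<integral>x. a * (indicator E x * W f x) + b * (indicator E x * W g x) \<partial>M)"
    unfolding J_def
  proof (rule integral_cong_AE)
    show "AE x in M. indicator E x * W (\<lambda>y. a * f y + b * g y) x = a * (indicator E x * W f x) + b * (indicator E x * W g x)"
      using lin_op_on_lincomb[OF adm_lin[OF W] f g, of a b] by eventually_elim (simp add: algebra_simps)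
    show "(\<lambda>x. indicator E x * W (\<lambda>y. a * f y + b * g y) x) \<in> borel_measurable M"
      using adm_measurable[OF W Dint_lincomb[OF f g]] Es by auto
    show "(\<lambda>x. a * (indicator E x * W f x) + b * (indicator E x * W g x)) \<in> borel_measurable M"
      using adm_measurable[OF W f] adm_measurable[OF W g] Es by auto
  qed
  also have "\<dots> = a * J W E f + b * J W E g"
    unfolding J_def using adm_integrable[OF W f E] adm_integrable[OF W g E] by simp
  finally show ?thesis .
qed

lemma J_sum:
  assumes W: "adm W" and E: "E \<in> fmeasurable M" and I: "finite I" and f: "\<And>i. i \<in> I \<Longrightarrow> f i \<in> Dint N"
  shows "J W E (\<lambda>y. \<Sum>i\<in>I. a i * f i y) = (\<Sum>i\<in>I. a i * J W E (f i))"
  using I f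
proof (induction I rule: finite_induct)
  case empty
  show ?case using J_lincomb[OF W Dint_zero Dint_zero E, of 0 0] by simp
next
  case (insert i I)
  have "J W E (\<lambda>y. a i * f i y + 1 * (\<Sum>i\<in>I. a i * f i y)) = a i * J W E (f i) + 1 * J W E (\<lambda>y. \<Sum>i\<in>I. a i * f i y)"
    using insert.prems by (intro J_lincomb[OF W _ _ E] Dint_sum Dint_cmult) auto
  then show ?case using insert by simp
qed

lemma J_set_sum:
  assumes W: "adm W" and f: "f \<in> Dint N" and I: "finite I" and Ei: "\<And>i. i \<in> I \<Longrightarrow> E i \<in> fmeasurable M"
    and eq: "\<And>x. indicat_real E' x = (\<Sum>i\<in>I. a i * indicat_real (E i) x)"
  shows "J W E' f = (\<Sum>i\<in>I. a i * J W (E i) f)"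
proof -
  have "J W E' f = (\<integral>x. (\<Sum>i\<in>I. a i * (indicator (E i) x * W f x)) \<partial>M)"
    unfolding J_def eq by (simp add: sum_distrib_right mult.assoc)
  also have "\<dots> = (\<Sum>i\<in>I. a i * J W (E i) f)"
    unfolding J_def using adm_integrable[OF W f Ei]
    by (subst Bochner_Integration.integral_sum) auto
  finally show ?thesis .
qed

lemma J_cell_mean_tendsto:
  assumes W: "adm W" and f: "f \<in> Dint N" and E: "E \<in> fmeasurable M"
  shows "((\<lambda>X. J W E (cell_mean N X f)) \<longlongrightarrow> J W E f) (finite_subsets_at_top (fmeasurable N))"
proof (rule tendstoI)
  fix e :: real assume e: "0 < e"
  define k where "k = 2 * (\<integral>y. \<bar>f y\<bar> \<partial>N) + 1"
  have k: "0 < k" unfolding k_def by (intro add_nonneg_pos mult_nonneg_nonneg integral_nonneg_AE) auto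
  define q where "q = \<kappa> * measure M E powr (1 - \<theta>) * k powr \<theta>"
  have q: "0 \<le> q" using \<kappa> by (simp add: q_def)
  \<comment> \<open>Makes q d^(1-\<theta>) equal to e q / (2 (q + 1)), which is below e even for q =
    0.\<close>
  define d where "d = (e / (2 * (q + 1))) powr (1 / (1 - \<theta>))"
  have d: "0 < d" using e q by (simp add: d_def)
  have dq: "q * d powr (1 - \<theta>) < e"
  proof -
    have "d powr (1 - \<theta>) = e / (2 * (q + 1))" unfolding d_def using e q th by (simp add: powr_powr)
    moreover have "0 < e * (q + 2)" using e q by simp
    then have "q * e < e * (2 * (q + 1))" by (simp add: algebra_simps)
    ultimately show ?thesis using q by (simp add: divide_less_eq)
  qed
  obtain X0 where X0: "finite X0" "X0 \<subseteq> fmeasurable N"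
      "\<And>X. finite X \<Longrightarrow> X0 \<subseteq> X \<Longrightarrow> X \<subseteq> fmeasurable N \<Longrightarrow> AE y in N. \<bar>cell_mean N X f y - f y\<bar> \<le> 2 * (d / 2)"
    using cell_mean_approx[OF f, of "d / 2"] d by auto
  show "eventually (\<lambda>X. dist (J W E (cell_mean N X f)) (J W E f) < e) (finite_subsets_at_top (fmeasurable N))"
    unfolding eventually_finite_subsets_at_top
  proof (intro exI[of _ X0] conjI allI impI X0(1,2))
    fix X assume "finite X \<and> X0 \<subseteq> X \<and> X \<subseteq> fmeasurable N"
    then have X: "finite X" "X0 \<subseteq> X" "X \<subseteq> fmeasurable N" by auto
    note cD = cell_mean_Dint[OF X(1,3), of f]
    define g where "g y = cell_mean N X f y - f y" for y
    have gD: "g \<in> Dint N" unfolding g_def[abs_def] by (intro Dint_diff cD f)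
    have g1: "AE y in N. \<bar>g y\<bar> \<le> d" using X0(3)[OF X] by (simp add: g_def)
    have "(\<integral>y. \<bar>g y\<bar> \<partial>N) \<le> (\<integral>y. \<bar>cell_mean N X f y\<bar> + \<bar>f y\<bar> \<partial>N)"
      using Dint_integrable[OF gD] Dint_integrable[OF cD] Dint_integrable[OF f]
      by (intro integral_mono) (auto simp: g_def)
    also have "\<dots> = (\<integral>y. \<bar>cell_mean N X f y\<bar> \<partial>N) + (\<integral>y. \<bar>f y\<bar> \<partial>N)"
      using Dint_integrable[OF cD] Dint_integrable[OF f] by (intro Bochner_Integration.integral_add) auto
    also have "\<dots> \<le> k" using cell_mean_L1(1)[OF X(1,3) Dint_integrable[OF f]] by (simp add: k_def)
    finally have g2: "(\<integral>y. \<bar>g y\<bar> \<partial>N) \<le> k" .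
    have "J W E g = J W E (cell_mean N X f) - J W E f"
      using J_lincomb[OF W cD f E, of 1 "-1"] by (simp add: g_def[abs_def])
    then have "\<bar>J W E (cell_mean N X f) - J W E f\<bar> \<le> J v E (\<lambda>y. \<bar>g y\<bar>)"
      using J_dominated[OF W gD E] by simp
    also have "\<dots> \<le> \<kappa> * measure M E powr (1 - \<theta>) * (d powr (1 - \<theta>) * k powr \<theta>)"
      using g1 g2 by (intro J_v_bound Dint_abs gD E d k) auto
    also have "\<dots> = q * d powr (1 - \<theta>)" by (simp add: q_def)
    also have "\<dots> < e" by (rule dq)
    finally show "dist (J W E (cell_mean N X f)) (J W E f) < e" by (simp add: dist_real_def)
  qed
qed

text \<open>The weighted AM-GM inequality \<open>x\<^bsup>1-\<theta>\<^esup> y\<^bsup>\<theta>\<^esup> \<le> t\<^bsup>\<theta>\<^esup> x + t\<^bsup>\<theta>-1\<^esup> y\<close> turns the weak type estimate into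
  the cut condition of the flow problem.\<close>
lemma J_v_indicator_bound:
  assumes E: "E \<in> fmeasurable M" and F: "F \<in> fmeasurable N" and t: "0 < t"
  shows "J v E (indicat_real F) \<le> \<kappa> * t powr \<theta> * measure M E + \<kappa> * t powr (\<theta> - 1) * measure N F"
proof (cases "measure N F = 0")
  case True
  then have "emeasure N F = 0" using F by (simp add: emeasure_eq_measure2)
  then have "F \<in> null_sets N" using F by auto
  from AE_not_in[OF this] have "AE y in N. indicat_real F y = 0" by eventually_elim simp
  then have "AE x in M. v (indicat_real F) x = v (\<lambda>y. 0) x"
    by (intro lin_op_on_cong[OF linv] Dint_indicator F Dint_zero)
  then have "AE x in M. indicator E x * v (indicat_real F) x = 0"
    using lin_op_on_zero[OF linv Dint_zero] by eventually_elim simp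
  then have "J v E (indicat_real F) = 0" unfolding J_def by (rule integral_eq_zero_AE)
  then show ?thesis using \<kappa> by (simp add: True)
next
  case False
  let ?x = "measure M E" and ?y = "measure N F"
  have y: "0 < ?y" using False by (simp add: zero_less_measure_iff)
  have Fs: "F \<in> sets N" using F by simp
  have "J v E (indicat_real F) \<le> \<kappa> * ?x powr (1 - \<theta>) * (1 powr (1 - \<theta>) * ?y powr \<theta>)"
  proof (rule J_v_bound[OF Dint_indicator[OF F] E])
    show "(\<integral>y. \<bar>indicat_real F y\<bar> \<partial>N) \<le> ?y" using Fs by (simp add: Int_absorb2 sets.sets_into_space)
  qed (use y in \<open>auto split: split_indicator\<close>)
  also have "\<dots> = \<kappa> * (?x powr (1 - \<theta>) * ?y powr \<theta>)" by simp
  also have "?x powr (1 - \<theta>) * ?y powr \<theta> \<le> t powr \<theta> * ?x + t powr (\<theta> - 1) * ?y"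
  proof -
    define u where "u = t powr \<theta> * ?x"
    define w where "w = t powr (\<theta> - 1) * ?y"
    have uw: "0 \<le> u" "0 \<le> w" by (auto simp: u_def w_def)
    have "?x powr (1 - \<theta>) * ?y powr \<theta> = u powr (1 - \<theta>) * w powr \<theta>"
    proof -
      have "u powr (1 - \<theta>) * w powr \<theta> = (t powr (\<theta> * (1 - \<theta>)) * t powr ((\<theta> - 1) * \<theta>)) * (?x powr (1 - \<theta>) * ?y powr \<theta>)"
        by (simp add: u_def w_def powr_mult powr_powr)
      also have "t powr (\<theta> * (1 - \<theta>)) * t powr ((\<theta> - 1) * \<theta>) = t powr 0"
        unfolding powr_add[symmetric] by (simp add: algebra_simps)
      finally show ?thesis using t by simp
    qed
    also have "\<dots> \<le> (u + w) powr (1 - \<theta>) * (u + w) powr \<theta>"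
      using uw th by (intro mult_mono powr_mono2) auto
    also have "\<dots> = u + w"
    proof (cases "u + w = 0")
      case True
      then show ?thesis by simp
    next
      case False
      then have "0 < u + w" using uw by simp
      then show ?thesis unfolding powr_add[symmetric] by simp
    qed
    finally show ?thesis by (simp add: u_def w_def)
  qed
  finally show ?thesis using \<kappa> by (simp add: algebra_simps)
qed

end


section \<open>Discretized bilinear forms and their limit\<close>

context dominated_operator
begin

definition partition_pair :: "'b set set \<Rightarrow> 'a set set \<Rightarrow> bool" where
  "partition_pair X Y \<longleftrightarrow> finite X \<and> X \<subseteq> fmeasurable N \<and> finite Y \<and> Y \<subseteq> fmeasurable M"

text \<open>\<open>S i j\<close> charges the mass that v carries between two cells to the cell
  \<open>i\<close> in M, which serves the L^infinity half; otherwise it is charged to the cell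
  \<open>j\<close> in N, for the L^1 half.\<close>

definition orientation :: "real \<Rightarrow> 'b set set \<Rightarrow> 'a set set \<Rightarrow> ('a set set \<Rightarrow> 'b set set \<Rightarrow> bool) \<Rightarrow> bool" where
  "orientation t X Y S \<longleftrightarrow>
     (\<forall>i\<in>Pow Y. (\<Sum>j\<in>Pow X. if S i j then J v (cell Y i) (indicat_real (cell X j)) else 0)
        \<le> 2 * (\<kappa> * t powr \<theta> * measure M (cell Y i))) \<and>
     (\<forall>j\<in>Pow X. (\<Sum>i\<in>Pow Y. if S i j then 0 else J v (cell Y i) (indicat_real (cell X j)))
        \<le> 2 * (\<kappa> * t powr (\<theta> - 1) * measure N (cell X j)))"

definition orient :: "real \<Rightarrow> 'b set set \<Rightarrow> 'a set set \<Rightarrow> 'a set set \<Rightarrow> 'b set set \<Rightarrow> bool" where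
  "orient t X Y = (SOME S. orientation t X Y S)"

lemma cells_fmeasurable:
  assumes "partition_pair X Y"
  shows "cell X j \<in> fmeasurable N" "cell Y i \<in> fmeasurable M"
  using assms cell_fmeasurable[of X N j] cell_fmeasurable[of Y M i] by (simp_all add: partition_pair_def)

lemma measure_UN_cells:
  assumes "finite X" "X \<subseteq> fmeasurable L" "finite I"
  shows "measure L (\<Union>i\<in>I. cell X i) = (\<Sum>i\<in>I. measure L (cell X i))"
proof (rule measure_finite_Union[OF assms(3)])
  note c = cell_fmeasurable[OF assms(1,2)]
  show "cell X ` I \<subseteq> sets L" using c by auto
  show "disjoint_family_on (cell X) I" by (auto simp: disjoint_family_on_def cell_disjoint)
  show "emeasure L (cell X i) \<noteq> \<infinity>" for i using c[THEN fmeasurableD2] by simp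
qed

lemma orientation_orient:
  assumes XY: "partition_pair X Y" and t: "0 < t"
  shows "orientation t X Y (orient t X Y)"
proof -
  have fin: "finite X" "finite Y" "X \<subseteq> fmeasurable N" "Y \<subseteq> fmeasurable M"
    using XY by (auto simp: partition_pair_def)
  note cf = cells_fmeasurable[OF XY]
  have "\<exists>S. orientation t X Y S"
    unfolding orientation_def
  proof (rule bipartite_orientation)
    \<comment> \<open>For subfamilies of cells the cut condition is the estimate
      \<open>J_v_indicator_bound\<close> for their unions, by bilinearity of
      \<open>J\<close>.\<close>
    fix I' J' assume I': "I' \<subseteq> Pow Y" and J': "J' \<subseteq> Pow X"
    have fI: "finite I'" "finite J'" using I' J' fin by (auto intro: finite_subset)
    let ?E = "\<Union>i\<in>I'. cell Y i" and ?F = "\<Union>j\<in>J'. cell X j"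
    have E: "?E \<in> fmeasurable M" using fI cf by (intro fmeasurable.finite_UN) auto
    have F: "?F \<in> fmeasurable N" using fI cf by (intro fmeasurable.finite_UN) auto
    have "J v ?E (indicat_real ?F) = (\<Sum>i\<in>I'. 1 * J v (cell Y i) (indicat_real ?F))"
      by (intro J_set_sum admv Dint_indicator F fI cf) (use fI in \<open>simp add: indicator_UN_cells\<close>)
    also have "\<dots> = (\<Sum>i\<in>I'. \<Sum>j\<in>J'. J v (cell Y i) (indicat_real (cell X j)))"
    proof (intro sum.cong refl)
      fix i
      have eq: "indicat_real ?F = (\<lambda>y. \<Sum>j\<in>J'. 1 * indicat_real (cell X j) y)"
        using fI by (auto simp: indicator_UN_cells)
      have "J v (cell Y i) (indicat_real ?F) = (\<Sum>j\<in>J'. 1 * J v (cell Y i) (indicat_real (cell X j)))"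
        unfolding eq by (intro J_sum admv cf fI Dint_indicator)
      then show "1 * J v (cell Y i) (indicat_real ?F) = (\<Sum>j\<in>J'. J v (cell Y i) (indicat_real (cell X j)))"
        by simp
    qed
    finally have "(\<Sum>i\<in>I'. \<Sum>j\<in>J'. J v (cell Y i) (indicat_real (cell X j)))
        \<le> \<kappa> * t powr \<theta> * measure M ?E + \<kappa> * t powr (\<theta> - 1) * measure N ?F"
      using J_v_indicator_bound[OF E F t] by simp
    also have "\<dots> = (\<Sum>i\<in>I'. \<kappa> * t powr \<theta> * measure M (cell Y i)) + (\<Sum>j\<in>J'. \<kappa> * t powr (\<theta> - 1) * measure N (cell X j))"
      using fI fin by (simp add: measure_UN_cells sum_distrib_left)
    finally show "(\<Sum>i\<in>I'. \<Sum>j\<in>J'. J v (cell Y i) (indicat_real (cell X j))) \<le>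
       (\<Sum>i\<in>I'. \<kappa> * t powr \<theta> * measure M (cell Y i)) + (\<Sum>j\<in>J'. \<kappa> * t powr (\<theta> - 1) * measure N (cell X j))" .
  next
    show "finite (Pow Y)" "finite (Pow X)" using fin by simp_all
  qed
  then show ?thesis unfolding orient_def by (rule someI_ex)
qed

text \<open>The fraction of the cell that A occupies. It makes the forms additive in A for every A
  of finite measure, not only for those generated by Y.\<close>

definition frac :: "'a set set \<Rightarrow> 'a set \<Rightarrow> 'a set set \<Rightarrow> real" where
  "frac Y A i = measure M (A \<inter> cell Y i) / measure M (cell Y i)"

definition entry :: "'b set set \<Rightarrow> 'a set set \<Rightarrow> ('b \<Rightarrow> real) \<Rightarrow> 'a set \<Rightarrow> 'a set set \<Rightarrow> 'b set set \<Rightarrow> real" where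
  "entry X Y f A i j = avg N f (cell X j) * frac Y A i * J T (cell Y i) (indicat_real (cell X j))"

text \<open>The pairing of the indicator of A with the first half of the discretized operator: f and
  A are averaged over cells, and only the pairs of cells charged to M are kept.\<close>

definition form0 :: "real \<Rightarrow> 'b set set \<Rightarrow> 'a set set \<Rightarrow> ('b \<Rightarrow> real) \<Rightarrow> 'a set \<Rightarrow> real" where
  "form0 t X Y f A = (\<Sum>i\<in>Pow Y. \<Sum>j\<in>Pow X. if orient t X Y i j then entry X Y f A i j else 0)"

definition form1 :: "real \<Rightarrow> 'b set set \<Rightarrow> 'a set set \<Rightarrow> ('b \<Rightarrow> real) \<Rightarrow> 'a set \<Rightarrow> real" where
  "form1 t X Y f A = (\<Sum>i\<in>Pow Y. \<Sum>j\<in>Pow X. if orient t X Y i j then 0 else entry X Y f A i j)"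

lemma frac_nonneg: "0 \<le> frac Y A i" by (simp add: frac_def)

lemma frac_add:
  assumes "partition_pair X Y" "A \<in> fmeasurable M" "A' \<in> fmeasurable M" "A \<inter> A' = {}"
  shows "frac Y (A \<union> A') i = frac Y A i + frac Y A' i"
proof -
  note c = cells_fmeasurable[OF assms(1)]
  have "measure M ((A \<inter> cell Y i) \<union> (A' \<inter> cell Y i)) = measure M (A \<inter> cell Y i) + measure M (A' \<inter> cell Y i)"
    using fmeasurable_Int_fmeasurable[OF assms(2), of "cell Y i"] fmeasurable_Int_fmeasurable[OF assms(3), of "cell Y i"]
      assms(4) c by (intro measure_Union) (auto simp: fmeasurable_def)
  then show ?thesis by (simp add: frac_def Int_Un_distrib2 add_divide_distrib)
qed

lemma frac_le_1:
  assumes "partition_pair X Y" "A \<in> fmeasurable M" shows "frac Y A i \<le> 1"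
proof -
  note c = cells_fmeasurable[OF assms(1)]
  have "measure M (A \<inter> cell Y i) \<le> measure M (cell Y i)"
    using assms(2) c by (intro measure_mono_fmeasurable) auto
  then show ?thesis by (simp add: frac_def divide_le_eq_1 zero_less_measure_iff)
qed

lemma frac_mult:
  assumes "partition_pair X Y" "A \<in> fmeasurable M"
  shows "frac Y A i * measure M (cell Y i) = measure M (A \<inter> cell Y i)"
proof (cases "measure M (cell Y i) = 0")
  case True
  have "measure M (A \<inter> cell Y i) \<le> measure M (cell Y i)"
    using assms(2) cells_fmeasurable[OF assms(1)] by (intro measure_mono_fmeasurable) auto
  then have "measure M (A \<inter> cell Y i) = 0" using True measure_nonneg[of M "A \<inter> cell Y i"] by linarith
  then show ?thesis by (simp add: True)
qed (simp add: frac_def)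

lemma sum_frac:
  assumes XY: "partition_pair X Y" and A: "A \<in> fmeasurable M"
  shows "(\<Sum>i\<in>Pow Y. frac Y A i * measure M (cell Y i)) \<le> measure M A"
proof -
  note c = cells_fmeasurable[OF XY]
  have fin: "finite (Pow Y)" using XY by (simp add: partition_pair_def)
  have Ac: "A \<inter> cell Y i \<in> fmeasurable M" for i using A c by (intro fmeasurable_Int_fmeasurable) auto
  have "(\<Sum>i\<in>Pow Y. frac Y A i * measure M (cell Y i)) = (\<Sum>i\<in>Pow Y. measure M (A \<inter> cell Y i))"
    using frac_mult[OF XY A] by simp
  also have "\<dots> = measure M (\<Union>i\<in>Pow Y. A \<inter> cell Y i)"
  proof (rule measure_finite_Union[OF fin, symmetric])
    show "(\<lambda>i. A \<inter> cell Y i) ` Pow Y \<subseteq> sets M" using Ac by auto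
    show "disjoint_family_on (\<lambda>i. A \<inter> cell Y i) (Pow Y)"
      unfolding disjoint_family_on_def
    proof (intro ballI impI)
      fix i k :: "'a set set" assume "i \<noteq> k"
      then show "A \<inter> cell Y i \<inter> (A \<inter> cell Y k) = {}" using cell_disjoint[of i k Y] by blast
    qed
    show "emeasure M (A \<inter> cell Y i) \<noteq> \<infinity>" for i using Ac[THEN fmeasurableD2] by simp
  qed
  also have "\<dots> \<le> measure M A"
    using A Ac fin by (intro measure_mono_fmeasurable sets.finite_UN) auto
  finally show ?thesis .
qed

text \<open>If \<open>A\<close> is one of the generating sets then every cell lies inside or outside of \<open>A\<close>.\<close>
lemma frac_generator:
  assumes XY: "partition_pair X Y" and A: "A \<in> Y"
  shows "frac Y A i * J W (cell Y i) f = of_bool (A \<in> i) * J W (cell Y i) f"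
proof (cases "measure M (cell Y i) = 0")
  case True
  note c = cells_fmeasurable[OF XY]
  have "emeasure M (cell Y i) = 0" using True c by (simp add: emeasure_eq_measure2)
  then have "cell Y i \<in> null_sets M" using c by auto
  from AE_not_in[OF this] have "AE x in M. indicator (cell Y i) x * W f x = 0" by eventually_elim simp
  then have "J W (cell Y i) f = 0" unfolding J_def by (rule integral_eq_zero_AE)
  then show ?thesis by simp
next
  case False
  show ?thesis
  proof (cases "A \<in> i")
    case True
    then have "A \<inter> cell Y i = cell Y i" by (auto simp: cell_def)
    then show ?thesis using False True by (simp add: frac_def)
  next
    case ni: False
    then have "A \<inter> cell Y i = {}" using A by (auto simp: cell_def)
    then show ?thesis using ni by (simp add: frac_def)
  qed
qed

lemma J_cell_mean:
  assumes XY: "partition_pair X Y" and A: "A \<in> Y" and W: "adm W"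
  shows "(\<Sum>i\<in>Pow Y. \<Sum>j\<in>Pow X. avg N f (cell X j) * frac Y A i * J W (cell Y i) (indicat_real (cell X j)))
     = J W A (cell_mean N X f)"
proof -
  note c = cells_fmeasurable[OF XY]
  have fin: "finite X" "finite Y" "finite (Pow X)" "finite (Pow Y)" and AM: "A \<in> fmeasurable M"
    using XY A by (auto simp: partition_pair_def)
  have "J W A (cell_mean N X f) = (\<Sum>j\<in>Pow X. avg N f (cell X j) * J W A (indicat_real (cell X j)))"
    unfolding cell_mean_def[abs_def] by (intro J_sum W AM fin Dint_indicator c)
  also have "\<dots> = (\<Sum>j\<in>Pow X. \<Sum>i\<in>Pow Y. avg N f (cell X j) * frac Y A i * J W (cell Y i) (indicat_real (cell X j)))"
  proof (intro sum.cong refl)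
    fix j
    have "J W A (indicat_real (cell X j)) = (\<Sum>i\<in>Pow Y. of_bool (A \<in> i) * J W (cell Y i) (indicat_real (cell X j)))"
      by (intro J_set_sum W Dint_indicator c fin indicator_eq_sum_cells A)
    also have "\<dots> = (\<Sum>i\<in>Pow Y. frac Y A i * J W (cell Y i) (indicat_real (cell X j)))"
      by (intro sum.cong refl frac_generator[OF XY A, symmetric])
    finally show "avg N f (cell X j) * J W A (indicat_real (cell X j))
        = (\<Sum>i\<in>Pow Y. avg N f (cell X j) * frac Y A i * J W (cell Y i) (indicat_real (cell X j)))"
      by (simp add: sum_distrib_left mult.assoc)
  qed
  finally show ?thesis by (subst sum.swap) simp
qed

lemma J_T_le_J_v:
  assumes "partition_pair X Y"
  shows "\<bar>J T (cell Y i) (indicat_real (cell X j))\<bar> \<le> J v (cell Y i) (indicat_real (cell X j))"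
proof -
  have "(\<lambda>y. \<bar>indicat_real (cell X j) y\<bar>) = indicat_real (cell X j)" by (auto split: split_indicator)
  then show ?thesis
    using J_dominated[OF admT Dint_indicator[OF cells_fmeasurable(1)[OF assms]] cells_fmeasurable(2)[OF assms],
        of i j] by (simp only:)
qed

lemma form0_lincomb:
  assumes XY: "partition_pair X Y" and f: "f \<in> Dint N" and g: "g \<in> Dint N"
  shows "form0 t X Y (\<lambda>y. a * f y + b * g y) A = a * form0 t X Y f A + b * form0 t X Y g A"
proof -
  have "avg N (\<lambda>y. a * f y + b * g y) (cell X j) = a * avg N f (cell X j) + b * avg N g (cell X j)" for j
    using cells_fmeasurable[OF XY] f g by (intro avg_lincomb) (auto intro: Dint_integrable)
  then have "entry X Y (\<lambda>y. a * f y + b * g y) A i j = a * entry X Y f A i j + b * entry X Y g A i j" for i j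
    by (simp add: entry_def algebra_simps)
  then have "form0 t X Y (\<lambda>y. a * f y + b * g y) A = (\<Sum>i\<in>Pow Y. \<Sum>j\<in>Pow X.
      a * (if orient t X Y i j then entry X Y f A i j else 0) + b * (if orient t X Y i j then entry X Y g A i j else 0))"
    unfolding form0_def by (intro sum.cong) auto
  then show ?thesis by (simp add: form0_def sum.distrib sum_distrib_left)
qed

lemma form0_add_sets:
  assumes XY: "partition_pair X Y" and A: "A \<in> fmeasurable M" "A' \<in> fmeasurable M" "A \<inter> A' = {}"
  shows "form0 t X Y f (A \<union> A') = form0 t X Y f A + form0 t X Y f A'"
proof -
  have "entry X Y f (A \<union> A') i j = entry X Y f A i j + entry X Y f A' i j" for i j
    using frac_add[OF XY A] by (simp add: entry_def algebra_simps)
  then have "form0 t X Y f (A \<union> A') = (\<Sum>i\<in>Pow Y. \<Sum>j\<in>Pow X.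
      (if orient t X Y i j then entry X Y f A i j else 0) + (if orient t X Y i j then entry X Y f A' i j else 0))"
    unfolding form0_def by (intro sum.cong) auto
  then show ?thesis by (simp add: form0_def sum.distrib)
qed

lemma abs_entry_le:
  assumes XY: "partition_pair X Y" and a: "\<bar>avg N f (cell X j)\<bar> \<le> h"
  shows "\<bar>entry X Y f A i j\<bar> \<le> h * frac Y A i * J v (cell Y i) (indicat_real (cell X j))"
proof -
  have "\<bar>entry X Y f A i j\<bar> = \<bar>avg N f (cell X j)\<bar> * frac Y A i * \<bar>J T (cell Y i) (indicat_real (cell X j))\<bar>"
    using frac_nonneg[of Y A i] by (simp add: entry_def abs_mult)
  also have "\<dots> \<le> h * frac Y A i * J v (cell Y i) (indicat_real (cell X j))"
    using a frac_nonneg[of Y A i] by (intro mult_mono mult_right_mono J_T_le_J_v[OF XY]) auto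
  finally show ?thesis .
qed

lemma form0_bound:
  assumes XY: "partition_pair X Y" and t: "0 < t" and f: "f \<in> Dint N" and A: "A \<in> fmeasurable M"
    and h: "0 \<le> h" "AE y in N. \<bar>f y\<bar> \<le> h"
  shows "\<bar>form0 t X Y f A\<bar> \<le> 2 * (\<kappa> * t powr \<theta>) * h * measure M A"
proof -
  note c = cells_fmeasurable[OF XY]
  let ?c = "\<lambda>i j. J v (cell Y i) (indicat_real (cell X j))"
  have a: "\<bar>avg N f (cell X j)\<bar> \<le> h" for j by (rule abs_avg_le[OF Dint_integrable[OF f] c(1) h(2,1)])
  have "\<bar>form0 t X Y f A\<bar> \<le> (\<Sum>i\<in>Pow Y. \<Sum>j\<in>Pow X. \<bar>if orient t X Y i j then entry X Y f A i j else 0\<bar>)"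
    unfolding form0_def by (intro order_trans[OF sum_abs] sum_mono sum_abs)
  also have "\<dots> \<le> (\<Sum>i\<in>Pow Y. \<Sum>j\<in>Pow X. h * frac Y A i * (if orient t X Y i j then ?c i j else 0))"
    using abs_entry_le[OF XY a] by (intro sum_mono) auto
  also have "\<dots> = (\<Sum>i\<in>Pow Y. h * frac Y A i * (\<Sum>j\<in>Pow X. if orient t X Y i j then ?c i j else 0))"
    by (simp add: sum_distrib_left)
  also have "\<dots> \<le> (\<Sum>i\<in>Pow Y. h * frac Y A i * (2 * (\<kappa> * t powr \<theta> * measure M (cell Y i))))"
    using orientation_orient[OF XY t] h frac_nonneg unfolding orientation_def
    by (intro sum_mono mult_left_mono) auto
  also have "\<dots> = 2 * (\<kappa> * t powr \<theta>) * h * (\<Sum>i\<in>Pow Y. frac Y A i * measure M (cell Y i))"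
    by (simp add: sum_distrib_left mult_ac)
  also have "\<dots> \<le> 2 * (\<kappa> * t powr \<theta>) * h * measure M A"
    using sum_frac[OF XY A] \<kappa> h by (intro mult_left_mono) auto
  finally show ?thesis .
qed

text \<open>The difference over disjoint sets pairs the image with a function of values between -1
  and 1, so this is an L^1 bound. The fractions of A and A' add up to at most 1, and the capacities
  of the cells in N sum to the integral of |f|.\<close>

lemma form1_bound:
  assumes XY: "partition_pair X Y" and t: "0 < t" and f: "f \<in> Dint N"
    and A: "A \<in> fmeasurable M" "A' \<in> fmeasurable M" "A \<inter> A' = {}"
  shows "form1 t X Y f A - form1 t X Y f A' \<le> 2 * (\<kappa> * t powr (\<theta> - 1)) * (\<integral>y. \<bar>f y\<bar> \<partial>N)"
proof -
  let ?c = "\<lambda>i j. J v (cell Y i) (indicat_real (cell X j))"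
  let ?a = "\<lambda>j. \<bar>avg N f (cell X j)\<bar>"
  have X: "finite X" "X \<subseteq> fmeasurable N" using XY by (auto simp: partition_pair_def)
  have "form1 t X Y f A - form1 t X Y f A' = (\<Sum>i\<in>Pow Y. \<Sum>j\<in>Pow X.
      (if orient t X Y i j then 0 else entry X Y f A i j) - (if orient t X Y i j then 0 else entry X Y f A' i j))"
    unfolding form1_def by (simp only: sum_subtractf)
  also have "\<dots> \<le> (\<Sum>i\<in>Pow Y. \<Sum>j\<in>Pow X. ?a j * (if orient t X Y i j then 0 else ?c i j))"
  proof (intro sum_mono)
    fix i j
    have "entry X Y f A i j - entry X Y f A' i j \<le> \<bar>entry X Y f A i j\<bar> + \<bar>entry X Y f A' i j\<bar>" by linarith
    also have "\<dots> \<le> ?a j * frac Y A i * ?c i j + ?a j * frac Y A' i * ?c i j"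
      by (intro add_mono abs_entry_le[OF XY]) auto
    also have "\<dots> = frac Y (A \<union> A') i * (?a j * ?c i j)"
      using frac_add[OF XY A] by (simp add: algebra_simps)
    also have "\<dots> \<le> 1 * (?a j * ?c i j)"
      using frac_le_1[OF XY fmeasurable.Un[OF A(1,2)]] J_T_le_J_v[OF XY, of i j]
      by (intro mult_right_mono mult_nonneg_nonneg) (auto intro: order_trans[OF abs_ge_zero])
    finally show "(if orient t X Y i j then 0 else entry X Y f A i j) - (if orient t X Y i j then 0 else entry X Y f A' i j)
        \<le> ?a j * (if orient t X Y i j then 0 else ?c i j)" by auto
  qed
  also have "\<dots> = (\<Sum>j\<in>Pow X. ?a j * (\<Sum>i\<in>Pow Y. if orient t X Y i j then 0 else ?c i j))"
    by (subst sum.swap) (simp add: sum_distrib_left)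
  also have "\<dots> \<le> (\<Sum>j\<in>Pow X. ?a j * (2 * (\<kappa> * t powr (\<theta> - 1) * measure N (cell X j))))"
    using orientation_orient[OF XY t] unfolding orientation_def
    by (intro sum_mono mult_left_mono) auto
  also have "\<dots> = 2 * (\<kappa> * t powr (\<theta> - 1)) * (\<Sum>j\<in>Pow X. ?a j * measure N (cell X j))"
    by (simp add: sum_distrib_left mult_ac)
  also have "\<dots> \<le> 2 * (\<kappa> * t powr (\<theta> - 1)) * (\<integral>y. \<bar>f y\<bar> \<partial>N)"
    using cell_mean_L1(2)[OF X Dint_integrable[OF f]] \<kappa> by (intro mult_left_mono) auto
  finally show ?thesis .
qed

lemma form_total:
  assumes "partition_pair X Y" "A \<in> Y"
  shows "form0 t X Y f A + form1 t X Y f A = J T A (cell_mean N X f)"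
proof -
  have "form0 t X Y f A + form1 t X Y f A = (\<Sum>i\<in>Pow Y. \<Sum>j\<in>Pow X. entry X Y f A i j)"
    unfolding form0_def form1_def sum.distrib[symmetric] by (intro sum.cong) auto
  also have "\<dots> = J T A (cell_mean N X f)"
    unfolding entry_def by (rule J_cell_mean[OF assms admT])
  finally show ?thesis .
qed

text \<open>In the limit this confines the first half to the set where v |f| does not
  vanish.\<close>

lemma form0_dominated:
  assumes XY: "partition_pair X Y" and A: "A \<in> Y" and f: "f \<in> Dint N"
  shows "\<bar>form0 t X Y f A\<bar> \<le> J v A (cell_mean N X (\<lambda>y. \<bar>f y\<bar>))"
proof -
  note c = cells_fmeasurable[OF XY]
  let ?c = "\<lambda>i j. J v (cell Y i) (indicat_real (cell X j))"
  let ?a = "\<lambda>j. avg N (\<lambda>y. \<bar>f y\<bar>) (cell X j)"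
  have "\<bar>form0 t X Y f A\<bar> \<le> (\<Sum>i\<in>Pow Y. \<Sum>j\<in>Pow X. \<bar>if orient t X Y i j then entry X Y f A i j else 0\<bar>)"
    unfolding form0_def by (intro order_trans[OF sum_abs] sum_mono sum_abs)
  also have "\<dots> \<le> (\<Sum>i\<in>Pow Y. \<Sum>j\<in>Pow X. ?a j * frac Y A i * ?c i j)"
  proof (intro sum_mono)
    fix i j
    have "\<bar>avg N f (cell X j)\<bar> \<le> ?a j" by (rule avg_abs)
    from abs_entry_le[OF XY this, of A i] show "\<bar>if orient t X Y i j then entry X Y f A i j else 0\<bar> \<le> ?a j * frac Y A i * ?c i j"
      by (auto intro: order_trans[OF abs_ge_zero])
  qed
  also have "\<dots> = J v A (cell_mean N X (\<lambda>y. \<bar>f y\<bar>))" by (rule J_cell_mean[OF XY A admv])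
  finally show ?thesis .
qed

text \<open>Only the limit of the first half is recorded; that of the second half must be
  \<open>J T A f - L f A\<close>, and the last clause is its L^1 bound.\<close>

definition limit_form :: "real \<Rightarrow> (('b \<Rightarrow> real) \<Rightarrow> 'a set \<Rightarrow> real) \<Rightarrow> bool" where
  "limit_form t L \<longleftrightarrow>
     (\<forall>f\<in>Dint N. \<forall>g\<in>Dint N. \<forall>a b. \<forall>A\<in>fmeasurable M.
        L (\<lambda>y. a * f y + b * g y) A = a * L f A + b * L g A) \<and>
     (\<forall>f\<in>Dint N. \<forall>A\<in>fmeasurable M. \<forall>A'\<in>fmeasurable M. A \<inter> A' = {} \<longrightarrow> L f (A \<union> A') = L f A + L f A') \<and>
     (\<forall>f\<in>Dint N. \<forall>A\<in>fmeasurable M. \<forall>h\<ge>0. (AE y in N. \<bar>f y\<bar> \<le> h) \<longrightarrow> \<bar>L f A\<bar> \<le> 2 * (\<kappa> * t powr \<theta>) * h * measure M A) \<and>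
     (\<forall>f\<in>Dint N. \<forall>A\<in>fmeasurable M. \<bar>L f A\<bar> \<le> J v A (\<lambda>y. \<bar>f y\<bar>)) \<and>
     (\<forall>f\<in>Dint N. \<forall>A\<in>fmeasurable M. \<forall>A'\<in>fmeasurable M. A \<inter> A' = {} \<longrightarrow>
        (J T A f - L f A) - (J T A' f - L f A') \<le> 2 * (\<kappa> * t powr (\<theta> - 1)) * (\<integral>y. \<bar>f y\<bar> \<partial>N))"

lemma limit_form_exists:
  assumes t: "0 < t"
  shows "\<exists>L. limit_form t L"
proof -
  \<comment> \<open>Extension by 0 gives a bound valid for all indices and all arguments, as the
    compactness lemma demands.\<close>
  define B where "B = (\<lambda>(X, Y) (f, A). if partition_pair X Y \<and> f \<in> Dint N \<and> A \<in> fmeasurable M then form0 t X Y f A else 0)"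
  define c where "c = (\<lambda>(f, A). 2 * (\<kappa> * t powr \<theta>) * enn2real (Linf_norm N f) * measure M A)"
  let ?G = "finite_subsets_at_top (fmeasurable N)" and ?H = "finite_subsets_at_top (fmeasurable M)"
  let ?F = "?G \<times>\<^sub>F ?H"
  have "\<bar>B p z\<bar> \<le> c z" for p z
  proof -
    obtain X Y f A where pz: "p = (X, Y)" "z = (f, A)" by (metis surj_pair)
    have "AE y in N. \<bar>f y\<bar> \<le> enn2real (Linf_norm N f)" if "f \<in> Dint N"
    proof (subst Linf_norm_le_iff[symmetric])
      show "Linf_norm N f \<le> ennreal (enn2real (Linf_norm N f))" using that by (simp add: Dint_def)
    qed simp
    then show ?thesis unfolding pz B_def c_def using form0_bound[OF _ t] \<kappa> by auto
  qed
  moreover have "?F \<noteq> bot" by (simp add: prod_filter_eq_bot)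
  ultimately obtain F' L where F': "F' \<noteq> bot" "F' \<le> ?F" and lim: "\<And>z. ((\<lambda>p. B p z) \<longlongrightarrow> L z) F'"
    using bounded_net_has_convergent_subfilter[of ?F B c] by blast
  have evX: "eventually (\<lambda>X. finite X \<and> X \<subseteq> fmeasurable N) ?G"
    unfolding eventually_finite_subsets_at_top by (intro exI[of _ "{}"]) auto
  have evY: "eventually (\<lambda>Y. finite Y \<and> Y \<subseteq> fmeasurable M \<and> A \<in> Y) ?H" if "A \<in> fmeasurable M" for A
    unfolding eventually_finite_subsets_at_top using that by (intro exI[of _ "{A}"]) auto
  have ev: "eventually (\<lambda>(X, Y). partition_pair X Y \<and> A \<in> Y) F'" if "A \<in> fmeasurable M" for A
  proof -
    have "eventually (\<lambda>p. (finite (fst p) \<and> fst p \<subseteq> fmeasurable N) \<and> (finite (snd p) \<and> snd p \<subseteq> fmeasurable M \<and> A \<in> snd p)) ?F"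
      unfolding eventually_prod_filter using evX evY[OF that]
      by (intro exI conjI) (assumption, assumption, auto)
    then have "eventually (\<lambda>(X, Y). partition_pair X Y \<and> A \<in> Y) ?F"
      by (rule eventually_mono) (auto simp: partition_pair_def)
    then show ?thesis using F'(2) by (rule filter_leD[rotated])
  qed
  have lim0: "((\<lambda>p. form0 t (fst p) (snd p) f A) \<longlongrightarrow> L (f, A)) F'" if "f \<in> Dint N" "A \<in> fmeasurable M" for f A
    using lim[of "(f, A)"]
  proof (rule Lim_transform_eventually)
    show "eventually (\<lambda>p. B p (f, A) = form0 t (fst p) (snd p) f A) F'"
      using ev[OF that(2)] by eventually_elim (use that in \<open>auto simp: B_def\<close>)
  qed
  have limJ: "((\<lambda>p. J W A (cell_mean N (fst p) f)) \<longlongrightarrow> J W A f) F'"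
    if "adm W" "f \<in> Dint N" "A \<in> fmeasurable M" for W f A
  proof -
    have "filterlim fst ?G F'" using F'(2) filterlim_fst filterlim_mono by blast
    then show ?thesis by (rule filterlim_compose[OF J_cell_mean_tendsto[OF that]])
  qed
  \<comment> \<open>The second half needs no compactness of its own: once A belongs to Y, both
    halves add up to \<open>J T\<close> at the cell mean, which converges.\<close>
  have lim1: "((\<lambda>p. form1 t (fst p) (snd p) f A) \<longlongrightarrow> J T A f - L (f, A)) F'"
    if fA: "f \<in> Dint N" "A \<in> fmeasurable M" for f A
    using tendsto_diff[OF limJ[OF admT fA] lim0[OF fA]]
  proof (rule Lim_transform_eventually)
    show "eventually (\<lambda>p. J T A (cell_mean N (fst p) f) - form0 t (fst p) (snd p) f A = form1 t (fst p) (snd p) f A) F'"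
      using ev[OF fA(2)]
    proof eventually_elim
      case (elim p)
      then show ?case using form_total[of "fst p" "snd p" A t f] by (simp add: case_prod_beta)
    qed
  qed
  show ?thesis
    unfolding limit_form_def
  proof (intro exI[of _ "\<lambda>f A. L (f, A)"] conjI ballI allI impI)
    fix f A assume f: "f \<in> Dint N" and A: "A \<in> fmeasurable M"
    show "L (\<lambda>y. a * f y + b * g y, A) = a * L (f, A) + b * L (g, A)" if g: "g \<in> Dint N" for g a b
    proof (rule tendsto_unique[OF F'(1) lim0[OF Dint_lincomb[OF f g] A]])
      have "((\<lambda>p. a * form0 t (fst p) (snd p) f A + b * form0 t (fst p) (snd p) g A) \<longlongrightarrow> a * L (f, A) + b * L (g, A)) F'"
        by (intro tendsto_intros lim0 f g A)
      then show "((\<lambda>p. form0 t (fst p) (snd p) (\<lambda>y. a * f y + b * g y) A) \<longlongrightarrow> a * L (f, A) + b * L (g, A)) F'"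
      proof (rule Lim_transform_eventually)
        show "eventually (\<lambda>p. a * form0 t (fst p) (snd p) f A + b * form0 t (fst p) (snd p) g A
            = form0 t (fst p) (snd p) (\<lambda>y. a * f y + b * g y) A) F'"
          using ev[OF A] by eventually_elim (auto simp: form0_lincomb f g)
      qed
    qed
    show "L (f, A \<union> A') = L (f, A) + L (f, A')" if A': "A' \<in> fmeasurable M" "A \<inter> A' = {}" for A'
    proof (rule tendsto_unique[OF F'(1) lim0[OF f fmeasurable.Un[OF A A'(1)]]])
      have "((\<lambda>p. form0 t (fst p) (snd p) f A + form0 t (fst p) (snd p) f A') \<longlongrightarrow> L (f, A) + L (f, A')) F'"
        by (intro tendsto_intros lim0 f A A')
      then show "((\<lambda>p. form0 t (fst p) (snd p) f (A \<union> A')) \<longlongrightarrow> L (f, A) + L (f, A')) F'"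
      proof (rule Lim_transform_eventually)
        show "eventually (\<lambda>p. form0 t (fst p) (snd p) f A + form0 t (fst p) (snd p) f A' = form0 t (fst p) (snd p) f (A \<union> A')) F'"
          using ev[OF A] by eventually_elim (auto simp: form0_add_sets A A')
      qed
    qed
    show "\<bar>L (f, A)\<bar> \<le> 2 * (\<kappa> * t powr \<theta>) * h * measure M A" if h: "0 \<le> h" "AE y in N. \<bar>f y\<bar> \<le> h" for h
    proof (rule tendsto_upperbound[OF tendsto_rabs[OF lim0[OF f A]] _ F'(1)])
      show "eventually (\<lambda>p. \<bar>form0 t (fst p) (snd p) f A\<bar> \<le> 2 * (\<kappa> * t powr \<theta>) * h * measure M A) F'"
        using ev[OF A] by eventually_elim (use form0_bound[OF _ t f A h] in auto)
    qed
    show "\<bar>L (f, A)\<bar> \<le> J v A (\<lambda>y. \<bar>f y\<bar>)"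
    proof (rule tendsto_le[OF F'(1) limJ[OF admv Dint_abs[OF f] A] tendsto_rabs[OF lim0[OF f A]]])
      show "eventually (\<lambda>p. \<bar>form0 t (fst p) (snd p) f A\<bar> \<le> J v A (cell_mean N (fst p) (\<lambda>y. \<bar>f y\<bar>))) F'"
        using ev[OF A] by eventually_elim (use form0_dominated[OF _ _ f] in auto)
    qed
    show "(J T A f - L (f, A)) - (J T A' f - L (f, A')) \<le> 2 * (\<kappa> * t powr (\<theta> - 1)) * (\<integral>y. \<bar>f y\<bar> \<partial>N)"
      if A': "A' \<in> fmeasurable M" "A \<inter> A' = {}" for A'
    proof (rule tendsto_upperbound[OF tendsto_diff[OF lim1[OF f A] lim1[OF f A'(1)]] _ F'(1)])
      show "eventually (\<lambda>p. form1 t (fst p) (snd p) f A - form1 t (fst p) (snd p) f A'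
          \<le> 2 * (\<kappa> * t powr (\<theta> - 1)) * (\<integral>y. \<bar>f y\<bar> \<partial>N)) F'"
        using ev[OF A] by eventually_elim (use form1_bound[OF _ t f A A'] in auto)
    qed
  qed
qed

end


section \<open>Reconstruction of the two operators from the limit form\<close>

lemma SsumI:
  assumes "g0 \<in> borel_measurable M" "g1 \<in> borel_measurable M" "Linf_norm M g0 < top" "L1_norm M g1 < top"
  shows "(\<lambda>x. g0 x + g1 x) \<in> Ssum M"
proof -
  have "\<exists>f h. f \<in> borel_measurable M \<and> h \<in> borel_measurable M \<and> Linf_norm M f < top \<and> L1_norm M h < top \<and>
      (AE x in M. g0 x + g1 x = f x + h x)"
    by (rule exI[of _ g0], rule exI[of _ g1]) (simp add: assms)
  then show ?thesis unfolding Ssum_def using assms(1,2) by simp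
qed

context dominated_operator
begin

text \<open>Sets of finite measure exhausting the set where v |f| does not vanish; T f and the
  density of the limit form vanish a.e. outside their union.\<close>

definition level :: "('b \<Rightarrow> real) \<Rightarrow> nat \<Rightarrow> 'a set" where
  "level f n = {x \<in> space M. 1 / Suc n < \<bar>v (\<lambda>y. \<bar>f y\<bar>) x\<bar>}"

lemma level_fmeasurable: "f \<in> Dint N \<Longrightarrow> level f n \<in> fmeasurable M"
  unfolding level_def by (intro v_level Dint_abs) auto

lemma not_in_level: "x \<in> space M \<Longrightarrow> x \<notin> (\<Union>n. level f n) \<Longrightarrow> v (\<lambda>y. \<bar>f y\<bar>) x = 0"
proof (rule ccontr)
  assume x: "x \<in> space M" "x \<notin> (\<Union>n. level f n)" and "v (\<lambda>y. \<bar>f y\<bar>) x \<noteq> 0"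
  then obtain n where "inverse (real (Suc n)) < \<bar>v (\<lambda>y. \<bar>f y\<bar>) x\<bar>"
    using reals_Archimedean[of "\<bar>v (\<lambda>y. \<bar>f y\<bar>) x\<bar>"] by auto
  then have "x \<in> level f n" using x by (simp add: level_def inverse_eq_divide)
  then show False using x by blast
qed

lemma level_mono: "m \<le> n \<Longrightarrow> level f m \<subseteq> level f n"
proof -
  assume "m \<le> n"
  then have "1 / real (Suc n) \<le> 1 / real (Suc m)" by (intro divide_left_mono) auto
  then show ?thesis unfolding level_def by auto
qed

lemma Linf_norm_Dint:
  assumes "f \<in> Dint N"
  shows "Linf_norm N f = ennreal (enn2real (Linf_norm N f))" "AE y in N. \<bar>f y\<bar> \<le> enn2real (Linf_norm N f)"
proof -
  show *: "Linf_norm N f = ennreal (enn2real (Linf_norm N f))" using assms by (simp add: Dint_def)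
  show "AE y in N. \<bar>f y\<bar> \<le> enn2real (Linf_norm N f)"
    by (subst Linf_norm_le_iff[symmetric]) (use * in auto)
qed

lemma operator_split:
  assumes t: "0 < t"
  shows "\<exists>T0 T1. amb_op N M T0 \<and> amb_op N M T1 \<and> (\<forall>f\<in>Dint N. AE x in M. T f x = T0 f x + T1 f x) \<and>
     B0_norm N M T0 \<le> ennreal (2 * (\<kappa> * t powr \<theta>)) \<and> B1_norm N M T1 \<le> ennreal (2 * (\<kappa> * t powr (\<theta> - 1)))"
proof -
  obtain L where L: "limit_form t L" using limit_form_exists[OF t] by blast
  have L_lin: "\<And>f g a b A. f \<in> Dint N \<Longrightarrow> g \<in> Dint N \<Longrightarrow> A \<in> fmeasurable M \<Longrightarrow>
        L (\<lambda>y. a * f y + b * g y) A = a * L f A + b * L g A"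
    and L_add: "\<And>f A A'. f \<in> Dint N \<Longrightarrow> A \<in> fmeasurable M \<Longrightarrow> A' \<in> fmeasurable M \<Longrightarrow> A \<inter> A' = {} \<Longrightarrow> L f (A \<union> A') = L f A + L f A'"
    and L_bound: "\<And>f A h. f \<in> Dint N \<Longrightarrow> A \<in> fmeasurable M \<Longrightarrow> 0 \<le> h \<Longrightarrow> AE y in N. \<bar>f y\<bar> \<le> h \<Longrightarrow>
        \<bar>L f A\<bar> \<le> 2 * (\<kappa> * t powr \<theta>) * h * measure M A"
    and L_dom: "\<And>f A. f \<in> Dint N \<Longrightarrow> A \<in> fmeasurable M \<Longrightarrow> \<bar>L f A\<bar> \<le> J v A (\<lambda>y. \<bar>f y\<bar>)"
    and L_rest: "\<And>f A A'. f \<in> Dint N \<Longrightarrow> A \<in> fmeasurable M \<Longrightarrow> A' \<in> fmeasurable M \<Longrightarrow> A \<inter> A' = {} \<Longrightarrow>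
        (J T A f - L f A) - (J T A' f - L f A') \<le> 2 * (\<kappa> * t powr (\<theta> - 1)) * (\<integral>y. \<bar>f y\<bar> \<partial>N)"
    using L unfolding limit_form_def by auto
  define hf where "hf f = enn2real (Linf_norm N f)" for f
  define c where "c f = 2 * (\<kappa> * t powr \<theta>) * hf f" for f
  have c0: "0 \<le> c f" for f using \<kappa> by (simp add: c_def hf_def)
  define density where "density f g \<longleftrightarrow> g \<in> borel_measurable M \<and> (\<forall>x. \<bar>g x\<bar> \<le> c f) \<and>
     (\<forall>x. x \<notin> (\<Union>n. level f n) \<longrightarrow> g x = 0) \<and>
     (\<forall>A\<in>fmeasurable M. L f A = (\<integral>x. indicator A x * g x \<partial>M))" for f g
  have "\<exists>g. density f g" if f: "f \<in> Dint N" for f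
  proof -
    have lc: "lipschitz_content M (c f) (L f)"
      unfolding lipschitz_content_def c_def hf_def
      using L_add[OF f] L_bound[OF f _ _ Linf_norm_Dint(2)[OF f]] by auto
    \<comment> \<open>Domination by \<open>J v\<close> annihilates the limit form on sets disjoint
      from all levels.\<close>
    have zero: "L f A = 0" if A: "A \<in> fmeasurable M" "A \<inter> (\<Union>n. level f n) = {}" for A
    proof -
      have "indicator A x * v (\<lambda>y. \<bar>f y\<bar>) x = 0" for x
        using not_in_level[of x f] A sets.sets_into_space[OF fmeasurableD[OF A(1)]]
        by (auto split: split_indicator)
      then have "J v A (\<lambda>y. \<bar>f y\<bar>) = 0" unfolding J_def by (intro integral_eq_zero_AE AE_I2)
      then show ?thesis using L_dom[OF f A(1)] by simp
    qed
    show ?thesis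
      using lipschitz_content_density[OF lc c0 level_fmeasurable[OF f] zero]
      unfolding density_def Bex_def .
  qed
  then obtain T0 where d: "\<And>f. f \<in> Dint N \<Longrightarrow> density f (T0 f)" by metis
  have T0: "\<And>f. f \<in> Dint N \<Longrightarrow> T0 f \<in> borel_measurable M"
      "\<And>f x. f \<in> Dint N \<Longrightarrow> \<bar>T0 f x\<bar> \<le> c f"
      "\<And>f x. f \<in> Dint N \<Longrightarrow> x \<notin> (\<Union>n. level f n) \<Longrightarrow> T0 f x = 0"
      "\<And>f A. f \<in> Dint N \<Longrightarrow> A \<in> fmeasurable M \<Longrightarrow> L f A = (\<integral>x. indicator A x * T0 f x \<partial>M)"
    using d by (simp_all add: density_def)
  have int0: "integrable M (\<lambda>x. indicator A x * T0 f x)" if "f \<in> Dint N" "A \<in> fmeasurable M" for f A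
    using T0(1,2)[OF that(1)] that(2) by (intro integrable_indicator_bounded)
  \<comment> \<open>All three densities vanish outside countably many sets of finite measure, so
    their integrals determine them a.e. The three-term form covers linearity and, with b = 0, the
    dependence on a.e. classes only.\<close>
  have uniq: "AE x in M. T0 f x = a * T0 g x + b * T0 h x"
    if f: "f \<in> Dint N" and g: "g \<in> Dint N" and h: "h \<in> Dint N"
      and eq: "\<And>A. A \<in> fmeasurable M \<Longrightarrow> L f A = a * L g A + b * L h A" for f g h a b
  proof -
    have "AE x in M. T0 f x - (a * T0 g x + b * T0 h x) = 0"
    proof (rule AE_zero_if_integrals_zero)
      show "(\<lambda>x. T0 f x - (a * T0 g x + b * T0 h x)) \<in> borel_measurable M"
        using T0(1)[OF f] T0(1)[OF g] T0(1)[OF h] by measurable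
      show "level f n \<union> level g n \<union> level h n \<in> fmeasurable M" for n
        using level_fmeasurable f g h by (intro fmeasurable.Un)
      show "AE x in M. x \<notin> (\<Union>n. level f n \<union> level g n \<union> level h n) \<longrightarrow> T0 f x - (a * T0 g x + b * T0 h x) = 0"
        using T0(3)[OF f] T0(3)[OF g] T0(3)[OF h] by (intro AE_I2) auto
      fix A assume A: "A \<in> fmeasurable M"
      have e: "indicator A x * (T0 f x - (a * T0 g x + b * T0 h x))
          = indicator A x * T0 f x - (a * (indicator A x * T0 g x) + b * (indicator A x * T0 h x))" for x
        by (simp add: algebra_simps)
      show "integrable M (\<lambda>x. indicator A x * (T0 f x - (a * T0 g x + b * T0 h x)))"
        unfolding e using int0[OF f A] int0[OF g A] int0[OF h A] by auto
      have "(\<integral>x. indicator A x * (T0 f x - (a * T0 g x + b * T0 h x)) \<partial>M) = L f A - (a * L g A + b * L h A)"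
        unfolding e T0(4)[OF f A] T0(4)[OF g A] T0(4)[OF h A]
        using int0[OF f A] int0[OF g A] int0[OF h A] by simp
      then show "(\<integral>x. indicator A x * (T0 f x - (a * T0 g x + b * T0 h x)) \<partial>M) = 0" using eq[OF A] by simp
    qed
    then show ?thesis by eventually_elim simp
  qed
  have lin0: "lin_op_on N M (Dint N) T0"
    unfolding lin_op_on_def
  proof (intro conjI ballI allI impI T0(1))
    fix f g assume f: "f \<in> Dint N" and g: "g \<in> Dint N"
    show "AE x in M. T0 (\<lambda>y. a * f y + b * g y) x = a * T0 f x + b * T0 g x" for a b
      using f g L_lin[OF f g] by (intro uniq Dint_lincomb)
    assume fg: "AE y in N. f y = g y"
    \<comment> \<open>The difference of f and g is bounded by h = 0, so the L^infinity estimate of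
      the limit form annihilates it.\<close>
    have "L f A = 1 * L g A + 0 * L g A" if A: "A \<in> fmeasurable M" for A
    proof -
      have "L (\<lambda>y. 1 * f y + (-1) * g y) A = L f A - L g A" using L_lin[OF f g A, of 1 "-1"] by simp
      moreover have "\<bar>L (\<lambda>y. 1 * f y + (-1) * g y) A\<bar> \<le> 2 * (\<kappa> * t powr \<theta>) * 0 * measure M A"
        using fg by (intro L_bound Dint_lincomb f g A) auto
      ultimately show ?thesis by simp
    qed
    from uniq[OF f g g this] show "AE x in M. T0 f x = T0 g x" by simp
  qed
  \<comment> \<open>With this definition T = T0 + T1 holds exactly and T1 inherits
    linearity.\<close>
  define T1 where "T1 = (\<lambda>f x. T f x + (-1) * T0 f x)"
  have lin1: "lin_op_on N M (Dint N) T1" unfolding T1_def by (rule lin_op_on_lincomb_op[OF linT lin0])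
  have T1_bound: "L1_norm M (T1 f) \<le> ennreal (2 * (\<kappa> * t powr (\<theta> - 1))) * L1_norm N f" if f: "f \<in> Dint N" for f
  proof -
    have T1m[measurable]: "T1 f \<in> borel_measurable M" by (rule lin_op_on_measurable[OF lin1 f])
    let ?W = "level f"
    have W: "?W n \<in> fmeasurable M" for n by (rule level_fmeasurable[OF f])
    then have [measurable]: "?W n \<in> sets M" for n by auto
    let ?b = "2 * (\<kappa> * t powr (\<theta> - 1)) * (\<integral>y. \<bar>f y\<bar> \<partial>N)"
    have iT1: "integrable M (\<lambda>x. indicator A x * T1 f x)" and JT1: "(\<integral>x. indicator A x * T1 f x \<partial>M) = J T A f - L f A"
      if A: "A \<in> fmeasurable M" for A
    proof -
      have e: "indicator A x * T1 f x = indicator A x * T f x - indicator A x * T0 f x" for x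
        by (simp add: T1_def algebra_simps)
      note i = adm_integrable[OF admT f A] int0[OF f A]
      show "integrable M (\<lambda>x. indicator A x * T1 f x)" unfolding e using i by simp
      show "(\<integral>x. indicator A x * T1 f x \<partial>M) = J T A f - L f A"
        unfolding e J_def T0(4)[OF f A] using i by simp
    qed
    have part: "(\<integral>\<^sup>+x. ennreal \<bar>T1 f x\<bar> * indicator (?W n) x \<partial>M) \<le> ennreal ?b" for n
    proof -
      \<comment> \<open>On the sets where T1 f has a fixed sign, the clause about disjoint sets is
        exactly the integral of |T1 f| over the level.\<close>
      define A where "A = ?W n \<inter> {x \<in> space M. 0 \<le> T1 f x}"
      define A' where "A' = ?W n \<inter> {x \<in> space M. T1 f x < 0}"
      have A: "A \<in> fmeasurable M" "A' \<in> fmeasurable M" "A \<inter> A' = {}"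
        unfolding A_def A'_def by (auto intro!: fmeasurable_Int_fmeasurable W)
      have eq: "indicator (?W n) x * \<bar>T1 f x\<bar> = indicator A x * T1 f x - indicator A' x * T1 f x" if "x \<in> space M" for x
        using that by (auto simp: A_def A'_def split: split_indicator)
      have "(\<integral>\<^sup>+x. ennreal \<bar>T1 f x\<bar> * indicator (?W n) x \<partial>M) = (\<integral>\<^sup>+x. ennreal (indicator A x * T1 f x - indicator A' x * T1 f x) \<partial>M)"
        by (intro nn_integral_cong, subst eq[symmetric]) (auto split: split_indicator)
      also have "\<dots> = ennreal (\<integral>x. indicator A x * T1 f x - indicator A' x * T1 f x \<partial>M)"
      proof (rule nn_integral_eq_integral)
        show "integrable M (\<lambda>x. indicator A x * T1 f x - indicator A' x * T1 f x)" using iT1 A by auto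
        show "AE x in M. 0 \<le> indicator A x * T1 f x - indicator A' x * T1 f x"
          using AE_space by eventually_elim (subst eq[symmetric], auto)
      qed
      also have "(\<integral>x. indicator A x * T1 f x - indicator A' x * T1 f x \<partial>M) = (J T A f - L f A) - (J T A' f - L f A')"
        using iT1 A JT1 by simp
      also have "ennreal \<dots> \<le> ennreal ?b" by (intro ennreal_leI L_rest f A)
      finally show ?thesis .
    qed
    \<comment> \<open>T1 f vanishes a.e. outside the levels, so monotone convergence along them
      recovers its full L^1 norm.\<close>
    have "AE x in M. ennreal \<bar>T1 f x\<bar> = (SUP n. ennreal \<bar>T1 f x\<bar> * indicator (?W n) x)"
      using dom[OF f] AE_space
    proof eventually_elim
      case (elim x)
      show ?case
      proof (cases "x \<in> (\<Union>n. ?W n)")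
        case True
        then obtain n where n: "x \<in> ?W n" by blast
        show ?thesis
        proof (rule antisym)
          show "ennreal \<bar>T1 f x\<bar> \<le> (SUP n. ennreal \<bar>T1 f x\<bar> * indicator (?W n) x)"
            using n by (intro SUP_upper2[of n]) auto
          show "(SUP n. ennreal \<bar>T1 f x\<bar> * indicator (?W n) x) \<le> ennreal \<bar>T1 f x\<bar>"
            by (intro SUP_least) (auto split: split_indicator)
        qed
      next
        case False
        then have "T f x = 0" "T0 f x = 0" using elim not_in_level[of x f] T0(3)[OF f] by auto
        then show ?thesis by (simp add: T1_def)
      qed
    qed
    then have "L1_norm M (T1 f) = (\<integral>\<^sup>+x. (SUP n. ennreal \<bar>T1 f x\<bar> * indicator (?W n) x) \<partial>M)"
      unfolding L1_norm_def by (rule nn_integral_cong_AE)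
    also have "\<dots> = (SUP n. \<integral>\<^sup>+x. ennreal \<bar>T1 f x\<bar> * indicator (?W n) x \<partial>M)"
    proof (rule nn_integral_monotone_convergence_SUP)
      show "incseq (\<lambda>n x. ennreal \<bar>T1 f x\<bar> * indicator (?W n) x)"
        using level_mono[of _ _ f] by (auto simp: incseq_def le_fun_def split: split_indicator)
    qed measurable
    also have "\<dots> \<le> ennreal ?b" by (intro SUP_least part)
    also have "\<dots> = ennreal (2 * (\<kappa> * t powr (\<theta> - 1))) * L1_norm N f"
    proof -
      have "L1_norm N f = ennreal (\<integral>y. \<bar>f y\<bar> \<partial>N)"
        unfolding L1_norm_def using Dint_integrable[OF f] by (intro nn_integral_eq_integral) auto
      then show ?thesis using \<kappa> by (simp add: ennreal_mult)
    qed
    finally show ?thesis .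
  qed
  have T0_bound: "Linf_norm M (T0 f) \<le> ennreal (2 * (\<kappa> * t powr \<theta>)) * Linf_norm N f" if f: "f \<in> Dint N" for f
  proof -
    have "Linf_norm M (T0 f) \<le> ennreal (c f)"
      using T0(2)[OF f] by (intro Linf_norm_le AE_I2 ennreal_leI)
    also have "\<dots> = ennreal (2 * (\<kappa> * t powr \<theta>)) * ennreal (hf f)"
      using \<kappa> unfolding c_def hf_def by (intro ennreal_mult) auto
    also have "ennreal (hf f) = Linf_norm N f" using Linf_norm_Dint(1)[OF f] by (simp add: hf_def)
    finally show ?thesis .
  qed
  have z: "Linf_norm M (\<lambda>x. 0) < top" "L1_norm M (\<lambda>x. 0) < top"
    using Linf_norm_le[of "\<lambda>x. 0" 0 M] by (auto simp: L1_norm_def)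
  have "T0 f \<in> Ssum M" if f: "f \<in> Dint N" for f
  proof -
    have "Linf_norm M (T0 f) < top"
      by (rule le_less_trans[OF T0_bound[OF f]]) (use f in \<open>auto simp: Dint_def ennreal_mult_less_top\<close>)
    with SsumI[OF T0(1)[OF f] borel_measurable_const[of 0] _ z(2)] show ?thesis by simp
  qed
  then have amb0: "amb_op N M T0" using lin0 by (simp add: amb_op_def)
  have "T1 f \<in> Ssum M" if f: "f \<in> Dint N" for f
  proof -
    have "L1_norm M (T1 f) < top"
      by (rule le_less_trans[OF T1_bound[OF f]]) (use f in \<open>auto simp: Dint_def ennreal_mult_less_top\<close>)
    with SsumI[OF borel_measurable_const[of 0] lin_op_on_measurable[OF lin1 f] z(1)] show ?thesis by simp
  qed
  then have amb1: "amb_op N M T1" using lin1 by (simp add: amb_op_def)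
  show ?thesis
  proof (rule exI[of _ T0], rule exI[of _ T1], intro conjI ballI amb0 amb1)
    show "AE x in M. T f x = T0 f x + T1 f x" for f by (simp add: T1_def)
    show "B0_norm N M T0 \<le> ennreal (2 * (\<kappa> * t powr \<theta>))"
      unfolding B0_norm_def using T0_bound by (intro Inf_lower) auto
    show "B1_norm N M T1 \<le> ennreal (2 * (\<kappa> * t powr (\<theta> - 1)))"
      unfolding B1_norm_def using T1_bound by (intro Inf_lower) auto
  qed
qed

text \<open>Both summands of the K-functional are at most 2\<kappa> t^\<theta>, one for each half of
  the splitting.\<close>

lemma interp_norm_le: "interp_norm N M \<theta> T \<le> ennreal (4 * \<kappa>)"
  unfolding interp_norm_def
proof (rule SUP_least)
  fix t :: real assume "t \<in> {0<..}"
  then have t: "0 < t" by simp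
  obtain T0 T1 where sp: "amb_op N M T0" "amb_op N M T1" "\<forall>f\<in>Dint N. AE x in M. T f x = T0 f x + T1 f x"
     "B0_norm N M T0 \<le> ennreal (2 * (\<kappa> * t powr \<theta>))" "B1_norm N M T1 \<le> ennreal (2 * (\<kappa> * t powr (\<theta> - 1)))"
    using operator_split[OF t] by blast
  have "Kfun N M t T \<le> B0_norm N M T0 + ennreal t * B1_norm N M T1"
    unfolding Kfun_def using sp(1,2,3) by (intro Inf_lower) blast
  also have "\<dots> \<le> ennreal (2 * (\<kappa> * t powr \<theta>)) + ennreal t * ennreal (2 * (\<kappa> * t powr (\<theta> - 1)))"
    using sp(4,5) by (intro add_mono mult_left_mono) auto
  also have "\<dots> = ennreal (4 * \<kappa> * t powr \<theta>)"
    using t \<kappa> by (simp add: ennreal_mult[symmetric] ennreal_plus[symmetric] powr_diff del: ennreal_plus)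
  finally have "ennreal (t powr (- \<theta>)) * Kfun N M t T \<le> ennreal (t powr (- \<theta>)) * ennreal (4 * \<kappa> * t powr \<theta>)"
    by (rule mult_left_mono) simp
  also have "\<dots> = ennreal (t powr (- \<theta>) * (4 * \<kappa> * t powr \<theta>))"
    using \<kappa> by (intro ennreal_mult[symmetric]) auto
  also have "t powr (- \<theta>) * (4 * \<kappa> * t powr \<theta>) = 4 * \<kappa>"
    using t by (simp add: powr_minus field_simps)
  finally show "ennreal (t powr (- \<theta>)) * Kfun N M t T \<le> ennreal (4 * \<kappa>)" .
qed

end

section \<open>Assembly of the two norm inequalities\<close>

lemma lin_op_on_subset: "lin_op_on N M S T \<Longrightarrow> S' \<subseteq> S \<Longrightarrow> lin_op_on N M S' T"
  unfolding lin_op_on_def by (meson subsetD)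

lemma interp_norm_le_Br:
  assumes th: "0 < \<theta>" "\<theta> < 1" and amb: "amb_op N M T"
    and k: "0 < k" "Br_norm N M (1/\<theta>) T < ennreal k"
  shows "interp_norm N M \<theta> T \<le> ennreal (4 * (C_weak \<theta> * C_hoelder \<theta>) * k)"
proof -
  obtain u where u: "lor_bdd_op N M (1/\<theta>) u" "\<forall>f\<in>Dint N. AE x in M. u f x = T f x"
      "regular_norm N M (1/\<theta>) u < ennreal k"
    using k(2) unfolding Br_norm_def Inf_less_iff by blast
  obtain v where v: "lor_bdd_op N M (1/\<theta>) v" "positive_op N M (Lp1 N (1/\<theta>)) v"
      "\<forall>f\<in>Lp1 N (1/\<theta>). AE x in M. \<bar>u f x\<bar> \<le> v (\<lambda>y. \<bar>f y\<bar>) x" "lor_opnorm N M (1/\<theta>) v < ennreal k"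
    using u(3) unfolding regular_norm_def Inf_less_iff by blast
  obtain C where C: "C < ennreal k" "\<forall>f\<in>Lp1 N (1/\<theta>). lorentz_inf_norm M (1/\<theta>) (v f) \<le> C * lorentz_1_norm N (1/\<theta>) f"
    using v(4) unfolding lor_opnorm_def Inf_less_iff by blast
  note sub = Dint_subset_Lp1[OF th, of N]
  \<comment> \<open>\<open>C_hoelder\<close> estimates the norm of the input, \<open>k\<close>
    bounds the norm of v, and \<open>C_weak\<close> passes from the weak norm of the output to
    integrals.\<close>
  define \<kappa> where "\<kappa> = C_weak \<theta> * C_hoelder \<theta> * k"
  have \<kappa>: "0 < \<kappa>" using C_weak_pos[OF th] C_hoelder_pos[OF th] k by (simp add: \<kappa>_def)
  have linv: "lin_op_on N M (Dint N) v"
    using v(1) sub by (auto simp: lor_bdd_op_def intro: lin_op_on_subset)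
  have weak: "weak_bound M \<theta> (k * (C_hoelder \<theta> * (h powr (1 - \<theta>) * k' powr \<theta>))) (v f)"
    if f: "f \<in> Dint N" and h: "0 < h" "AE y in N. \<bar>f y\<bar> \<le> h" and k': "0 < k'" "(\<integral>y. \<bar>f y\<bar> \<partial>N) \<le> k'" for f h k'
  proof (rule lorentz_inf_imp_weak_bound[OF th])
    show "0 \<le> k * (C_hoelder \<theta> * (h powr (1 - \<theta>) * k' powr \<theta>))" using k C_hoelder_pos[OF th] by simp
    show "v f \<in> borel_measurable M" by (rule lin_op_on_measurable[OF linv f])
    have "(\<integral>\<^sup>+y. ennreal \<bar>f y\<bar> \<partial>N) \<le> ennreal k'"
      using Dint_integrable[OF f] k' by (subst nn_integral_eq_integral) (auto intro: ennreal_leI)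
    then have n1: "lorentz_1_norm N (1/\<theta>) f \<le> ennreal (C_hoelder \<theta> * (h powr (1 - \<theta>) * k' powr \<theta>))"
      using h k' f by (intro lorentz_1_norm_le_interpolated th) auto
    have "lorentz_inf_norm M (1/\<theta>) (v f) \<le> C * lorentz_1_norm N (1/\<theta>) f" using C(2) f sub by blast
    also have "\<dots> \<le> ennreal k * ennreal (C_hoelder \<theta> * (h powr (1 - \<theta>) * k' powr \<theta>))"
      using C(1) n1 by (intro mult_mono) auto
    also have "\<dots> = ennreal (k * (C_hoelder \<theta> * (h powr (1 - \<theta>) * k' powr \<theta>)))"
      using k C_hoelder_pos[OF th] by (intro ennreal_mult[symmetric]) auto
    finally show "lorentz_inf_norm M (1/\<theta>) (v f) \<le> \<dots>" .
  qed
  interpret dominated_operator N M \<theta> \<kappa> T v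
  proof
    show "lin_op_on N M (Dint N) T" using amb by (simp add: amb_op_def)
    show "AE x in M. 0 \<le> v f x" if "f \<in> Dint N" "AE y in N. 0 \<le> f y" for f
      using v(2) that sub unfolding positive_op_def by blast
    show "AE x in M. \<bar>T f x\<bar> \<le> v (\<lambda>y. \<bar>f y\<bar>) x" if f: "f \<in> Dint N" for f
    proof -
      have "AE x in M. u f x = T f x" using u(2) f by blast
      moreover have "AE x in M. \<bar>u f x\<bar> \<le> v (\<lambda>y. \<bar>f y\<bar>) x" using v(3) f sub by blast
      ultimately show ?thesis by eventually_elim simp
    qed
    fix f assume f: "f \<in> Dint N"
    note m = lin_op_on_measurable[OF linv f]
    show "(\<integral>\<^sup>+x\<in>E. ennreal \<bar>v f x\<bar> \<partial>M) \<le> ennreal (\<kappa> * measure M E powr (1 - \<theta>) * (h powr (1 - \<theta>) * k' powr \<theta>))"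
      if h: "0 < h" and k': "0 < k'" and hb: "AE y in N. \<bar>f y\<bar> \<le> h" and kb: "(\<integral>y. \<bar>f y\<bar> \<partial>N) \<le> k'"
        and E: "E \<in> fmeasurable M" for h k' E
    proof -
      have c0: "0 \<le> k * (C_hoelder \<theta> * (h powr (1 - \<theta>) * k' powr \<theta>))" using k C_hoelder_pos[OF th] by simp
      from weak_bound_integral_nonneg[OF th c0 weak[OF f h hb k' kb] m E] show ?thesis
        by (simp add: \<kappa>_def mult_ac)
    qed
    show "{x \<in> space M. l < \<bar>v f x\<bar>} \<in> fmeasurable M" if l: "0 < l" for l
    proof -
      obtain h where h: "h > 0" "AE y in N. \<bar>f y\<bar> \<le> h" using f by (auto simp: Dint_iff)
      have k': "0 < (\<integral>y. \<bar>f y\<bar> \<partial>N) + 1" by (intro add_nonneg_pos integral_nonneg_AE) auto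
      have "emeasure M {x \<in> space M. l < \<bar>v f x\<bar>}
          \<le> ennreal ((k * (C_hoelder \<theta> * (h powr (1 - \<theta>) * ((\<integral>y. \<bar>f y\<bar> \<partial>N) + 1) powr \<theta>)) / l) powr (1 / \<theta>))"
        using weak[OF f h k'] l unfolding weak_bound_def by simp
      then have "emeasure M {x \<in> space M. l < \<bar>v f x\<bar>} < \<infinity>"
        by (rule le_less_trans) simp
      then show ?thesis using m by (auto simp: fmeasurable_def)
    qed
  qed (use th \<kappa> linv in auto)
  show ?thesis using interp_norm_le by (simp add: \<kappa>_def mult_ac)
qed

text \<open>Lets the strict upper bound K decrease to x. The slack e/C is positive even when x = 0,
  and for infinite x the right-hand side is infinite.\<close>

lemma ennreal_le_cmult_if_le:
  assumes C: "0 < C" and le: "\<And>K. 0 < K \<Longrightarrow> x < ennreal K \<Longrightarrow> y \<le> ennreal (C * K)"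
  shows "y \<le> ennreal C * x"
proof (cases x)
  case (real r)
  have "y \<le> ennreal (C * r)"
  proof (rule ennreal_le_epsilon)
    fix e :: real assume e: "0 < e"
    have "y \<le> ennreal (C * (r + e / C))"
      using real e C by (intro le) (auto simp: ennreal_less_iff add_nonneg_pos)
    also have "C * (r + e / C) = C * r + e" using C by (simp add: field_simps)
    finally show "y \<le> ennreal (C * r) + ennreal e" using real e C by simp
  qed
  then show ?thesis using real C by (simp add: ennreal_mult)
qed (use C in \<open>simp add: ennreal_mult_top\<close>)

theorem theorem4p2:
  fixes M :: "'a measure" and N :: "'b measure" and \<theta> :: real
  assumes "0 < \<theta>" and "\<theta> < 1"
  shows "\<exists>C::real. 0 < C \<and> (\<forall>T. amb_op N M T \<longrightarrow>
            interp_norm N M \<theta> T \<le> ennreal C * Br_norm N M (1/\<theta>) T \<and>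
            Br_norm N M (1/\<theta>) T \<le> ennreal C * interp_norm N M \<theta> T)"
proof -
  note th = assms
  define A where "A = 4 * (C_weak \<theta> * C_hoelder \<theta>)"
  define B where "B = 4 * C_regular \<theta>"
  have A: "0 < A" using C_weak_pos[OF th] C_hoelder_pos[OF th] by (simp add: A_def)
  have B: "0 < B" using C_regular_pos[OF th] by (simp add: B_def)
  have "interp_norm N M \<theta> T \<le> ennreal (A + B) * Br_norm N M (1/\<theta>) T \<and>
      Br_norm N M (1/\<theta>) T \<le> ennreal (A + B) * interp_norm N M \<theta> T" if T: "amb_op N M T" for T
  proof
    have "interp_norm N M \<theta> T \<le> ennreal A * Br_norm N M (1/\<theta>) T"
      using interp_norm_le_Br[OF th T] A by (intro ennreal_le_cmult_if_le) (auto simp: A_def)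
    also have "\<dots> \<le> ennreal (A + B) * Br_norm N M (1/\<theta>) T"
      using A B by (intro mult_right_mono ennreal_leI) auto
    finally show "interp_norm N M \<theta> T \<le> ennreal (A + B) * Br_norm N M (1/\<theta>) T" .
    have "Br_norm N M (1/\<theta>) T \<le> ennreal B * interp_norm N M \<theta> T"
      using Br_norm_le[OF th T] B by (intro ennreal_le_cmult_if_le) (auto simp: B_def)
    also have "\<dots> \<le> ennreal (A + B) * interp_norm N M \<theta> T"
      using A B by (intro mult_right_mono ennreal_leI) auto
    finally show "Br_norm N M (1/\<theta>) T \<le> ennreal (A + B) * interp_norm N M \<theta> T" .
  qed
  then show ?thesis using A B by (intro exI[of _ "A + B"]) auto
qed

end
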